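(* Let $(\mathcal C,\otimes,[-,-],I)$ be a monoidal skew closed category, with $\mathcal C$ a model category, satisfying Axiom MC. Then $(\mathcal C,\otimes,I)$ is homotopy monoidal if and only if the following three conditions are satisfied. 1. For all cofibrant $A$ and fibrant $B$ the function $v:\mathcal C(A,B)\to\mathcal C(I,[A,B])$ is a bijection on homotopy classes of maps. 2. For all fibrant $A$ the map $i:[I,A]\to A$ is a weak equivalence. 3. The transformation $t:[A\otimes B,C]\to[A,[B,C]]$ is a weak equivalence whenever $A$ and $B$ are cofibrant and $C$ is fibrant.
   Context: **Skew monoidal category** $(\mathcal C,\otimes,I,\alpha,l,r)$: a functor $\otimes:\mathcal C\times\mathcal C\to\mathcal C$, an object $I$, and natural (not necessarily invertible) maps $\alpha_{A,B,C}:(A\otimes B)\otimes C\to A\otimes(B\otimes C)$, $l_A:I\otimes A\to A$, $r_A:A\to A\otimes I$ with: $(1\otimes\alpha_{B,C,D})\alpha_{A,B\otimes C,D}(\alpha_{A,B,C}\otimes1)=\alpha_{A,B,C\otimes D}\alpha_{A\otimes B,C,D}$; $l_{B\otimes C}\alpha_{I,B,C}=l_B\otimes1$; $(1\otimes l_C)\alpha_{A,I,C}(r_A\otimes1)=1$; $\alpha_{A,B,I}r_{A\otimes B}=1\otimes r_B$; $l_Ir_I=1$. It is (genuinely) monoidal precisely when $\alpha,l,r$ are invertible. **Skew closed category** $(\mathcal C,[-,-],I,L,i,j)$: a bifunctor $[-,-]:\mathcal C^{op}\times\mathcal C\to\mathcal C$, an object $I$, maps $L=L^A_{B,C}:[B,C]\to[[A,B],[A,C]]$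 natural in $B,C$ and extranatural in $A$, a natural $i_A:[I,A]\to A$, and an extranatural $j_A:I\to[A,A]$, with: (C1) $[L^A_{B,C},1]\circ L^{[A,B]}_{[A,C],[A,D]}\circ L^A_{C,D}=[1,L^A_{B,D}]\circ L^B_{C,D}$; (C2) $i_{[A,C]}\circ[j_A,1]\circ L^A_{A,C}=1$; (C3) $L^A_{B,B}\circ j_B=j_{[A,B]}$; (C4) $[1,i_C]\circ L^I_{B,C}=[i_B,1]$; (C5) $i_I\circ j_I=1$. The function $v:\mathcal C(A,B)\to\mathcal C(I,[A,B])$ is $v(f)=[1,f]\circ j_A$. **Monoidal skew closed category** $(\mathcal C,\otimes,[-,-],I,\phi)$: a skew monoidal and a skew closed structure on $\mathcal C$ with the same $I$ and isomorphisms $\phi:\mathcal C(A\otimes B,C)\cong\mathcal C(A,[B,C])$ natural in each variable, such that: $\phi(f\circ l_A)=[1,f]\circ j_A$ for $f:A\to B$; $g\circ r_A=i_B\circ\phi(g)$ for $g:A\otimes I\to B$; and $\phi(\phi(h\circ\alpha))=t\circ\phi(h)$ for $h:A\otimes(B\otimes C)\to D$. Here $u:A\to[B,A\otimes B]$ is $\phi(1_{A\otimes B})$ and $t_{A,B,C}=[u,1]\circ L:[A\otimes B,C]\to[[B,A\otimes B],[B,C]]\to[A,[B,C]]$. **Model category conventions.** Model categories have functorial factorisations, giving cofibrant and fibrant replacement functors $Q,R$ with natural trivial fibrations $p_A:QA\to A$ and trivial cofibrations $q_A:A\to RA$. **Axiom MC**: for cofibrant $X$ the functor $-\otimes X$ is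 left Quillen (equivalently $[X,-]$ is right Quillen); for each cofibrant $Y$ the functor $Y\otimes-$ preserves weak equivalences between cofibrant objects (equivalently, in the presence of the first condition, for each fibrant $Y$ the functor $[-,Y]$ preserves weak equivalences between cofibrant objects); and $I$ is cofibrant. **Homotopy monoidal.** Under Axiom MC, $\otimes$ preserves cofibrant objects and weak equivalences between them, so $\mathrm{Ho}(\mathcal C)$ has a *left derived* skew monoidal structure $(\mathrm{Ho}(\mathcal C),\otimes_l,I,\alpha_l,l_l,r_l)$ with $A\otimes_lB=QA\otimes QB$, unit $I$, and in $\mathrm{Ho}(\mathcal C)$: $\alpha_l=(1\otimes p)^{-1}\circ\alpha_{QA,QB,QC}\circ(p\otimes1)$; $l_l=p_A\circ l_{QA}\circ(p_I\otimes1)$; $r_l=(1\otimes p_I)^{-1}\circ r_{QA}\circ p_A^{-1}$. $(\mathcal C,\otimes,I)$ is *homotopy monoidal* if $(\mathrm{Ho}(\mathcal C),\otimes_l,I)$ is genuinely monoidal. *)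

theory Defs
  imports Main
begin

section \<open>Categories, functors and adjoints\<close>

text \<open>Composition is written in applicative order, and nothing is assumed about it on pairs of
  arrows that are not composable.\<close>

record ('o, 'a) cat =
  Obj :: "'o set"
  Arr :: "'a set"
  Dom :: "'a \<Rightarrow> 'o"
  Cod :: "'a \<Rightarrow> 'o"
  Id :: "'o \<Rightarrow> 'a"
  Comp :: "'a \<Rightarrow> 'a \<Rightarrow> 'a" (infixl "\<cdot>\<index>" 55)

definition hom :: "('o, 'a) cat \<Rightarrow> 'o \<Rightarrow> 'o \<Rightarrow> 'a set" where
  "hom \<C> A B = {f \<in> Arr \<C>. Dom \<C> f = A \<and> Cod \<C> f = B}"

locale category =
  fixes \<C> :: "('o, 'a) cat" (structure)
  assumes Dom_Obj: "f \<in> Arr \<C> \<Longrightarrow> Dom \<C> f \<in> Obj \<C>"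
    and Cod_Obj: "f \<in> Arr \<C> \<Longrightarrow> Cod \<C> f \<in> Obj \<C>"
    and Id_hom: "A \<in> Obj \<C> \<Longrightarrow> Id \<C> A \<in> hom \<C> A A"
    and Comp_hom: "f \<in> hom \<C> A B \<Longrightarrow> g \<in> hom \<C> B D \<Longrightarrow> g \<cdot> f \<in> hom \<C> A D"
    and Comp_Id: "f \<in> hom \<C> A B \<Longrightarrow> f \<cdot> Id \<C> A = f"
    and Id_Comp: "f \<in> hom \<C> A B \<Longrightarrow> Id \<C> B \<cdot> f = f"
    and Comp_assoc: "f \<in> hom \<C> A B \<Longrightarrow> g \<in> hom \<C> B D \<Longrightarrow> h \<in> hom \<C> D E
      \<Longrightarrow> h \<cdot> (g \<cdot> f) = (h \<cdot> g) \<cdot> f"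

definition op_cat :: "('o, 'a) cat \<Rightarrow> ('o, 'a) cat" where
  "op_cat \<C> = \<lparr>Obj = Obj \<C>, Arr = Arr \<C>, Dom = Cod \<C>, Cod = Dom \<C>, Id = Id \<C>,
     Comp = (\<lambda>g f. f \<cdot>\<^bsub>\<C>\<^esub> g)\<rparr>"

definition prod_cat :: "('o, 'a) cat \<Rightarrow> ('p, 'b) cat \<Rightarrow> ('o \<times> 'p, 'a \<times> 'b) cat" where
  "prod_cat \<C> \<D> = \<lparr>Obj = Obj \<C> \<times> Obj \<D>, Arr = Arr \<C> \<times> Arr \<D>,
     Dom = map_prod (Dom \<C>) (Dom \<D>), Cod = map_prod (Cod \<C>) (Cod \<D>),
     Id = map_prod (Id \<C>) (Id \<D>),
     Comp = (\<lambda>g f. (fst g \<cdot>\<^bsub>\<C>\<^esub> fst f, snd g \<cdot>\<^bsub>\<D>\<^esub> snd f))\<rparr>"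

definition inverse_arrows :: "('o, 'a) cat \<Rightarrow> 'a \<Rightarrow> 'a \<Rightarrow> bool" where
  "inverse_arrows \<C> f g \<longleftrightarrow> (\<exists>A B. f \<in> hom \<C> A B \<and> g \<in> hom \<C> B A \<and>
     g \<cdot>\<^bsub>\<C>\<^esub> f = Id \<C> A \<and> f \<cdot>\<^bsub>\<C>\<^esub> g = Id \<C> B)"

definition is_iso :: "('o, 'a) cat \<Rightarrow> 'a \<Rightarrow> bool" where
  "is_iso \<C> f \<longleftrightarrow> (\<exists>g. inverse_arrows \<C> f g)"

definition inv_arr :: "('o, 'a) cat \<Rightarrow> 'a \<Rightarrow> 'a" where
  "inv_arr \<C> f = (THE g. inverse_arrows \<C> f g)"

record ('o, 'a, 'p, 'b) func =
  ob :: "'o \<Rightarrow> 'p"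
  ar :: "'a \<Rightarrow> 'b"

definition is_functor :: "('o, 'a) cat \<Rightarrow> ('p, 'b) cat \<Rightarrow> ('o, 'a, 'p, 'b) func \<Rightarrow> bool" where
  "is_functor \<C> \<D> F \<longleftrightarrow> category \<C> \<and> category \<D> \<and>
     (\<forall>A\<in>Obj \<C>. ob F A \<in> Obj \<D>) \<and>
     (\<forall>A B. \<forall>f\<in>hom \<C> A B. ar F f \<in> hom \<D> (ob F A) (ob F B)) \<and>
     (\<forall>A\<in>Obj \<C>. ar F (Id \<C> A) = Id \<D> (ob F A)) \<and>
     (\<forall>A B D. \<forall>f\<in>hom \<C> A B. \<forall>g\<in>hom \<C> B D. ar F (g \<cdot>\<^bsub>\<C>\<^esub> f) = ar F g \<cdot>\<^bsub>\<D>\<^esub> ar F f)"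

definition is_left_adjoint :: "('o, 'a) cat \<Rightarrow> ('p, 'b) cat \<Rightarrow> ('o, 'a, 'p, 'b) func \<Rightarrow> bool" where
  "is_left_adjoint \<C> \<D> F \<longleftrightarrow> is_functor \<C> \<D> F \<and>
     (\<exists>(G :: ('p, 'b, 'o, 'a) func) \<theta>. is_functor \<D> \<C> G \<and>
       (\<forall>A\<in>Obj \<C>. \<forall>B\<in>Obj \<D>. bij_betw (\<theta> A B) (hom \<D> (ob F A) B) (hom \<C> A (ob G B))) \<and>
       (\<forall>A A' B B'. \<forall>a\<in>hom \<C> A' A. \<forall>b\<in>hom \<D> B B'. \<forall>f\<in>hom \<D> (ob F A) B.
          \<theta> A' B' (b \<cdot>\<^bsub>\<D>\<^esub> f \<cdot>\<^bsub>\<D>\<^esub> ar F a) = ar G b \<cdot>\<^bsub>\<C>\<^esub> \<theta> A B f \<cdot>\<^bsub>\<C>\<^esub> a))"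


section \<open>Limits and colimits\<close>

definition is_cone :: "('i, 'k) cat \<Rightarrow> ('o, 'a) cat \<Rightarrow> ('i, 'k, 'o, 'a) func \<Rightarrow> 'o \<Rightarrow> ('i \<Rightarrow> 'a) \<Rightarrow> bool" where
  "is_cone \<J> \<C> D X \<tau> \<longleftrightarrow> X \<in> Obj \<C> \<and> (\<forall>k\<in>Obj \<J>. \<tau> k \<in> hom \<C> X (ob D k)) \<and>
     (\<forall>k k'. \<forall>u\<in>hom \<J> k k'. ar D u \<cdot>\<^bsub>\<C>\<^esub> \<tau> k = \<tau> k')"

definition is_limit :: "('i, 'k) cat \<Rightarrow> ('o, 'a) cat \<Rightarrow> ('i, 'k, 'o, 'a) func \<Rightarrow> 'o \<Rightarrow> ('i \<Rightarrow> 'a) \<Rightarrow> bool" where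
  "is_limit \<J> \<C> D X \<tau> \<longleftrightarrow> is_cone \<J> \<C> D X \<tau> \<and>
     (\<forall>Y \<sigma>. is_cone \<J> \<C> D Y \<sigma> \<longrightarrow> (\<exists>!h. h \<in> hom \<C> Y X \<and> (\<forall>k\<in>Obj \<J>. \<tau> k \<cdot>\<^bsub>\<C>\<^esub> h = \<sigma> k)))"

text \<open>Every finite category is isomorphic to one whose objects and arrows are natural numbers.\<close>

definition has_finite_limits :: "('o, 'a) cat \<Rightarrow> bool" where
  "has_finite_limits \<C> \<longleftrightarrow> (\<forall>(\<J> :: (nat, nat) cat) D.
     finite (Obj \<J>) \<and> finite (Arr \<J>) \<and> is_functor \<J> \<C> D \<longrightarrow> (\<exists>X \<tau>. is_limit \<J> \<C> D X \<tau>))"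

definition has_finite_colimits :: "('o, 'a) cat \<Rightarrow> bool" where
  "has_finite_colimits \<C> \<longleftrightarrow> has_finite_limits (op_cat \<C>)"

definition is_initial :: "('o, 'a) cat \<Rightarrow> 'o \<Rightarrow> bool" where
  "is_initial \<C> X \<longleftrightarrow> X \<in> Obj \<C> \<and> (\<forall>A\<in>Obj \<C>. \<exists>!f. f \<in> hom \<C> X A)"

definition init_obj :: "('o, 'a) cat \<Rightarrow> 'o" where
  "init_obj \<C> = (SOME X. is_initial \<C> X)"

definition from_init :: "('o, 'a) cat \<Rightarrow> 'o \<Rightarrow> 'a" where
  "from_init \<C> A = (THE f. f \<in> hom \<C> (init_obj \<C>) A)"

definition is_coproduct :: "('o, 'a) cat \<Rightarrow> 'o \<Rightarrow> 'o \<Rightarrow> 'o \<Rightarrow> 'a \<Rightarrow> 'a \<Rightarrow> bool" where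
  "is_coproduct \<C> A B X m n \<longleftrightarrow> m \<in> hom \<C> A X \<and> n \<in> hom \<C> B X \<and>
     (\<forall>Y. \<forall>f\<in>hom \<C> A Y. \<forall>g\<in>hom \<C> B Y.
       \<exists>!h. h \<in> hom \<C> X Y \<and> h \<cdot>\<^bsub>\<C>\<^esub> m = f \<and> h \<cdot>\<^bsub>\<C>\<^esub> n = g)"


section \<open>Model categories\<close>

definition is_retract :: "('o, 'a) cat \<Rightarrow> 'a \<Rightarrow> 'a \<Rightarrow> bool" where
  "is_retract \<C> f g \<longleftrightarrow> (\<exists>A B A' B' s s' r r'. f \<in> hom \<C> A B \<and> g \<in> hom \<C> A' B' \<and>
     s \<in> hom \<C> A A' \<and> s' \<in> hom \<C> B B' \<and> r \<in> hom \<C> A' A \<and> r' \<in> hom \<C> B' B \<and>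
     r \<cdot>\<^bsub>\<C>\<^esub> s = Id \<C> A \<and> r' \<cdot>\<^bsub>\<C>\<^esub> s' = Id \<C> B \<and>
     g \<cdot>\<^bsub>\<C>\<^esub> s = s' \<cdot>\<^bsub>\<C>\<^esub> f \<and> f \<cdot>\<^bsub>\<C>\<^esub> r = r' \<cdot>\<^bsub>\<C>\<^esub> g)"

definition has_lifting :: "('o, 'a) cat \<Rightarrow> 'a \<Rightarrow> 'a \<Rightarrow> bool" where
  "has_lifting \<C> m e \<longleftrightarrow> (\<forall>A B X Y. \<forall>u\<in>hom \<C> A X. \<forall>v\<in>hom \<C> B Y.
     m \<in> hom \<C> A B \<and> e \<in> hom \<C> X Y \<and> e \<cdot>\<^bsub>\<C>\<^esub> u = v \<cdot>\<^bsub>\<C>\<^esub> m \<longrightarrow>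
     (\<exists>d\<in>hom \<C> B X. d \<cdot>\<^bsub>\<C>\<^esub> m = u \<and> e \<cdot>\<^bsub>\<C>\<^esub> d = v))"

text \<open>A functorial factorisation sends an arrow \<open>f\<close> to
  \<open>Dom f \<rightarrow> mid f \<rightarrow> Cod f\<close>, with composite \<open>f\<close>, and a commutative square \<open>(u, v)\<close> from \<open>f\<close> to \<open>g\<close>
  to an arrow \<open>mmap f g u v : mid f \<rightarrow> mid g\<close>.\<close>

record ('o, 'a) ffact =
  mid :: "'a \<Rightarrow> 'o"
  lft :: "'a \<Rightarrow> 'a"
  rgt :: "'a \<Rightarrow> 'a"
  mmap :: "'a \<Rightarrow> 'a \<Rightarrow> 'a \<Rightarrow> 'a \<Rightarrow> 'a"

definition is_square :: "('o, 'a) cat \<Rightarrow> 'a \<Rightarrow> 'a \<Rightarrow> 'a \<Rightarrow> 'a \<Rightarrow> bool" where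
  "is_square \<C> f g u v \<longleftrightarrow> f \<in> Arr \<C> \<and> g \<in> Arr \<C> \<and> u \<in> hom \<C> (Dom \<C> f) (Dom \<C> g) \<and>
     v \<in> hom \<C> (Cod \<C> f) (Cod \<C> g) \<and> v \<cdot>\<^bsub>\<C>\<^esub> f = g \<cdot>\<^bsub>\<C>\<^esub> u"

definition functorial_factorisation ::
    "('o, 'a) cat \<Rightarrow> 'a set \<Rightarrow> 'a set \<Rightarrow> ('o, 'a) ffact \<Rightarrow> bool" where
  "functorial_factorisation \<C> \<L> \<R> \<Phi> \<longleftrightarrow>
     (\<forall>f\<in>Arr \<C>. lft \<Phi> f \<in> hom \<C> (Dom \<C> f) (mid \<Phi> f) \<inter> \<L> \<and>
        rgt \<Phi> f \<in> hom \<C> (mid \<Phi> f) (Cod \<C> f) \<inter> \<R> \<and> rgt \<Phi> f \<cdot>\<^bsub>\<C>\<^esub> lft \<Phi> f = f) \<and>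
     (\<forall>f g u v. is_square \<C> f g u v \<longrightarrow> mmap \<Phi> f g u v \<in> hom \<C> (mid \<Phi> f) (mid \<Phi> g) \<and>
        mmap \<Phi> f g u v \<cdot>\<^bsub>\<C>\<^esub> lft \<Phi> f = lft \<Phi> g \<cdot>\<^bsub>\<C>\<^esub> u \<and>
        rgt \<Phi> g \<cdot>\<^bsub>\<C>\<^esub> mmap \<Phi> f g u v = v \<cdot>\<^bsub>\<C>\<^esub> rgt \<Phi> f) \<and>
     (\<forall>f\<in>Arr \<C>. mmap \<Phi> f f (Id \<C> (Dom \<C> f)) (Id \<C> (Cod \<C> f)) = Id \<C> (mid \<Phi> f)) \<and>
     (\<forall>f g h u v u' v'. is_square \<C> f g u v \<and> is_square \<C> g h u' v' \<longrightarrow>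
        mmap \<Phi> f h (u' \<cdot>\<^bsub>\<C>\<^esub> u) (v' \<cdot>\<^bsub>\<C>\<^esub> v) = mmap \<Phi> g h u' v' \<cdot>\<^bsub>\<C>\<^esub> mmap \<Phi> f g u v)"

text \<open>Quillen's axioms (so only finite limits and colimits are required), with functorial
  factorisations as part of the structure.\<close>

locale model_category = category \<C>
  for \<C> :: "('o, 'a) cat" (structure) +
  fixes W Cof Fib :: "'a set" and \<Phi> \<Psi> :: "('o, 'a) ffact"
  assumes classes: "W \<subseteq> Arr \<C>" "Cof \<subseteq> Arr \<C>" "Fib \<subseteq> Arr \<C>"
    and finite_limits: "has_finite_limits \<C>"
    and finite_colimits: "has_finite_colimits \<C>"
    and W_Comp: "f \<in> hom \<C> A B \<Longrightarrow> g \<in> hom \<C> B D \<Longrightarrow> f \<in> W \<Longrightarrow> g \<in> W \<Longrightarrow> g \<cdot> f \<in> W"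
    and W_cancel_left: "f \<in> hom \<C> A B \<Longrightarrow> g \<in> hom \<C> B D \<Longrightarrow> g \<in> W \<Longrightarrow> g \<cdot> f \<in> W \<Longrightarrow> f \<in> W"
    and W_cancel_right: "f \<in> hom \<C> A B \<Longrightarrow> g \<in> hom \<C> B D \<Longrightarrow> f \<in> W \<Longrightarrow> g \<cdot> f \<in> W \<Longrightarrow> g \<in> W"
    and W_retract: "is_retract \<C> f g \<Longrightarrow> g \<in> W \<Longrightarrow> f \<in> W"
    and Cof_retract: "is_retract \<C> f g \<Longrightarrow> g \<in> Cof \<Longrightarrow> f \<in> Cof"
    and Fib_retract: "is_retract \<C> f g \<Longrightarrow> g \<in> Fib \<Longrightarrow> f \<in> Fib"
    and lift_cof_trivfib: "m \<in> Cof \<Longrightarrow> e \<in> Fib \<inter> W \<Longrightarrow> has_lifting \<C> m e"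
    and lift_trivcof_fib: "m \<in> Cof \<inter> W \<Longrightarrow> e \<in> Fib \<Longrightarrow> has_lifting \<C> m e"
    and fact_cof_trivfib: "functorial_factorisation \<C> Cof (Fib \<inter> W) \<Phi>"
    and fact_trivcof_fib: "functorial_factorisation \<C> (Cof \<inter> W) Fib \<Psi>"

definition cofibrant :: "('o, 'a) cat \<Rightarrow> 'a set \<Rightarrow> 'o \<Rightarrow> bool" where
  "cofibrant \<C> Cof A \<longleftrightarrow> A \<in> Obj \<C> \<and> from_init \<C> A \<in> Cof"

definition fibrant :: "('o, 'a) cat \<Rightarrow> 'a set \<Rightarrow> 'o \<Rightarrow> bool" where
  "fibrant \<C> Fib A \<longleftrightarrow> cofibrant (op_cat \<C>) Fib A"

text \<open>Cofibrant replacement: \<open>QA\<close> is the middle object of the factorisation of \<open>0 \<rightarrow> A\<close>, and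
  \<open>p\<close> is its right-hand part.\<close>

definition cof_repl :: "('o, 'a) cat \<Rightarrow> ('o, 'a) ffact \<Rightarrow> ('o, 'a, 'o, 'a) func" where
  "cof_repl \<C> \<Phi> = \<lparr>ob = (\<lambda>A. mid \<Phi> (from_init \<C> A)),
     ar = (\<lambda>f. mmap \<Phi> (from_init \<C> (Dom \<C> f)) (from_init \<C> (Cod \<C> f)) (Id \<C> (init_obj \<C>)) f)\<rparr>"

definition cof_repl_map :: "('o, 'a) cat \<Rightarrow> ('o, 'a) ffact \<Rightarrow> 'o \<Rightarrow> 'a" where
  "cof_repl_map \<C> \<Phi> A = rgt \<Phi> (from_init \<C> A)"

definition left_quillen ::
    "('o, 'a) cat \<Rightarrow> 'a set \<Rightarrow> 'a set \<Rightarrow> ('p, 'b) cat \<Rightarrow> 'b set \<Rightarrow> 'b set \<Rightarrow> ('o, 'a, 'p, 'b) func \<Rightarrow> bool" where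
  "left_quillen \<C> W Cof \<D> W' Cof' F \<longleftrightarrow> is_left_adjoint \<C> \<D> F \<and>
     (\<forall>f\<in>Cof. ar F f \<in> Cof') \<and> (\<forall>f\<in>Cof \<inter> W. ar F f \<in> Cof' \<inter> W')"


section \<open>Homotopy classes of maps\<close>

text \<open>In a left homotopy, \<open>s \<cdot> c\<close> factors the codiagonal \<open>A + A \<rightarrow> A\<close> as a cofibration followed by a
  weak equivalence, i.e. \<open>K\<close> is a cylinder object for \<open>A\<close>.\<close>

definition left_homotopic :: "('o, 'a) cat \<Rightarrow> 'a set \<Rightarrow> 'a set \<Rightarrow> 'a \<Rightarrow> 'a \<Rightarrow> bool" where
  "left_homotopic \<C> W Cof f g \<longleftrightarrow> (\<exists>A B X m n K c s h.
     f \<in> hom \<C> A B \<and> g \<in> hom \<C> A B \<and> is_coproduct \<C> A A X m n \<and>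
     c \<in> hom \<C> X K \<inter> Cof \<and> s \<in> hom \<C> K A \<inter> W \<and>
     s \<cdot>\<^bsub>\<C>\<^esub> c \<cdot>\<^bsub>\<C>\<^esub> m = Id \<C> A \<and> s \<cdot>\<^bsub>\<C>\<^esub> c \<cdot>\<^bsub>\<C>\<^esub> n = Id \<C> A \<and>
     h \<in> hom \<C> K B \<and> h \<cdot>\<^bsub>\<C>\<^esub> c \<cdot>\<^bsub>\<C>\<^esub> m = f \<and> h \<cdot>\<^bsub>\<C>\<^esub> c \<cdot>\<^bsub>\<C>\<^esub> n = g)"

definition right_homotopic :: "('o, 'a) cat \<Rightarrow> 'a set \<Rightarrow> 'a set \<Rightarrow> 'a \<Rightarrow> 'a \<Rightarrow> bool" where
  "right_homotopic \<C> W Fib f g \<longleftrightarrow> left_homotopic (op_cat \<C>) W Fib f g"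

definition homotopy_rel :: "('o, 'a) cat \<Rightarrow> 'a set \<Rightarrow> 'a set \<Rightarrow> 'a set \<Rightarrow> 'o \<Rightarrow> 'o \<Rightarrow> ('a \<times> 'a) set" where
  "homotopy_rel \<C> W Cof Fib A B = {(f, g). f \<in> hom \<C> A B \<and> g \<in> hom \<C> A B \<and>
     left_homotopic \<C> W Cof f g \<and> right_homotopic \<C> W Fib f g}"

text \<open>The function \<open>F : hom A B \<rightarrow> hom A' B'\<close> induces a (well-defined) bijection on homotopy classes.\<close>

definition bij_on_homotopy_classes ::
    "('o, 'a) cat \<Rightarrow> 'a set \<Rightarrow> 'a set \<Rightarrow> 'a set \<Rightarrow> 'o \<Rightarrow> 'o \<Rightarrow> 'o \<Rightarrow> 'o \<Rightarrow> ('a \<Rightarrow> 'a) \<Rightarrow> bool" where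
  "bij_on_homotopy_classes \<C> W Cof Fib A B A' B' F \<longleftrightarrow>
     (let \<rho> = homotopy_rel \<C> W Cof Fib A B; \<rho>' = homotopy_rel \<C> W Cof Fib A' B' in
      (\<forall>f\<in>hom \<C> A B. F f \<in> hom \<C> A' B') \<and>
      (\<exists>F'. bij_betw F' (hom \<C> A B // \<rho>) (hom \<C> A' B' // \<rho>') \<and>
         (\<forall>f\<in>hom \<C> A B. F' (\<rho> `` {f}) = \<rho>' `` {F f})))"


section \<open>The homotopy category\<close>

text \<open>The homotopy category is the localisation \<open>\<C>[W\<inverse>]\<close>: an arrow is an equivalence class of
  zigzags, with its source and target recorded. Zigzags are listed in the direction of travel, and
  \<open>Bwd w\<close> stands for a weak equivalence traversed backwards.\<close>

datatype 'a step = Fwd 'a | Bwd 'a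

fun is_zigzag :: "('o, 'a) cat \<Rightarrow> 'a set \<Rightarrow> 'o \<Rightarrow> 'a step list \<Rightarrow> 'o \<Rightarrow> bool" where
  "is_zigzag \<C> W A [] B \<longleftrightarrow> A \<in> Obj \<C> \<and> A = B"
| "is_zigzag \<C> W A (Fwd f # zs) B \<longleftrightarrow> f \<in> Arr \<C> \<and> Dom \<C> f = A \<and> is_zigzag \<C> W (Cod \<C> f) zs B"
| "is_zigzag \<C> W A (Bwd w # zs) B \<longleftrightarrow> w \<in> Arr \<C> \<inter> W \<and> Cod \<C> w = A \<and> is_zigzag \<C> W (Dom \<C> w) zs B"

inductive zz_equiv :: "('o, 'a) cat \<Rightarrow> 'a set \<Rightarrow> 'o \<Rightarrow> 'o \<Rightarrow> 'a step list \<Rightarrow> 'a step list \<Rightarrow> bool"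
  for \<C> :: "('o, 'a) cat" and W :: "'a set" where
  zz_refl: "is_zigzag \<C> W A xs B \<Longrightarrow> zz_equiv \<C> W A B xs xs"
| zz_sym: "zz_equiv \<C> W A B xs ys \<Longrightarrow> zz_equiv \<C> W A B ys xs"
| zz_trans: "zz_equiv \<C> W A B xs ys \<Longrightarrow> zz_equiv \<C> W A B ys zs \<Longrightarrow> zz_equiv \<C> W A B xs zs"
| zz_append: "zz_equiv \<C> W A B xs xs' \<Longrightarrow> zz_equiv \<C> W B D ys ys'
    \<Longrightarrow> zz_equiv \<C> W A D (xs @ ys) (xs' @ ys')"
| zz_Id: "A \<in> Obj \<C> \<Longrightarrow> zz_equiv \<C> W A A [Fwd (Id \<C> A)] []"
| zz_Comp: "f \<in> hom \<C> A B \<Longrightarrow> g \<in> hom \<C> B D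
    \<Longrightarrow> zz_equiv \<C> W A D [Fwd f, Fwd g] [Fwd (g \<cdot>\<^bsub>\<C>\<^esub> f)]"
| zz_Fwd_Bwd: "w \<in> hom \<C> A B \<Longrightarrow> w \<in> W \<Longrightarrow> zz_equiv \<C> W A A [Fwd w, Bwd w] []"
| zz_Bwd_Fwd: "w \<in> hom \<C> A B \<Longrightarrow> w \<in> W \<Longrightarrow> zz_equiv \<C> W B B [Bwd w, Fwd w] []"

type_synonym ('o, 'a) ho_arr = "'o \<times> 'a step list set \<times> 'o"

definition ho_class :: "('o, 'a) cat \<Rightarrow> 'a set \<Rightarrow> 'o \<Rightarrow> 'o \<Rightarrow> 'a step list \<Rightarrow> ('o, 'a) ho_arr" where
  "ho_class \<C> W A B xs = (A, {ys. zz_equiv \<C> W A B xs ys}, B)"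

definition ho_cat :: "('o, 'a) cat \<Rightarrow> 'a set \<Rightarrow> ('o, ('o, 'a) ho_arr) cat" where
  "ho_cat \<C> W = \<lparr>Obj = Obj \<C>,
     Arr = {ho_class \<C> W A B xs | A B xs. is_zigzag \<C> W A xs B},
     Dom = (\<lambda>(A, X, B). A),
     Cod = (\<lambda>(A, X, B). B),
     Id = (\<lambda>A. ho_class \<C> W A A []),
     Comp = (\<lambda>(B', Y, D) (A, X, B). (A, {zs. \<exists>xs\<in>X. \<exists>ys\<in>Y. zz_equiv \<C> W A D (xs @ ys) zs}, D))\<rparr>"

definition to_ho :: "('o, 'a) cat \<Rightarrow> 'a set \<Rightarrow> 'a \<Rightarrow> ('o, 'a) ho_arr" where
  "to_ho \<C> W f = ho_class \<C> W (Dom \<C> f) (Cod \<C> f) [Fwd f]"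


section \<open>Skew monoidal and skew closed categories\<close>

text \<open>The tensor is a functor \<open>T\<close> on \<open>\<C> \<times> \<C>\<close>; a subscript \<open>a\<close> marks its action on arrows.
  Likewise for the internal hom \<open>H\<close> below.\<close>

locale category_data =
  fixes \<C> :: "('o, 'a) cat" (structure)
begin

abbreviation ident ("\<one>") where "\<one> \<equiv> Id \<C>"

end

locale skew_monoidal_data = category_data \<C>
  for \<C> :: "('o, 'a) cat" (structure) +
  fixes T :: "('o \<times> 'o, 'a \<times> 'a, 'o, 'a) func"
    and I :: "'o"
    and \<alpha> :: "'o \<Rightarrow> 'o \<Rightarrow> 'o \<Rightarrow> 'a"
    and l :: "'o \<Rightarrow> 'a"
    and r :: "'o \<Rightarrow> 'a"
begin

abbreviation tensor_ob (infixr "\<otimes>" 75) where "A \<otimes> B \<equiv> ob T (A, B)"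
abbreviation tensor_ar (infixr "\<otimes>\<^sub>a" 75) where "f \<otimes>\<^sub>a g \<equiv> ar T (f, g)"

end

locale skew_monoidal = skew_monoidal_data + category +
  assumes tensor_functor: "is_functor (prod_cat \<C> \<C>) \<C> T"
    and unit_Obj: "I \<in> Obj \<C>"
    and \<alpha>_hom: "A \<in> Obj \<C> \<Longrightarrow> B \<in> Obj \<C> \<Longrightarrow> D \<in> Obj \<C>
      \<Longrightarrow> \<alpha> A B D \<in> hom \<C> ((A \<otimes> B) \<otimes> D) (A \<otimes> (B \<otimes> D))"
    and \<alpha>_natural: "f \<in> hom \<C> A A' \<Longrightarrow> g \<in> hom \<C> B B' \<Longrightarrow> h \<in> hom \<C> D D'
      \<Longrightarrow> \<alpha> A' B' D' \<cdot> ((f \<otimes>\<^sub>a g) \<otimes>\<^sub>a h) = (f \<otimes>\<^sub>a (g \<otimes>\<^sub>a h)) \<cdot> \<alpha> A B D"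
    and l_hom: "A \<in> Obj \<C> \<Longrightarrow> l A \<in> hom \<C> (I \<otimes> A) A"
    and l_natural: "f \<in> hom \<C> A B \<Longrightarrow> l B \<cdot> (\<one> I \<otimes>\<^sub>a f) = f \<cdot> l A"
    and r_hom: "A \<in> Obj \<C> \<Longrightarrow> r A \<in> hom \<C> A (A \<otimes> I)"
    and r_natural: "f \<in> hom \<C> A B \<Longrightarrow> r B \<cdot> f = (f \<otimes>\<^sub>a \<one> I) \<cdot> r A"
    and pentagon: "A \<in> Obj \<C> \<Longrightarrow> B \<in> Obj \<C> \<Longrightarrow> D \<in> Obj \<C> \<Longrightarrow> E \<in> Obj \<C>
      \<Longrightarrow> (\<one> A \<otimes>\<^sub>a \<alpha> B D E) \<cdot> \<alpha> A (B \<otimes> D) E \<cdot> (\<alpha> A B D \<otimes>\<^sub>a \<one> E) = \<alpha> A B (D \<otimes> E) \<cdot> \<alpha> (A \<otimes> B) D E"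
    and l_\<alpha>: "B \<in> Obj \<C> \<Longrightarrow> D \<in> Obj \<C> \<Longrightarrow> l (B \<otimes> D) \<cdot> \<alpha> I B D = l B \<otimes>\<^sub>a \<one> D"
    and l_\<alpha>_r: "A \<in> Obj \<C> \<Longrightarrow> D \<in> Obj \<C>
      \<Longrightarrow> (\<one> A \<otimes>\<^sub>a l D) \<cdot> \<alpha> A I D \<cdot> (r A \<otimes>\<^sub>a \<one> D) = \<one> (A \<otimes> D)"
    and \<alpha>_r: "A \<in> Obj \<C> \<Longrightarrow> B \<in> Obj \<C> \<Longrightarrow> \<alpha> A B I \<cdot> r (A \<otimes> B) = \<one> A \<otimes>\<^sub>a r B"
    and l_r: "l I \<cdot> r I = \<one> I"

locale genuinely_monoidal = skew_monoidal +
  assumes \<alpha>_iso: "A \<in> Obj \<C> \<Longrightarrow> B \<in> Obj \<C> \<Longrightarrow> D \<in> Obj \<C> \<Longrightarrow> is_iso \<C> (\<alpha> A B D)"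
    and l_iso: "A \<in> Obj \<C> \<Longrightarrow> is_iso \<C> (l A)"
    and r_iso: "A \<in> Obj \<C> \<Longrightarrow> is_iso \<C> (r A)"

locale skew_closed_data = category_data \<C>
  for \<C> :: "('o, 'a) cat" (structure) +
  fixes H :: "('o \<times> 'o, 'a \<times> 'a, 'o, 'a) func"
    and I :: "'o"
    and L :: "'o \<Rightarrow> 'o \<Rightarrow> 'o \<Rightarrow> 'a"
    and i :: "'o \<Rightarrow> 'a"
    and j :: "'o \<Rightarrow> 'a"
begin

abbreviation hom_ob ("\<lbrace>_,/ _\<rbrace>") where "\<lbrace>A, B\<rbrace> \<equiv> ob H (A, B)"
abbreviation hom_ar ("\<lbrace>_,/ _\<rbrace>\<^sub>a") where "\<lbrace>f, g\<rbrace>\<^sub>a \<equiv> ar H (f, g)"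

end

text \<open>\<open>L A B D\<close> is \<open>L\<close> with superscript \<open>A\<close> and subscripts \<open>B, D\<close>.\<close>

locale skew_closed = skew_closed_data + category +
  assumes hom_functor: "is_functor (prod_cat (op_cat \<C>) \<C>) \<C> H"
    and unit_Obj: "I \<in> Obj \<C>"
    and L_hom: "A \<in> Obj \<C> \<Longrightarrow> B \<in> Obj \<C> \<Longrightarrow> D \<in> Obj \<C>
      \<Longrightarrow> L A B D \<in> hom \<C> \<lbrace>B, D\<rbrace> \<lbrace>\<lbrace>A, B\<rbrace>, \<lbrace>A, D\<rbrace>\<rbrace>"
    and L_natural: "A \<in> Obj \<C> \<Longrightarrow> f \<in> hom \<C> B' B \<Longrightarrow> g \<in> hom \<C> D D'
      \<Longrightarrow> L A B' D' \<cdot> \<lbrace>f, g\<rbrace>\<^sub>a = \<lbrace>\<lbrace>\<one> A, f\<rbrace>\<^sub>a, \<lbrace>\<one> A, g\<rbrace>\<^sub>a\<rbrace>\<^sub>a \<cdot> L A B D"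
    and L_extranatural: "f \<in> hom \<C> A A' \<Longrightarrow> B \<in> Obj \<C> \<Longrightarrow> D \<in> Obj \<C>
      \<Longrightarrow> \<lbrace>\<lbrace>f, \<one> B\<rbrace>\<^sub>a, \<one> \<lbrace>A, D\<rbrace>\<rbrace>\<^sub>a \<cdot> L A B D = \<lbrace>\<one> \<lbrace>A', B\<rbrace>, \<lbrace>f, \<one> D\<rbrace>\<^sub>a\<rbrace>\<^sub>a \<cdot> L A' B D"
    and i_hom: "A \<in> Obj \<C> \<Longrightarrow> i A \<in> hom \<C> \<lbrace>I, A\<rbrace> A"
    and i_natural: "f \<in> hom \<C> A B \<Longrightarrow> i B \<cdot> \<lbrace>\<one> I, f\<rbrace>\<^sub>a = f \<cdot> i A"
    and j_hom: "A \<in> Obj \<C> \<Longrightarrow> j A \<in> hom \<C> I \<lbrace>A, A\<rbrace>"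
    and j_extranatural: "f \<in> hom \<C> A B \<Longrightarrow> \<lbrace>f, \<one> B\<rbrace>\<^sub>a \<cdot> j B = \<lbrace>\<one> A, f\<rbrace>\<^sub>a \<cdot> j A"
    and C1: "A \<in> Obj \<C> \<Longrightarrow> B \<in> Obj \<C> \<Longrightarrow> D \<in> Obj \<C> \<Longrightarrow> E \<in> Obj \<C>
      \<Longrightarrow> \<lbrace>L A B D, \<one> \<lbrace>\<lbrace>A, B\<rbrace>, \<lbrace>A, E\<rbrace>\<rbrace>\<rbrace>\<^sub>a \<cdot> L \<lbrace>A, B\<rbrace> \<lbrace>A, D\<rbrace> \<lbrace>A, E\<rbrace> \<cdot> L A D E
        = \<lbrace>\<one> \<lbrace>B, D\<rbrace>, L A B E\<rbrace>\<^sub>a \<cdot> L B D E"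
    and C2: "A \<in> Obj \<C> \<Longrightarrow> D \<in> Obj \<C>
      \<Longrightarrow> i \<lbrace>A, D\<rbrace> \<cdot> \<lbrace>j A, \<one> \<lbrace>A, D\<rbrace>\<rbrace>\<^sub>a \<cdot> L A A D = \<one> \<lbrace>A, D\<rbrace>"
    and C3: "A \<in> Obj \<C> \<Longrightarrow> B \<in> Obj \<C> \<Longrightarrow> L A B B \<cdot> j B = j \<lbrace>A, B\<rbrace>"
    and C4: "B \<in> Obj \<C> \<Longrightarrow> D \<in> Obj \<C>
      \<Longrightarrow> \<lbrace>\<one> \<lbrace>I, B\<rbrace>, i D\<rbrace>\<^sub>a \<cdot> L I B D = \<lbrace>i B, \<one> D\<rbrace>\<^sub>a"
    and C5: "i I \<cdot> j I = \<one> I"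

definition v_map ::
    "('o, 'a) cat \<Rightarrow> ('o \<times> 'o, 'a \<times> 'a, 'o, 'a) func \<Rightarrow> ('o \<Rightarrow> 'a) \<Rightarrow> 'o \<Rightarrow> 'a \<Rightarrow> 'a" where
  "v_map \<C> H j A f = ar H (Id \<C> A, f) \<cdot>\<^bsub>\<C>\<^esub> j A"

text \<open>\<open>\<phi> A B D\<close> is the bijection from \<open>\<C>(A \<otimes> B, D)\<close> to \<open>\<C>(A, [B, D])\<close>.\<close>

definition u_map ::
    "('o, 'a) cat \<Rightarrow> ('o \<times> 'o, 'a \<times> 'a, 'o, 'a) func \<Rightarrow> ('o \<Rightarrow> 'o \<Rightarrow> 'o \<Rightarrow> 'a \<Rightarrow> 'a) \<Rightarrow> 'o \<Rightarrow> 'o \<Rightarrow> 'a" where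
  "u_map \<C> T \<phi> A B = \<phi> A B (ob T (A, B)) (Id \<C> (ob T (A, B)))"

definition t_map ::
    "('o, 'a) cat \<Rightarrow> ('o \<times> 'o, 'a \<times> 'a, 'o, 'a) func \<Rightarrow> ('o \<times> 'o, 'a \<times> 'a, 'o, 'a) func
      \<Rightarrow> ('o \<Rightarrow> 'o \<Rightarrow> 'o \<Rightarrow> 'a) \<Rightarrow> ('o \<Rightarrow> 'o \<Rightarrow> 'o \<Rightarrow> 'a \<Rightarrow> 'a) \<Rightarrow> 'o \<Rightarrow> 'o \<Rightarrow> 'o \<Rightarrow> 'a" where
  "t_map \<C> T H L \<phi> A B D =
     ar H (u_map \<C> T \<phi> A B, Id \<C> (ob H (B, D))) \<cdot>\<^bsub>\<C>\<^esub> L B (ob T (A, B)) D"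

locale monoidal_skew_closed =
  skew_monoidal \<C> T I \<alpha> l r + skew_closed \<C> H I L i j
  for \<C> :: "('o, 'a) cat" (structure)
    and T H :: "('o \<times> 'o, 'a \<times> 'a, 'o, 'a) func"
    and I :: "'o"
    and \<alpha> :: "'o \<Rightarrow> 'o \<Rightarrow> 'o \<Rightarrow> 'a" and l r :: "'o \<Rightarrow> 'a"
    and L :: "'o \<Rightarrow> 'o \<Rightarrow> 'o \<Rightarrow> 'a" and i j :: "'o \<Rightarrow> 'a" +
  fixes \<phi> :: "'o \<Rightarrow> 'o \<Rightarrow> 'o \<Rightarrow> 'a \<Rightarrow> 'a"
  assumes \<phi>_bij: "A \<in> Obj \<C> \<Longrightarrow> B \<in> Obj \<C> \<Longrightarrow> D \<in> Obj \<C>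
      \<Longrightarrow> bij_betw (\<phi> A B D) (hom \<C> (A \<otimes> B) D) (hom \<C> A \<lbrace>B, D\<rbrace>)"
    and \<phi>_natural: "a \<in> hom \<C> A' A \<Longrightarrow> b \<in> hom \<C> B' B \<Longrightarrow> d \<in> hom \<C> D D' \<Longrightarrow> f \<in> hom \<C> (A \<otimes> B) D
      \<Longrightarrow> \<phi> A' B' D' (d \<cdot> f \<cdot> (a \<otimes>\<^sub>a b)) = \<lbrace>b, d\<rbrace>\<^sub>a \<cdot> \<phi> A B D f \<cdot> a"
    and \<phi>_l: "f \<in> hom \<C> A B \<Longrightarrow> \<phi> I A B (f \<cdot> l A) = v_map \<C> H j A f"
    and \<phi>_r: "A \<in> Obj \<C> \<Longrightarrow> g \<in> hom \<C> (A \<otimes> I) B \<Longrightarrow> g \<cdot> r A = i B \<cdot> \<phi> A I B g"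
    and \<phi>_\<alpha>: "A \<in> Obj \<C> \<Longrightarrow> B \<in> Obj \<C> \<Longrightarrow> D \<in> Obj \<C> \<Longrightarrow> h \<in> hom \<C> (A \<otimes> (B \<otimes> D)) E
      \<Longrightarrow> \<phi> A B \<lbrace>D, E\<rbrace> (\<phi> (A \<otimes> B) D E (h \<cdot> \<alpha> A B D)) = t_map \<C> T H L \<phi> B D E \<cdot> \<phi> A (B \<otimes> D) E h"


section \<open>Axiom MC and the derived skew monoidal structure\<close>

definition axiom_MC ::
    "('o, 'a) cat \<Rightarrow> 'a set \<Rightarrow> 'a set \<Rightarrow> ('o \<times> 'o, 'a \<times> 'a, 'o, 'a) func \<Rightarrow> 'o \<Rightarrow> bool" where
  "axiom_MC \<C> W Cof T I \<longleftrightarrow>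
     (\<forall>X. cofibrant \<C> Cof X \<longrightarrow>
        left_quillen \<C> W Cof \<C> W Cof \<lparr>ob = (\<lambda>A. ob T (A, X)), ar = (\<lambda>f. ar T (f, Id \<C> X))\<rparr>) \<and>
     (\<forall>Y A B. \<forall>w\<in>hom \<C> A B. cofibrant \<C> Cof Y \<and> cofibrant \<C> Cof A \<and> cofibrant \<C> Cof B \<and> w \<in> W
        \<longrightarrow> ar T (Id \<C> Y, w) \<in> W) \<and>
     cofibrant \<C> Cof I"

text \<open>The left derived tensor is the functor on the homotopy category induced by \<open>QA \<otimes> QB\<close>; the
  values below determine it, as the arrows of \<open>Ho \<C> \<times> Ho \<C>\<close> are generated by images of arrows of
  \<open>\<C> \<times> \<C>\<close> and inverses of such.\<close>

definition is_derived_tensor ::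
    "('o, 'a) cat \<Rightarrow> 'a set \<Rightarrow> ('o, 'a) ffact \<Rightarrow> ('o \<times> 'o, 'a \<times> 'a, 'o, 'a) func
      \<Rightarrow> ('o \<times> 'o, ('o, 'a) ho_arr \<times> ('o, 'a) ho_arr, 'o, ('o, 'a) ho_arr) func \<Rightarrow> bool" where
  "is_derived_tensor \<C> W \<Phi> T T\<^sub>l \<longleftrightarrow> (let Q = cof_repl \<C> \<Phi> in
     is_functor (prod_cat (ho_cat \<C> W) (ho_cat \<C> W)) (ho_cat \<C> W) T\<^sub>l \<and>
     (\<forall>A\<in>Obj \<C>. \<forall>B\<in>Obj \<C>. ob T\<^sub>l (A, B) = ob T (ob Q A, ob Q B)) \<and>
     (\<forall>f\<in>Arr \<C>. \<forall>g\<in>Arr \<C>. ar T\<^sub>l (to_ho \<C> W f, to_ho \<C> W g) = to_ho \<C> W (ar T (ar Q f, ar Q g))))"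

definition derived_assoc ::
    "('o, 'a) cat \<Rightarrow> 'a set \<Rightarrow> ('o, 'a) ffact \<Rightarrow> ('o \<times> 'o, 'a \<times> 'a, 'o, 'a) func
      \<Rightarrow> ('o \<Rightarrow> 'o \<Rightarrow> 'o \<Rightarrow> 'a) \<Rightarrow> 'o \<Rightarrow> 'o \<Rightarrow> 'o \<Rightarrow> ('o, 'a) ho_arr" where
  "derived_assoc \<C> W \<Phi> T \<alpha> A B D =
     (let Q = ob (cof_repl \<C> \<Phi>); p = cof_repl_map \<C> \<Phi>; \<gamma> = to_ho \<C> W; Ho = ho_cat \<C> W in
      inv_arr Ho (\<gamma> (ar T (Id \<C> (Q A), p (ob T (Q B, Q D)))))
        \<cdot>\<^bsub>Ho\<^esub> \<gamma> (\<alpha> (Q A) (Q B) (Q D)) \<cdot>\<^bsub>Ho\<^esub> \<gamma> (ar T (p (ob T (Q A, Q B)), Id \<C> (Q D))))"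

definition derived_left_unit ::
    "('o, 'a) cat \<Rightarrow> 'a set \<Rightarrow> ('o, 'a) ffact \<Rightarrow> ('o \<times> 'o, 'a \<times> 'a, 'o, 'a) func \<Rightarrow> 'o
      \<Rightarrow> ('o \<Rightarrow> 'a) \<Rightarrow> 'o \<Rightarrow> ('o, 'a) ho_arr" where
  "derived_left_unit \<C> W \<Phi> T I l A =
     (let Q = ob (cof_repl \<C> \<Phi>); p = cof_repl_map \<C> \<Phi>; \<gamma> = to_ho \<C> W; Ho = ho_cat \<C> W in
      \<gamma> (p A) \<cdot>\<^bsub>Ho\<^esub> \<gamma> (l (Q A)) \<cdot>\<^bsub>Ho\<^esub> \<gamma> (ar T (p I, Id \<C> (Q A))))"

definition derived_right_unit ::
    "('o, 'a) cat \<Rightarrow> 'a set \<Rightarrow> ('o, 'a) ffact \<Rightarrow> ('o \<times> 'o, 'a \<times> 'a, 'o, 'a) func \<Rightarrow> 'o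
      \<Rightarrow> ('o \<Rightarrow> 'a) \<Rightarrow> 'o \<Rightarrow> ('o, 'a) ho_arr" where
  "derived_right_unit \<C> W \<Phi> T I r A =
     (let Q = ob (cof_repl \<C> \<Phi>); p = cof_repl_map \<C> \<Phi>; \<gamma> = to_ho \<C> W; Ho = ho_cat \<C> W in
      inv_arr Ho (\<gamma> (ar T (Id \<C> (Q A), p I))) \<cdot>\<^bsub>Ho\<^esub> \<gamma> (r (Q A)) \<cdot>\<^bsub>Ho\<^esub> inv_arr Ho (\<gamma> (p A)))"

definition homotopy_monoidal ::
    "('o, 'a) cat \<Rightarrow> 'a set \<Rightarrow> ('o, 'a) ffact \<Rightarrow> ('o \<times> 'o, 'a \<times> 'a, 'o, 'a) func \<Rightarrow> 'o
      \<Rightarrow> ('o \<Rightarrow> 'o \<Rightarrow> 'o \<Rightarrow> 'a) \<Rightarrow> ('o \<Rightarrow> 'a) \<Rightarrow> ('o \<Rightarrow> 'a) \<Rightarrow> bool" where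
  "homotopy_monoidal \<C> W \<Phi> T I \<alpha> l r \<longleftrightarrow> (\<exists>T\<^sub>l. is_derived_tensor \<C> W \<Phi> T T\<^sub>l \<and>
     genuinely_monoidal (ho_cat \<C> W) T\<^sub>l I (derived_assoc \<C> W \<Phi> T \<alpha>)
       (derived_left_unit \<C> W \<Phi> T I l) (derived_right_unit \<C> W \<Phi> T I r))"

end

theory Submission
  imports Defs
begin

text \<open>Write \<open>\<gamma> : \<C> \<rightarrow> Ho \<C>\<close> for the localisation. For \<open>A\<close> cofibrant and \<open>B\<close> fibrant, \<open>\<gamma>\<close> identifies
  \<open>Ho \<C>(A, B)\<close> with homotopy classes of maps \<open>A \<rightarrow> B\<close>, and \<open>\<gamma> f\<close> is invertible only if \<open>f\<close> is a weak
  equivalence. Hence a map between cofibrant objects is a weak equivalence iff precomposing with it is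
  bijective on homotopy classes of maps into every fibrant object, and dually. Under Axiom MC, \<open>\<phi>\<close>
  preserves and reflects homotopy, so the identities \<open>\<phi>(f \<circ> l) = v(f)\<close>, \<open>g \<circ> r = i \<circ> \<phi>(g)\<close> and
  \<open>\<phi>(\<phi>(h \<circ> \<alpha>)) = t \<circ> \<phi>(h)\<close> translate the three conditions into: \<open>l\<close>, \<open>r\<close> and \<open>\<alpha>\<close> are weak equivalences at
  cofibrant objects. This in turn says that the derived structure maps are invertible, because they are
  composed of \<open>l\<close>, \<open>r\<close>, \<open>\<alpha>\<close> at objects \<open>QA\<close> and of isomorphisms. As every arrow of \<open>Ho \<C>\<close> is, up to the
  isomorphisms \<open>A \<cong> RQA\<close>, the image of an arrow of \<open>\<C>\<close>, both the derived tensor and its skew monoidal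
  axioms are inherited from \<open>\<C>\<close>.\<close>

section \<open>Categories\<close>

text \<open>The opposite of a model category is again one, so each fact about cofibrations,
  cylinders and left homotopy has a dual about fibrations, path objects and right homotopy. The
  obstacle inside \<open>Ho\<close> is to separate arrows: zigzag classes are given by generators
  and relations, so an equality of classes reveals nothing by itself. An invariant decides it,
  namely the action of zigzags on homotopy classes of maps from a fixed cofibrant object into
  fibrant replacements. A second obstacle is that Axiom MC makes \<open>\<otimes>\<close> preserve
  cofibrant objects but says nothing of fibrant ones. An arrow of \<open>Ho\<close> is therefore
  lifted to a map between bifibrant objects before tensoring, since there \<gamma>-equal maps have
  \<gamma>-equal tensor products, and the result is carried back along weak equivalences. Coherence
  is never computed with the inverses that occur in the derived structure maps: both sides of an
  axiom are mapped by one invertible comparison to the same axiom in \<open>\<C>\<close>, where it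
  is an assumption.\<close>

lemma homD:
  assumes "f \<in> hom \<C> A B"
  shows "f \<in> Arr \<C>" "Dom \<C> f = A" "Cod \<C> f = B"
  using assms by (auto simp: hom_def)

lemma hom_iff: "f \<in> hom \<C> A B \<longleftrightarrow> f \<in> Arr \<C> \<and> Dom \<C> f = A \<and> Cod \<C> f = B"
  by (auto simp: hom_def)

context category
begin

lemma hom_Obj:
  assumes "f \<in> hom \<C> A B"
  shows "A \<in> Obj \<C>" "B \<in> Obj \<C>"
  using assms Dom_Obj Cod_Obj by (auto simp: hom_def)

lemma Dom_Cod_Obj [simp]:
  "f \<in> Arr \<C> \<Longrightarrow> Dom \<C> f \<in> Obj \<C>" "f \<in> Arr \<C> \<Longrightarrow> Cod \<C> f \<in> Obj \<C>"
  by (auto intro: Dom_Obj Cod_Obj)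

lemma Id_simps [simp]:
  assumes "A \<in> Obj \<C>"
  shows "Id \<C> A \<in> Arr \<C>" "Dom \<C> (Id \<C> A) = A" "Cod \<C> (Id \<C> A) = A"
  using Id_hom [OF assms] by (auto simp: hom_def)

lemma Comp_simps [simp]:
  assumes "f \<in> Arr \<C>" "g \<in> Arr \<C>" "Cod \<C> f = Dom \<C> g"
  shows "g \<cdot> f \<in> Arr \<C>" "Dom \<C> (g \<cdot> f) = Dom \<C> f" "Cod \<C> (g \<cdot> f) = Cod \<C> g"
  using Comp_hom [of f "Dom \<C> f" "Dom \<C> g" g "Cod \<C> g"] assms by (auto simp: hom_def)

lemma Comp_Id_simp [simp]: "f \<in> Arr \<C> \<Longrightarrow> Dom \<C> f = A \<Longrightarrow> f \<cdot> Id \<C> A = f"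
  by (rule Comp_Id) (auto simp: hom_def)

lemma Id_Comp_simp [simp]: "f \<in> Arr \<C> \<Longrightarrow> Cod \<C> f = B \<Longrightarrow> Id \<C> B \<cdot> f = f"
  by (rule Id_Comp) (auto simp: hom_def)

lemma Comp_assoc_simp [simp]:
  assumes "f \<in> Arr \<C>" "g \<in> Arr \<C>" "h \<in> Arr \<C>" "Cod \<C> f = Dom \<C> g" "Cod \<C> g = Dom \<C> h"
  shows "(h \<cdot> g) \<cdot> f = h \<cdot> (g \<cdot> f)"
  using Comp_assoc [of f "Dom \<C> f" "Dom \<C> g" g "Dom \<C> h" h "Cod \<C> h"] assms
  by (auto simp: hom_def)

text \<open>Composites are normalised to the right, so an equation for \<open>g \<cdot> f\<close> no
  longer matches inside a longer composite. This form restores the match, and the interchange laws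
  for tensors and for \<gamma> are turned into rewrite rules by it.\<close>

lemma Comp_assoc_subst:
  assumes "g \<cdot> f = k" "f \<in> Arr \<C>" "g \<in> Arr \<C>" "x \<in> Arr \<C>" "Cod \<C> f = Dom \<C> g" "Cod \<C> x = Dom \<C> f"
  shows "g \<cdot> (f \<cdot> x) = k \<cdot> x"
  using assms by (simp flip: Comp_assoc_simp)

lemma inverse_arrows_iff:
  "inverse_arrows \<C> f g \<longleftrightarrow> f \<in> Arr \<C> \<and> g \<in> Arr \<C> \<and> Dom \<C> g = Cod \<C> f \<and> Cod \<C> g = Dom \<C> f \<and>
     g \<cdot> f = Id \<C> (Dom \<C> f) \<and> f \<cdot> g = Id \<C> (Cod \<C> f)"
  by (auto simp: inverse_arrows_def hom_def)

lemma inverse_arrows_unique: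
  assumes "inverse_arrows \<C> f g" "inverse_arrows \<C> f h"
  shows "g = h"
proof -
  have "g = g \<cdot> (f \<cdot> h)" using assms by (simp add: inverse_arrows_iff)
  also have "\<dots> = (g \<cdot> f) \<cdot> h" using assms by (intro Comp_assoc_simp [symmetric]) (auto simp: inverse_arrows_iff)
  also have "\<dots> = h" using assms by (simp add: inverse_arrows_iff)
  finally show ?thesis .
qed

lemma inv_arr_inverse: "is_iso \<C> f \<Longrightarrow> inverse_arrows \<C> f (inv_arr \<C> f)"
  unfolding is_iso_def inv_arr_def
  by (erule exE, rule theI, assumption) (rule inverse_arrows_unique)

lemma is_iso_Arr: "is_iso \<C> f \<Longrightarrow> f \<in> Arr \<C>"
  by (auto simp: is_iso_def inverse_arrows_iff)

lemma inv_arr_simps [simp]: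
  assumes "is_iso \<C> f"
  shows "inv_arr \<C> f \<in> Arr \<C>" "Dom \<C> (inv_arr \<C> f) = Cod \<C> f" "Cod \<C> (inv_arr \<C> f) = Dom \<C> f"
    "inv_arr \<C> f \<cdot> f = Id \<C> (Dom \<C> f)" "f \<cdot> inv_arr \<C> f = Id \<C> (Cod \<C> f)"
  using inv_arr_inverse [OF assms] by (auto simp: inverse_arrows_iff)

lemma inv_arr_cancel [simp]:
  assumes "is_iso \<C> f" "x \<in> Arr \<C>"
  shows "Cod \<C> x = Dom \<C> f \<Longrightarrow> inv_arr \<C> f \<cdot> (f \<cdot> x) = x"
    "Cod \<C> x = Cod \<C> f \<Longrightarrow> f \<cdot> (inv_arr \<C> f \<cdot> x) = x"
  using assms is_iso_Arr [OF assms(1)]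
  by (simp_all flip: Comp_assoc_simp)

lemma is_isoI:
  assumes "f \<in> Arr \<C>" "g \<in> Arr \<C>" "Dom \<C> g = Cod \<C> f" "Cod \<C> g = Dom \<C> f"
     "g \<cdot> f = Id \<C> (Dom \<C> f)" "f \<cdot> g = Id \<C> (Cod \<C> f)"
  shows "is_iso \<C> f"
  using assms by (auto simp: is_iso_def inverse_arrows_iff)

lemma is_iso_Id [simp]: "A \<in> Obj \<C> \<Longrightarrow> is_iso \<C> (Id \<C> A)"
  by (rule is_isoI [of _ "Id \<C> A"]) auto

lemma is_iso_inv [simp]: "is_iso \<C> f \<Longrightarrow> is_iso \<C> (inv_arr \<C> f)"
  using is_iso_Arr [of f] by (intro is_isoI [of "inv_arr \<C> f" f]) auto

lemma is_iso_Comp: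
  assumes "is_iso \<C> f" "is_iso \<C> g" "Cod \<C> f = Dom \<C> g"
  shows "is_iso \<C> (g \<cdot> f)"
  using assms is_iso_Arr [of f] is_iso_Arr [of g]
  by (intro is_isoI [of _ "inv_arr \<C> f \<cdot> inv_arr \<C> g"]) auto

lemma iso_cancel_left:
  assumes "is_iso \<C> f" "x \<in> Arr \<C>" "y \<in> Arr \<C>" "Cod \<C> x = Dom \<C> f" "Cod \<C> y = Dom \<C> f" "f \<cdot> x = f \<cdot> y"
  shows "x = y"
  using assms by (metis inv_arr_cancel(1))

lemma iso_cancel_right:
  assumes "is_iso \<C> f" "x \<in> Arr \<C>" "y \<in> Arr \<C>" "Dom \<C> x = Cod \<C> f" "Dom \<C> y = Cod \<C> f" "x \<cdot> f = y \<cdot> f"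
  shows "x = y"
proof -
  have "x = (x \<cdot> f) \<cdot> inv_arr \<C> f" using assms(1-5) is_iso_Arr [of f] by simp
  also have "\<dots> = (y \<cdot> f) \<cdot> inv_arr \<C> f" using assms(6) by simp
  also have "\<dots> = y" using assms(1-5) is_iso_Arr [of f] by simp
  finally show ?thesis .
qed

lemma is_iso_cancel_right:
  assumes "is_iso \<C> f" "g \<in> Arr \<C>" "Cod \<C> f = Dom \<C> g" "is_iso \<C> (g \<cdot> f)"
  shows "is_iso \<C> g"
proof -
  have "is_iso \<C> ((g \<cdot> f) \<cdot> inv_arr \<C> f)"
    using assms is_iso_Arr [of f] by (rule_tac is_iso_Comp) auto
  moreover have "(g \<cdot> f) \<cdot> inv_arr \<C> f = g" using assms(1-3) is_iso_Arr [of f] by simp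
  ultimately show ?thesis by simp
qed

lemma is_iso_cancel_left:
  assumes "is_iso \<C> g" "f \<in> Arr \<C>" "Cod \<C> f = Dom \<C> g" "is_iso \<C> (g \<cdot> f)"
  shows "is_iso \<C> f"
proof -
  have "is_iso \<C> (inv_arr \<C> g \<cdot> (g \<cdot> f))"
    using assms is_iso_Arr [of g] by (rule_tac is_iso_Comp) auto
  moreover have "inv_arr \<C> g \<cdot> (g \<cdot> f) = f" using assms(1-3) is_iso_Arr [of g] by simp
  ultimately show ?thesis by simp
qed

text \<open>This is the shape of the derived structure maps: the image of \<open>\<alpha>\<close>,
  \<open>l\<close> or \<open>r\<close> between two invertible arrows.\<close>

lemma is_iso_sandwich_iff:
  assumes x: "is_iso \<C> x" and z: "is_iso \<C> z"
    and y: "y \<in> Arr \<C>" "Cod \<C> z = Dom \<C> y" "Cod \<C> y = Dom \<C> x"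
  shows "is_iso \<C> (x \<cdot> y \<cdot> z) \<longleftrightarrow> is_iso \<C> y"
proof -
  note xz = is_iso_Arr [OF x] is_iso_Arr [OF z]
  have "is_iso \<C> (x \<cdot> y \<cdot> z) \<longleftrightarrow> is_iso \<C> (x \<cdot> y)"
    using is_iso_cancel_right [OF z, of "x \<cdot> y"] is_iso_Comp [OF z, of "x \<cdot> y"] xz y by auto
  also have "\<dots> \<longleftrightarrow> is_iso \<C> y"
    using is_iso_cancel_left [OF x, of y] is_iso_Comp [OF _ x, of y] y by auto
  finally show ?thesis .
qed

end

section \<open>Opposite categories, product categories and bifunctors\<close>

lemma op_cat_simps [simp]:
  "Obj (op_cat \<C>) = Obj \<C>" "Arr (op_cat \<C>) = Arr \<C>" "Dom (op_cat \<C>) = Cod \<C>" "Cod (op_cat \<C>) = Dom \<C>"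
  "Id (op_cat \<C>) = Id \<C>" "g \<cdot>\<^bsub>op_cat \<C>\<^esub> f = f \<cdot>\<^bsub>\<C>\<^esub> g"
  by (auto simp: op_cat_def)

lemma hom_op_cat [simp]: "hom (op_cat \<C>) A B = hom \<C> B A"
  by (auto simp: hom_def)

lemma op_op_cat [simp]: "op_cat (op_cat (\<C> :: ('o, 'a) cat)) = \<C>"
  by (simp add: op_cat_def)

lemma (in category) op_category: "category (op_cat \<C>)"
  by unfold_locales (auto simp: hom_def)

lemma prod_cat_simps [simp]:
  "Obj (prod_cat \<C> \<D>) = Obj \<C> \<times> Obj \<D>" "Arr (prod_cat \<C> \<D>) = Arr \<C> \<times> Arr \<D>"
  "Dom (prod_cat \<C> \<D>) = map_prod (Dom \<C>) (Dom \<D>)" "Cod (prod_cat \<C> \<D>) = map_prod (Cod \<C>) (Cod \<D>)"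
  "Id (prod_cat \<C> \<D>) = map_prod (Id \<C>) (Id \<D>)"
  "g \<cdot>\<^bsub>prod_cat \<C> \<D>\<^esub> f = (fst g \<cdot>\<^bsub>\<C>\<^esub> fst f, snd g \<cdot>\<^bsub>\<D>\<^esub> snd f)"
  by (auto simp: prod_cat_def)

lemma prod_category:
  assumes "category \<C>" "category \<D>"
  shows "category (prod_cat \<C> \<D>)"
proof -
  interpret C: category \<C> by fact
  interpret D: category \<D> by fact
  show ?thesis by unfold_locales (auto simp: hom_def)
qed

lemma bifunctorD:
  assumes "is_functor (prod_cat \<C> \<D>) \<E> F"
  shows "A \<in> Obj \<C> \<Longrightarrow> B \<in> Obj \<D> \<Longrightarrow> ob F (A, B) \<in> Obj \<E>"
    and "f \<in> Arr \<C> \<Longrightarrow> g \<in> Arr \<D> \<Longrightarrow> ar F (f, g) \<in> Arr \<E>"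
    and "f \<in> Arr \<C> \<Longrightarrow> g \<in> Arr \<D> \<Longrightarrow> Dom \<E> (ar F (f, g)) = ob F (Dom \<C> f, Dom \<D> g)"
    and "f \<in> Arr \<C> \<Longrightarrow> g \<in> Arr \<D> \<Longrightarrow> Cod \<E> (ar F (f, g)) = ob F (Cod \<C> f, Cod \<D> g)"
    and "A \<in> Obj \<C> \<Longrightarrow> B \<in> Obj \<D> \<Longrightarrow> ar F (Id \<C> A, Id \<D> B) = Id \<E> (ob F (A, B))"
    and "f \<in> Arr \<C> \<Longrightarrow> g \<in> Arr \<D> \<Longrightarrow> f' \<in> Arr \<C> \<Longrightarrow> g' \<in> Arr \<D> \<Longrightarrow> Cod \<C> f = Dom \<C> f' \<Longrightarrow> Cod \<D> g = Dom \<D> g'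
       \<Longrightarrow> ar F (f', g') \<cdot>\<^bsub>\<E>\<^esub> ar F (f, g) = ar F (f' \<cdot>\<^bsub>\<C>\<^esub> f, g' \<cdot>\<^bsub>\<D>\<^esub> g)"
proof -
  have ob: "\<And>X. X \<in> Obj (prod_cat \<C> \<D>) \<Longrightarrow> ob F X \<in> Obj \<E>"
    and ar: "\<And>X Y h. h \<in> hom (prod_cat \<C> \<D>) X Y \<Longrightarrow> ar F h \<in> hom \<E> (ob F X) (ob F Y)"
    and id: "\<And>X. X \<in> Obj (prod_cat \<C> \<D>) \<Longrightarrow> ar F (Id (prod_cat \<C> \<D>) X) = Id \<E> (ob F X)"
    and comp: "\<And>X Y Z h k. h \<in> hom (prod_cat \<C> \<D>) X Y \<Longrightarrow> k \<in> hom (prod_cat \<C> \<D>) Y Z \<Longrightarrow>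
       ar F (k \<cdot>\<^bsub>prod_cat \<C> \<D>\<^esub> h) = ar F k \<cdot>\<^bsub>\<E>\<^esub> ar F h"
    using assms unfolding is_functor_def by blast+
  show "A \<in> Obj \<C> \<Longrightarrow> B \<in> Obj \<D> \<Longrightarrow> ob F (A, B) \<in> Obj \<E>"
    using ob by simp
  show "f \<in> Arr \<C> \<Longrightarrow> g \<in> Arr \<D> \<Longrightarrow> ar F (f, g) \<in> Arr \<E>"
    "f \<in> Arr \<C> \<Longrightarrow> g \<in> Arr \<D> \<Longrightarrow> Dom \<E> (ar F (f, g)) = ob F (Dom \<C> f, Dom \<D> g)"
    "f \<in> Arr \<C> \<Longrightarrow> g \<in> Arr \<D> \<Longrightarrow> Cod \<E> (ar F (f, g)) = ob F (Cod \<C> f, Cod \<D> g)"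
    using ar [of "(f, g)" "(Dom \<C> f, Dom \<D> g)" "(Cod \<C> f, Cod \<D> g)"] by (auto simp: hom_def)
  show "A \<in> Obj \<C> \<Longrightarrow> B \<in> Obj \<D> \<Longrightarrow> ar F (Id \<C> A, Id \<D> B) = Id \<E> (ob F (A, B))"
    using id [of "(A, B)"] by simp
  show "f \<in> Arr \<C> \<Longrightarrow> g \<in> Arr \<D> \<Longrightarrow> f' \<in> Arr \<C> \<Longrightarrow> g' \<in> Arr \<D> \<Longrightarrow> Cod \<C> f = Dom \<C> f' \<Longrightarrow> Cod \<D> g = Dom \<D> g'
       \<Longrightarrow> ar F (f', g') \<cdot>\<^bsub>\<E>\<^esub> ar F (f, g) = ar F (f' \<cdot>\<^bsub>\<C>\<^esub> f, g' \<cdot>\<^bsub>\<D>\<^esub> g)"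
    using comp [of "(f, g)" "(Dom \<C> f, Dom \<D> g)" "(Cod \<C> f, Cod \<D> g)" "(f', g')" "(Cod \<C> f', Cod \<D> g')"]
    by (auto simp: hom_def)
qed

lemma bifunctorI:
  assumes "category \<C>" "category \<D>" "category \<E>"
    and "\<And>A B. A \<in> Obj \<C> \<Longrightarrow> B \<in> Obj \<D> \<Longrightarrow> ob F (A, B) \<in> Obj \<E>"
    and "\<And>f g. f \<in> Arr \<C> \<Longrightarrow> g \<in> Arr \<D> \<Longrightarrow>
       ar F (f, g) \<in> hom \<E> (ob F (Dom \<C> f, Dom \<D> g)) (ob F (Cod \<C> f, Cod \<D> g))"
    and "\<And>A B. A \<in> Obj \<C> \<Longrightarrow> B \<in> Obj \<D> \<Longrightarrow> ar F (Id \<C> A, Id \<D> B) = Id \<E> (ob F (A, B))"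
    and "\<And>f g f' g'. f \<in> Arr \<C> \<Longrightarrow> g \<in> Arr \<D> \<Longrightarrow> f' \<in> Arr \<C> \<Longrightarrow> g' \<in> Arr \<D> \<Longrightarrow>
       Cod \<C> f = Dom \<C> f' \<Longrightarrow> Cod \<D> g = Dom \<D> g' \<Longrightarrow>
       ar F (f' \<cdot>\<^bsub>\<C>\<^esub> f, g' \<cdot>\<^bsub>\<D>\<^esub> g) = ar F (f', g') \<cdot>\<^bsub>\<E>\<^esub> ar F (f, g)"
  shows "is_functor (prod_cat \<C> \<D>) \<E> F"
  unfolding is_functor_def
proof (intro conjI ballI allI)
  show "category (prod_cat \<C> \<D>)" by (rule prod_category) fact+
  show "category \<E>" by fact
  fix X Y Z h k
  show "X \<in> Obj (prod_cat \<C> \<D>) \<Longrightarrow> ob F X \<in> Obj \<E>" using assms(4) by auto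
  show "X \<in> Obj (prod_cat \<C> \<D>) \<Longrightarrow> ar F (Id (prod_cat \<C> \<D>) X) = Id \<E> (ob F X)"
    using assms(6) by (cases X) auto
  show "h \<in> hom (prod_cat \<C> \<D>) X Y \<Longrightarrow> ar F h \<in> hom \<E> (ob F X) (ob F Y)"
    using assms(5) [of "fst h" "snd h"] by (cases h) (auto simp: hom_iff)
  show "h \<in> hom (prod_cat \<C> \<D>) X Y \<Longrightarrow> k \<in> hom (prod_cat \<C> \<D>) Y Z \<Longrightarrow>
       ar F (k \<cdot>\<^bsub>prod_cat \<C> \<D>\<^esub> h) = ar F k \<cdot>\<^bsub>\<E>\<^esub> ar F h"
    using assms(7) [of "fst h" "snd h" "fst k" "snd k"] by (cases h; cases k) (auto simp: hom_iff)
qed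

section \<open>Initial objects and coproducts\<close>

text \<open>An initial object is a limit of the empty diagram in the opposite category.\<close>

lemma (in category) has_initial:
  assumes "has_finite_colimits \<C>"
  shows "\<exists>X. is_initial \<C> X"
proof -
  define \<J> :: "(nat, nat) cat" where
    "\<J> = \<lparr>Obj = {}, Arr = {}, Dom = id, Cod = id, Id = id, Comp = (\<lambda>g f. f)\<rparr>"
  define D :: "(nat, nat, 'o, 'a) func" where "D = \<lparr>ob = (\<lambda>_. undefined), ar = (\<lambda>_. undefined)\<rparr>"
  have "category \<J>" by unfold_locales (auto simp: \<J>_def hom_def)
  then have "is_functor \<J> (op_cat \<C>) D"
    using op_category by (auto simp: is_functor_def \<J>_def hom_def)
  moreover have "finite (Obj \<J>)" "finite (Arr \<J>)" by (auto simp: \<J>_def)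
  ultimately obtain X \<tau> where "is_limit \<J> (op_cat \<C>) D X \<tau>"
    using assms unfolding has_finite_colimits_def has_finite_limits_def by blast
  moreover have "is_cone \<J> (op_cat \<C>) D Y \<sigma> \<longleftrightarrow> Y \<in> Obj \<C>" for Y \<sigma>
    by (auto simp: is_cone_def \<J>_def hom_iff)
  ultimately have "X \<in> Obj \<C>" "\<And>Y. Y \<in> Obj \<C> \<Longrightarrow> \<exists>!h. h \<in> hom \<C> X Y"
    by (auto simp: is_limit_def \<J>_def)
  then have "is_initial \<C> X" by (simp add: is_initial_def)
  then show ?thesis by blast
qed

text \<open>A coproduct is a limit, in the opposite category, of the discrete diagram on two
  objects. The numbers 0 and 1 serve both as the objects and as their identity arrows.\<close>

lemma (in category) has_coproduct:
  assumes "has_finite_colimits \<C>" "A \<in> Obj \<C>" "B \<in> Obj \<C>"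
  obtains X m n where "is_coproduct \<C> A B X m n"
proof -
  define \<J> :: "(nat, nat) cat" where
    "\<J> = \<lparr>Obj = {0, 1}, Arr = {0, 1}, Dom = id, Cod = id, Id = id, Comp = (\<lambda>g f. f)\<rparr>"
  define D :: "(nat, nat, 'o, 'a) func" where
    "D = \<lparr>ob = (\<lambda>k. if k = 0 then A else B), ar = (\<lambda>k. Id \<C> (if k = 0 then A else B))\<rparr>"
  have "category \<J>" by unfold_locales (auto simp: \<J>_def hom_def)
  then have "is_functor \<J> (op_cat \<C>) D"
    using op_category assms by (auto simp: is_functor_def \<J>_def D_def hom_def)
  moreover have "finite (Obj \<J>)" "finite (Arr \<J>)" by (auto simp: \<J>_def)
  ultimately obtain X \<tau> where lim: "is_limit \<J> (op_cat \<C>) D X \<tau>"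
    using assms(1) unfolding has_finite_colimits_def has_finite_limits_def by blast
  have cone: "is_cone \<J> (op_cat \<C>) D Y \<sigma> \<longleftrightarrow> \<sigma> 0 \<in> hom \<C> A Y \<and> \<sigma> 1 \<in> hom \<C> B Y" for Y \<sigma>
    using assms by (auto simp: is_cone_def \<J>_def D_def hom_iff)
  have "is_coproduct \<C> A B X (\<tau> 0) (\<tau> 1)"
    unfolding is_coproduct_def
  proof (intro conjI allI ballI)
    show "\<tau> 0 \<in> hom \<C> A X" "\<tau> 1 \<in> hom \<C> B X" using lim cone by (auto simp: is_limit_def)
    fix Y f g assume "f \<in> hom \<C> A Y" "g \<in> hom \<C> B Y"
    then have "is_cone \<J> (op_cat \<C>) D Y (\<lambda>k. if k = 0 then f else g)" by (simp add: cone)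
    then have "\<exists>!h. h \<in> hom (op_cat \<C>) Y X \<and>
        (\<forall>k\<in>Obj \<J>. \<tau> k \<cdot>\<^bsub>op_cat \<C>\<^esub> h = (if k = 0 then f else g))"
      using lim unfolding is_limit_def by blast
    then show "\<exists>!h. h \<in> hom \<C> X Y \<and> h \<cdot> \<tau> 0 = f \<and> h \<cdot> \<tau> 1 = g"
      by (simp add: \<J>_def)
  qed
  then show ?thesis using that by blast
qed

lemma is_coproduct_swap: "is_coproduct \<C> A B X m n \<Longrightarrow> is_coproduct \<C> B A X n m"
  unfolding is_coproduct_def by (metis (no_types, lifting))

lemma coproduct_copair:
  assumes "is_coproduct \<C> A B X m n" "f \<in> hom \<C> A Y" "g \<in> hom \<C> B Y"
  obtains h where "h \<in> hom \<C> X Y" "h \<cdot>\<^bsub>\<C>\<^esub> m = f" "h \<cdot>\<^bsub>\<C>\<^esub> n = g"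
  using assms unfolding is_coproduct_def by metis

lemma (in category) coproduct_eq:
  assumes X: "is_coproduct \<C> A B X m n" and h: "h \<in> hom \<C> X Y" "k \<in> hom \<C> X Y"
    and "h \<cdot> m = k \<cdot> m" "h \<cdot> n = k \<cdot> n"
  shows "h = k"
proof -
  have "h \<cdot> m \<in> hom \<C> A Y" "h \<cdot> n \<in> hom \<C> B Y"
    using X h Comp_hom unfolding is_coproduct_def by blast+
  then have "\<exists>!h'. h' \<in> hom \<C> X Y \<and> h' \<cdot> m = h \<cdot> m \<and> h' \<cdot> n = h \<cdot> n"
    using X unfolding is_coproduct_def by blast
  then show ?thesis using h assms(4,5) by metis
qed

context category
begin

context
  assumes colim: "has_finite_colimits \<C>"
begin

lemma is_initial_init_obj: "is_initial \<C> (init_obj \<C>)"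
  unfolding init_obj_def using has_initial [OF colim] by (rule someI_ex)

lemma init_obj_Obj: "init_obj \<C> \<in> Obj \<C>"
  using is_initial_init_obj by (simp add: is_initial_def)

lemma from_init_hom: "A \<in> Obj \<C> \<Longrightarrow> from_init \<C> A \<in> hom \<C> (init_obj \<C>) A"
  unfolding from_init_def using is_initial_init_obj unfolding is_initial_def
  by (metis (mono_tags, lifting) theI')

lemma from_init_unique:
  "f \<in> hom \<C> (init_obj \<C>) A \<Longrightarrow> g \<in> hom \<C> (init_obj \<C>) A \<Longrightarrow> f = g"
  using is_initial_init_obj hom_Obj unfolding is_initial_def by metis

end

end

section \<open>Model categories\<close>

lemma is_square_op: "is_square (op_cat \<C>) f g u v \<longleftrightarrow> is_square \<C> g f v u"
  by (auto simp: is_square_def)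

text \<open>Reversing arrows exchanges the two halves of a factorisation, and a square
  \<open>(u, v)\<close> from \<open>f\<close> to \<open>g\<close> becomes the square
  \<open>(v, u)\<close> from \<open>g\<close> to \<open>f\<close>.\<close>

definition op_fact :: "('o, 'a) ffact \<Rightarrow> ('o, 'a) ffact" where
  "op_fact \<Phi> = \<lparr>mid = mid \<Phi>, lft = rgt \<Phi>, rgt = lft \<Phi>, mmap = (\<lambda>f g u v. mmap \<Phi> g f v u)\<rparr>"

lemma functorial_factorisation_op:
  assumes "functorial_factorisation \<C> \<L> \<R> \<Phi>"
  shows "functorial_factorisation (op_cat \<C>) \<R> \<L> (op_fact \<Phi>)"
  using assms unfolding functorial_factorisation_def is_square_op op_fact_def
  by (intro conjI) (simp, simp, simp, simp)

lemma has_lifting_op: "has_lifting (op_cat \<C>) e m \<longleftrightarrow> has_lifting \<C> m e"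
  unfolding has_lifting_def op_cat_simps hom_op_cat by (rule iffI; metis)

lemma is_retract_op: "is_retract (op_cat \<C>) f g \<longleftrightarrow> is_retract \<C> f g"
  unfolding is_retract_def op_cat_simps hom_op_cat by (rule iffI; metis)

lemma has_liftingD:
  assumes "has_lifting \<C> m e" "m \<in> hom \<C> A B" "e \<in> hom \<C> X Y" "u \<in> hom \<C> A X" "v \<in> hom \<C> B Y"
    "e \<cdot>\<^bsub>\<C>\<^esub> u = v \<cdot>\<^bsub>\<C>\<^esub> m"
  obtains d where "d \<in> hom \<C> B X" "d \<cdot>\<^bsub>\<C>\<^esub> m = u" "e \<cdot>\<^bsub>\<C>\<^esub> d = v"
  using assms unfolding has_lifting_def by blast

lemma fact_obtains:
  assumes "functorial_factorisation \<C> \<L> \<R> \<Phi>" "f \<in> hom \<C> A B"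
  obtains K c e where "c \<in> hom \<C> A K" "c \<in> \<L>" "e \<in> hom \<C> K B" "e \<in> \<R>" "e \<cdot>\<^bsub>\<C>\<^esub> c = f"
proof -
  have "f \<in> Arr \<C>" "Dom \<C> f = A" "Cod \<C> f = B" using assms(2) by (auto simp: hom_def)
  then show ?thesis
    using that [of "lft \<Phi> f" "mid \<Phi> f" "rgt \<Phi> f"] assms(1)
    unfolding functorial_factorisation_def by blast
qed

section \<open>Duality, and the classes of maps characterised by lifting\<close>

context model_category
begin

abbreviation cofib where "cofib \<equiv> cofibrant \<C> Cof"
abbreviation fib where "fib \<equiv> fibrant \<C> Fib"
abbreviation left_htp where "left_htp \<equiv> left_homotopic \<C> W Cof"
abbreviation right_htp where "right_htp \<equiv> right_homotopic \<C> W Fib"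

text \<open>The axioms are self-dual once \<open>Cof\<close> is exchanged with \<open>Fib\<close>.
  The factorisations are exchanged too: \<open>\<Psi>\<close> read backwards is a fibration
  followed, in the opposite category, by a trivial cofibration, which is the role that
  \<open>\<Phi>\<close> has in \<open>\<C>\<close>.\<close>

lemma op_model: "model_category (op_cat \<C>) W Fib Cof (op_fact \<Psi>) (op_fact \<Phi>)"
proof (intro model_category.intro model_category_axioms.intro)
  show "category (op_cat \<C>)" by (rule op_category)
  show "W \<subseteq> Arr (op_cat \<C>)" "Fib \<subseteq> Arr (op_cat \<C>)" "Cof \<subseteq> Arr (op_cat \<C>)" using classes by auto
  show "has_finite_limits (op_cat \<C>)" "has_finite_colimits (op_cat \<C>)"
    using finite_limits finite_colimits by (auto simp: has_finite_colimits_def)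
  show "functorial_factorisation (op_cat \<C>) Fib (Cof \<inter> W) (op_fact \<Psi>)"
    "functorial_factorisation (op_cat \<C>) (Fib \<inter> W) Cof (op_fact \<Phi>)"
    using fact_trivcof_fib fact_cof_trivfib by (auto intro: functorial_factorisation_op)
  fix f g A B D
  show "is_retract (op_cat \<C>) f g \<Longrightarrow> g \<in> W \<Longrightarrow> f \<in> W" "is_retract (op_cat \<C>) f g \<Longrightarrow> g \<in> Fib \<Longrightarrow> f \<in> Fib"
    "is_retract (op_cat \<C>) f g \<Longrightarrow> g \<in> Cof \<Longrightarrow> f \<in> Cof"
    unfolding is_retract_op by (fact W_retract Fib_retract Cof_retract)+
  show "f \<in> Fib \<Longrightarrow> g \<in> Cof \<inter> W \<Longrightarrow> has_lifting (op_cat \<C>) f g"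
    "f \<in> Fib \<inter> W \<Longrightarrow> g \<in> Cof \<Longrightarrow> has_lifting (op_cat \<C>) f g"
    unfolding has_lifting_op by (rule lift_trivcof_fib lift_cof_trivfib; assumption)+
  assume "f \<in> hom (op_cat \<C>) A B" "g \<in> hom (op_cat \<C>) B D"
  then have fg: "f \<in> hom \<C> B A" "g \<in> hom \<C> D B" by simp_all
  show "f \<in> W \<Longrightarrow> g \<in> W \<Longrightarrow> g \<cdot>\<^bsub>op_cat \<C>\<^esub> f \<in> W"
    "g \<in> W \<Longrightarrow> g \<cdot>\<^bsub>op_cat \<C>\<^esub> f \<in> W \<Longrightarrow> f \<in> W" "f \<in> W \<Longrightarrow> g \<cdot>\<^bsub>op_cat \<C>\<^esub> f \<in> W \<Longrightarrow> g \<in> W"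
    using W_Comp [OF fg(2,1)] W_cancel_left [OF fg(2,1)] W_cancel_right [OF fg(2,1)] by simp_all
qed

text \<open>A lift \<open>d\<close> in the square with top \<open>c\<close> and bottom the identity
  of \<open>B\<close> is a section of \<open>e\<close> under \<open>A\<close>. With identities on
  the sources, \<open>d\<close> and \<open>e\<close> exhibit \<open>m\<close> as a retract of
  \<open>c\<close>.\<close>

lemma retract_argument:
  assumes m: "m \<in> hom \<C> A B" and c: "c \<in> hom \<C> A K" and e: "e \<in> hom \<C> K B" and "e \<cdot> c = m"
    and "has_lifting \<C> m e"
  shows "is_retract \<C> m c"
proof -
  have "e \<cdot> c = Id \<C> B \<cdot> m" using assms by (simp add: Id_Comp)
  then obtain d where d: "d \<in> hom \<C> B K" "d \<cdot> m = c" "e \<cdot> d = Id \<C> B"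
    using has_liftingD [OF assms(5) m e c Id_hom] hom_Obj [OF m] by blast
  have "Id \<C> A \<in> hom \<C> A A" "Id \<C> A \<cdot> Id \<C> A = Id \<C> A" "c \<cdot> Id \<C> A = d \<cdot> m" "m \<cdot> Id \<C> A = e \<cdot> c"
    using Id_hom Comp_Id m c d(2) hom_Obj [OF m] assms(4) by auto
  then show ?thesis unfolding is_retract_def using m c e d by blast
qed

text \<open>Factor \<open>m\<close> and lift it against its own right half; the retract argument
  then makes \<open>m\<close> a retract of its left half.\<close>

lemma has_lifting_factI:
  assumes "m \<in> Arr \<C>" "functorial_factorisation \<C> \<L> \<R> F" "\<forall>e\<in>\<R>. has_lifting \<C> m e"
    "\<And>f g. is_retract \<C> f g \<Longrightarrow> g \<in> \<L> \<Longrightarrow> f \<in> \<L>"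
  shows "m \<in> \<L>"
proof -
  have m: "m \<in> hom \<C> (Dom \<C> m) (Cod \<C> m)" using assms by (auto simp: hom_def)
  obtain K c e where "c \<in> hom \<C> (Dom \<C> m) K" "c \<in> \<L>" "e \<in> hom \<C> K (Cod \<C> m)" "e \<in> \<R>" "e \<cdot> c = m"
    using fact_obtains [OF assms(2) m] by metis
  then show ?thesis using retract_argument [OF m] assms(3,4) by blast
qed

lemma Cof_iff: "m \<in> Cof \<longleftrightarrow> m \<in> Arr \<C> \<and> (\<forall>e\<in>Fib \<inter> W. has_lifting \<C> m e)"
  using has_lifting_factI [OF _ fact_cof_trivfib] classes lift_cof_trivfib Cof_retract by blast

lemma trivial_Cof_iff: "m \<in> Cof \<inter> W \<longleftrightarrow> m \<in> Arr \<C> \<and> (\<forall>e\<in>Fib. has_lifting \<C> m e)"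
proof
  assume "m \<in> Arr \<C> \<and> (\<forall>e\<in>Fib. has_lifting \<C> m e)"
  then show "m \<in> Cof \<inter> W"
    using has_lifting_factI [OF _ fact_trivcof_fib] Cof_retract W_retract by blast
qed (use classes lift_trivcof_fib in auto)

lemma Fib_iff: "e \<in> Fib \<longleftrightarrow> e \<in> Arr \<C> \<and> (\<forall>m\<in>Cof \<inter> W. has_lifting \<C> m e)"
  using model_category.Cof_iff [OF op_model, of e] by (simp add: has_lifting_op)

lemma trivial_Fib_iff: "e \<in> Fib \<inter> W \<longleftrightarrow> e \<in> Arr \<C> \<and> (\<forall>m\<in>Cof. has_lifting \<C> m e)"
  using model_category.trivial_Cof_iff [OF op_model, of e] by (simp add: has_lifting_op)

lemma has_lifting_Id: "A \<in> Obj \<C> \<Longrightarrow> has_lifting \<C> (Id \<C> A) e"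
  unfolding has_lifting_def
  by (auto simp: hom_iff intro!: bexI)

text \<open>The axioms do not list identities. An identity lifts against every arrow, so it is a
  trivial cofibration, and in the opposite category the same gives a fibration.\<close>

lemma Id_classes:
  assumes "A \<in> Obj \<C>"
  shows "Id \<C> A \<in> W" "Id \<C> A \<in> Cof" "Id \<C> A \<in> Fib"
proof -
  show "Id \<C> A \<in> W" "Id \<C> A \<in> Cof"
    using trivial_Cof_iff [of "Id \<C> A"] has_lifting_Id [OF assms] assms by auto
  show "Id \<C> A \<in> Fib" using Fib_iff [of "Id \<C> A"]
      category.Id_simps [OF op_category] model_category.has_lifting_Id [OF op_model] assms
    by (simp add: has_lifting_op)
qed

lemma weq_square:
  assumes "f \<in> hom \<C> A B" "g \<in> hom \<C> A' B'" "u \<in> hom \<C> A A'" "v \<in> hom \<C> B B'" "u \<in> W" "v \<in> W" "g \<cdot> u = v \<cdot> f" "f \<in> W"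
  shows "g \<in> W"
  using W_cancel_right [OF assms(3,2)] W_Comp [OF assms(1,4)] assms by simp

lemma has_lifting_Comp:
  assumes m: "m \<in> hom \<C> A B" "n \<in> hom \<C> B D" and lift: "has_lifting \<C> m e" "has_lifting \<C> n e"
  shows "has_lifting \<C> (n \<cdot> m) e"
  unfolding has_lifting_def
proof (intro allI ballI impI; elim conjE)
  fix A' D' X Y u v
  assume u: "u \<in> hom \<C> A' X" and v: "v \<in> hom \<C> D' Y" and nm: "n \<cdot> m \<in> hom \<C> A' D'"
    and e: "e \<in> hom \<C> X Y" and eq: "e \<cdot> u = v \<cdot> (n \<cdot> m)"
  have [simp]: "A' = A" "D' = D" using nm m Comp_hom [OF m] by (auto simp: hom_iff)
  have v': "v \<cdot> n \<in> hom \<C> B Y" "e \<cdot> u = (v \<cdot> n) \<cdot> m"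
    using v m eq by (auto simp: hom_iff)
  obtain d where d: "d \<in> hom \<C> B X" "d \<cdot> m = u" "e \<cdot> d = v \<cdot> n"
    using has_liftingD [OF lift(1) m(1) e _ v'(1)] u v'(2) by auto
  obtain d' where d': "d' \<in> hom \<C> D X" "d' \<cdot> n = d" "e \<cdot> d' = v"
    using has_liftingD [OF lift(2) m(2) e d(1)] v d(3) by auto
  have "d' \<cdot> (n \<cdot> m) = u" using d' d m Comp_assoc by metis
  then show "\<exists>d\<in>hom \<C> D' X. d \<cdot> (n \<cdot> m) = u \<and> e \<cdot> d = v" using d' by auto
qed

lemma Cof_Comp: "m \<in> hom \<C> A B \<Longrightarrow> n \<in> hom \<C> B D \<Longrightarrow> m \<in> Cof \<Longrightarrow> n \<in> Cof \<Longrightarrow> n \<cdot> m \<in> Cof"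
  using has_lifting_Comp [of m A B n D] Comp_hom [of m A B n D] by (auto simp: Cof_iff hom_iff)

text \<open>A lifting square against the map from the initial object commutes automatically, and so
  does the upper triangle of a candidate lift. What remains is to lift maps out of \<open>A\<close>
  through trivial fibrations, and this form can be transposed along \<open>\<phi>\<close>.\<close>

lemma cofibrant_iff:
  "cofib A \<longleftrightarrow> A \<in> Obj \<C> \<and>
     (\<forall>X Y. \<forall>e\<in>hom \<C> X Y \<inter> Fib \<inter> W. \<forall>v\<in>hom \<C> A Y. \<exists>d\<in>hom \<C> A X. e \<cdot> d = v)"
proof (cases "A \<in> Obj \<C>")
  case True
  note i = from_init_hom [OF finite_colimits] from_init_unique [OF finite_colimits]
  have "from_init \<C> A \<in> Cof \<longleftrightarrow> (\<forall>e\<in>Fib \<inter> W. has_lifting \<C> (from_init \<C> A) e)"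
    using Cof_iff i(1) [OF True] by (auto simp: hom_iff)
  also have "\<dots> \<longleftrightarrow> (\<forall>X Y. \<forall>e\<in>hom \<C> X Y \<inter> Fib \<inter> W. \<forall>v\<in>hom \<C> A Y. \<exists>d\<in>hom \<C> A X. e \<cdot> d = v)"
  proof (intro iffI allI ballI)
    fix X Y e v assume *: "\<forall>e\<in>Fib \<inter> W. has_lifting \<C> (from_init \<C> A) e"
      and e: "e \<in> hom \<C> X Y \<inter> Fib \<inter> W" and v: "v \<in> hom \<C> A Y"
    have X: "X \<in> Obj \<C>" using e hom_Obj by blast
    have "e \<cdot> from_init \<C> X = v \<cdot> from_init \<C> A"
      using e v i(1) [OF X] i(1) [OF True] by (intro i(2) [of _ Y]) (auto intro: Comp_hom)
    then show "\<exists>d\<in>hom \<C> A X. e \<cdot> d = v"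
      using has_liftingD [OF _ i(1) [OF True] _ i(1) [OF X] v] * e by blast
  next
    fix e assume *: "\<forall>X Y. \<forall>e\<in>hom \<C> X Y \<inter> Fib \<inter> W. \<forall>v\<in>hom \<C> A Y. \<exists>d\<in>hom \<C> A X. e \<cdot> d = v"
      and e: "e \<in> Fib \<inter> W"
    show "has_lifting \<C> (from_init \<C> A) e" unfolding has_lifting_def
    proof (intro allI ballI impI; elim conjE)
      fix Z B X Y u v assume h: "u \<in> hom \<C> Z X" "v \<in> hom \<C> B Y" "from_init \<C> A \<in> hom \<C> Z B" "e \<in> hom \<C> X Y"
      then have [simp]: "Z = init_obj \<C>" "B = A" using i(1) [OF True] by (auto simp: hom_iff)
      obtain d where d: "d \<in> hom \<C> A X" "e \<cdot> d = v" using * e h by fastforce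
      have "d \<cdot> from_init \<C> A = u" using d h by (intro i(2)) (auto intro: Comp_hom)
      then show "\<exists>d\<in>hom \<C> B X. d \<cdot> from_init \<C> A = u \<and> e \<cdot> d = v" using d by auto
    qed
  qed
  finally show ?thesis using True by (simp add: cofibrant_def)
qed (simp add: cofibrant_def)

lemma cofibrant_Obj: "cofib A \<Longrightarrow> A \<in> Obj \<C>"
  by (simp add: cofibrant_def)

lemma fibrant_Obj: "fib A \<Longrightarrow> A \<in> Obj \<C>"
  by (simp add: fibrant_def cofibrant_def)

lemma cofibrant_lift:
  assumes "cofib A" "e \<in> hom \<C> X Y" "e \<in> Fib" "e \<in> W" "v \<in> hom \<C> A Y"
  obtains d where "d \<in> hom \<C> A X" "e \<cdot> d = v"
  using assms unfolding cofibrant_iff by blast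

lemma cofibrant_Cof:
  assumes A: "cofib A" and m: "m \<in> hom \<C> A B" "m \<in> Cof"
  shows "cofib B"
  unfolding cofibrant_iff
proof (intro conjI allI ballI)
  show "B \<in> Obj \<C>" using hom_Obj m by blast
  fix X Y e v assume e: "e \<in> hom \<C> X Y \<inter> Fib \<inter> W" and v: "v \<in> hom \<C> B Y"
  have "v \<cdot> m \<in> hom \<C> A Y" using m v by (auto intro: Comp_hom)
  then obtain d where "d \<in> hom \<C> A X" "e \<cdot> d = v \<cdot> m" using cofibrant_lift [OF A] e by blast
  then show "\<exists>d\<in>hom \<C> B X. e \<cdot> d = v"
    using has_liftingD [OF lift_cof_trivfib m(1) _ _ v] m(2) e by blast
qed

lemma fibrant_lift:
  assumes "fib A" "m \<in> hom \<C> X Y" "m \<in> Cof" "m \<in> W" "v \<in> hom \<C> X A"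
  obtains d where "d \<in> hom \<C> Y A" "d \<cdot> m = v"
  using model_category.cofibrant_lift [OF op_model, of A m Y X v] assms by (auto simp: fibrant_def)

lemma fibrant_iff:
  "fib A \<longleftrightarrow> A \<in> Obj \<C> \<and>
     (\<forall>X Y. \<forall>m\<in>hom \<C> X Y \<inter> Cof \<inter> W. \<forall>v\<in>hom \<C> X A. \<exists>d\<in>hom \<C> Y A. d \<cdot> m = v)"
  using model_category.cofibrant_iff [OF op_model, of A] by (auto simp: fibrant_def)

lemma fibrant_Fib: "fib B \<Longrightarrow> e \<in> hom \<C> A B \<Longrightarrow> e \<in> Fib \<Longrightarrow> fib A"
  using model_category.cofibrant_Cof [OF op_model, of B e A] by (auto simp: fibrant_def)

text \<open>The injection \<open>m\<close> is the pushout of the cofibration from the initial object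
  to \<open>B\<close>. Concretely, a lift is given on \<open>A\<close> by the square, is chosen on
  \<open>B\<close> by cofibrancy, and the two are copaired.\<close>

lemma cofibrant_coproduct_injection:
  assumes X: "is_coproduct \<C> A B X m n" and B: "cofib B"
  shows "m \<in> Cof"
proof -
  have mn: "m \<in> hom \<C> A X" "n \<in> hom \<C> B X" using X by (auto simp: is_coproduct_def)
  have "has_lifting \<C> m e" if e: "e \<in> Fib \<inter> W" for e
    unfolding has_lifting_def
  proof (intro allI ballI impI; elim conjE)
    fix A' X' U V u v assume h: "u \<in> hom \<C> A' U" "v \<in> hom \<C> X' V" "m \<in> hom \<C> A' X'"
      "e \<in> hom \<C> U V" "e \<cdot> u = v \<cdot> m"
    have [simp]: "A' = A" "X' = X" using h mn by (auto simp: hom_iff)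
    have "v \<cdot> n \<in> hom \<C> B V" using mn h by (auto intro: Comp_hom)
    then obtain d' where d': "d' \<in> hom \<C> B U" "e \<cdot> d' = v \<cdot> n"
      using cofibrant_lift [OF B h(4)] e by blast
    obtain d where d: "d \<in> hom \<C> X U" "d \<cdot> m = u" "d \<cdot> n = d'"
      using coproduct_copair [OF X _ d'(1)] h(1) by auto
    have "e \<cdot> d = v"
    proof (rule coproduct_eq [OF X])
      show "e \<cdot> d \<in> hom \<C> X V" "v \<in> hom \<C> X V" using Comp_hom [OF d(1) h(4)] h(2) by simp_all
      show "e \<cdot> d \<cdot> m = v \<cdot> m" "e \<cdot> d \<cdot> n = v \<cdot> n"
        using d h d' mn Comp_assoc [OF mn(1) d(1) h(4)] Comp_assoc [OF mn(2) d(1) h(4)] by simp_all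
    qed
    then show "\<exists>d\<in>hom \<C> X' U. d \<cdot> m = u \<and> e \<cdot> d = v" using d by auto
  qed
  then show ?thesis using mn by (auto simp: Cof_iff hom_iff)
qed

end

section \<open>Cylinders and path objects\<close>

text \<open>The two ends \<open>a\<close>, \<open>b\<close> and the projection \<open>s\<close> are
  exposed, while the coproduct and the cofibration out of it stay hidden. In the opposite category
  the same predicate describes a path object, with \<open>a\<close> and \<open>b\<close> its two
  evaluations.\<close>

definition cylinder ::
    "('o, 'a) cat \<Rightarrow> 'a set \<Rightarrow> 'a set \<Rightarrow> 'o \<Rightarrow> 'o \<Rightarrow> 'a \<Rightarrow> 'a \<Rightarrow> 'a \<Rightarrow> bool" where
  "cylinder \<C> W Cof A K a b s \<longleftrightarrow> (\<exists>X m n c. is_coproduct \<C> A A X m n \<and> c \<in> hom \<C> X K \<inter> Cof \<and>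
     a = c \<cdot>\<^bsub>\<C>\<^esub> m \<and> b = c \<cdot>\<^bsub>\<C>\<^esub> n \<and> s \<in> hom \<C> K A \<inter> W \<and> s \<cdot>\<^bsub>\<C>\<^esub> a = Id \<C> A \<and> s \<cdot>\<^bsub>\<C>\<^esub> b = Id \<C> A)"

lemma cylinder_swap: "cylinder \<C> W Cof A K a b s \<Longrightarrow> cylinder \<C> W Cof A K b a s"
  unfolding cylinder_def using is_coproduct_swap [of \<C>] by metis

context category
begin

lemma cylinder_hom:
  assumes "cylinder \<C> W Cof A K a b s"
  shows "a \<in> hom \<C> A K" "b \<in> hom \<C> A K" "s \<in> hom \<C> K A" "s \<in> W" "s \<cdot> a = Id \<C> A" "s \<cdot> b = Id \<C> A"
  using assms unfolding cylinder_def is_coproduct_def by (auto intro: Comp_hom)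

lemma left_homotopic_iff:
  "left_homotopic \<C> W Cof f g \<longleftrightarrow>
     (\<exists>A B K a b s h. cylinder \<C> W Cof A K a b s \<and> h \<in> hom \<C> K B \<and> h \<cdot> a = f \<and> h \<cdot> b = g)"
proof
  assume "left_homotopic \<C> W Cof f g"
  then obtain A B X m n K c s h where h:
    "f \<in> hom \<C> A B" "g \<in> hom \<C> A B" "is_coproduct \<C> A A X m n" "c \<in> hom \<C> X K \<inter> Cof" "s \<in> hom \<C> K A \<inter> W"
    "s \<cdot> c \<cdot> m = Id \<C> A" "s \<cdot> c \<cdot> n = Id \<C> A" "h \<in> hom \<C> K B" "h \<cdot> c \<cdot> m = f" "h \<cdot> c \<cdot> n = g"
    unfolding left_homotopic_def by blast
  have mn: "m \<in> hom \<C> A X" "n \<in> hom \<C> A X" using h(3) by (auto simp: is_coproduct_def)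
  have "s \<cdot> (c \<cdot> m) = Id \<C> A" "s \<cdot> (c \<cdot> n) = Id \<C> A"
    using h(4-7) mn Comp_assoc by auto
  then have "cylinder \<C> W Cof A K (c \<cdot> m) (c \<cdot> n) s" unfolding cylinder_def using h(3-5) by blast
  moreover have "h \<cdot> (c \<cdot> m) = f" "h \<cdot> (c \<cdot> n) = g"
    using h(4,8-10) mn Comp_assoc by auto
  ultimately show "\<exists>A B K a b s h. cylinder \<C> W Cof A K a b s \<and> h \<in> hom \<C> K B \<and> h \<cdot> a = f \<and> h \<cdot> b = g"
    using h(8) by blast
next
  assume "\<exists>A B K a b s h. cylinder \<C> W Cof A K a b s \<and> h \<in> hom \<C> K B \<and> h \<cdot> a = f \<and> h \<cdot> b = g"
  then obtain A B K a b s h X m n c where h: "cylinder \<C> W Cof A K a b s" "h \<in> hom \<C> K B"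
     "h \<cdot> a = f" "h \<cdot> b = g"
    and c: "is_coproduct \<C> A A X m n" "c \<in> hom \<C> X K \<inter> Cof"
     "a = c \<cdot> m" "b = c \<cdot> n" "s \<in> hom \<C> K A \<inter> W" "s \<cdot> a = Id \<C> A" "s \<cdot> b = Id \<C> A"
    unfolding cylinder_def by metis
  have mn: "m \<in> hom \<C> A X" "n \<in> hom \<C> A X" using c by (auto simp: is_coproduct_def)
  have "f \<in> hom \<C> A B" "g \<in> hom \<C> A B" using h cylinder_hom [OF h(1)] by (auto intro: Comp_hom)
  moreover have "s \<cdot> c \<cdot> m = Id \<C> A" "s \<cdot> c \<cdot> n = Id \<C> A" "h \<cdot> c \<cdot> m = f" "h \<cdot> c \<cdot> n = g"
    using c mn h Comp_assoc by auto
  ultimately show "left_homotopic \<C> W Cof f g"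
    unfolding left_homotopic_def using c h(2) by blast
qed

lemma right_homotopic_iff:
  "right_homotopic \<C> W Fib f g \<longleftrightarrow>
     (\<exists>A B P x y s h. cylinder (op_cat \<C>) W Fib B P x y s \<and> h \<in> hom \<C> A P \<and> x \<cdot> h = f \<and> y \<cdot> h = g)"
  unfolding right_homotopic_def category.left_homotopic_iff [OF op_category] op_cat_simps hom_op_cat
  by blast

lemmas path_hom = category.cylinder_hom [OF op_category, unfolded op_cat_simps hom_op_cat]

end

context model_category
begin

lemma cylinder_exists:
  assumes "A \<in> Obj \<C>"
  obtains K a b s where "cylinder \<C> W Cof A K a b s"
proof -
  obtain X m n where X: "is_coproduct \<C> A A X m n" using has_coproduct [OF finite_colimits] assms by blast
  have mn: "m \<in> hom \<C> A X" "n \<in> hom \<C> A X" using X by (auto simp: is_coproduct_def)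
  obtain h where h: "h \<in> hom \<C> X A" "h \<cdot> m = Id \<C> A" "h \<cdot> n = Id \<C> A"
    using coproduct_copair [OF X] Id_hom [OF assms] by metis
  obtain K c e where "c \<in> hom \<C> X K" "c \<in> Cof" "e \<in> hom \<C> K A" "e \<in> Fib \<inter> W" "e \<cdot> c = h"
    using fact_obtains [OF fact_cof_trivfib h(1)] by metis
  then have "cylinder \<C> W Cof A K (c \<cdot> m) (c \<cdot> n) e"
    unfolding cylinder_def using X mn h Comp_assoc
    by (intro exI [of _ X] exI [of _ m] exI [of _ n] exI [of _ c]) auto
  then show ?thesis using that by blast
qed

text \<open>Each end is a coproduct injection followed by a cofibration, and it is a weak
  equivalence because it is a section of \<open>s\<close>. Cofibrancy of \<open>A\<close> enters
  through the injection.\<close>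

lemma cylinder_Cof:
  assumes A: "cofib A" and cyl: "cylinder \<C> W Cof A K a b s"
  shows "a \<in> Cof" "a \<in> W" "b \<in> Cof" "b \<in> W"
proof -
  have *: "a \<in> Cof \<and> a \<in> W" if "cylinder \<C> W Cof A K a b s" for a b
  proof
    obtain X m n c where c: "is_coproduct \<C> A A X m n" "c \<in> hom \<C> X K \<inter> Cof" "a = c \<cdot> m"
      using \<open>cylinder \<C> W Cof A K a b s\<close> unfolding cylinder_def by blast
    have "m \<in> hom \<C> A X" using c by (auto simp: is_coproduct_def)
    then show "a \<in> Cof" using cofibrant_coproduct_injection [OF c(1) A] c by (auto intro: Cof_Comp)
    show "a \<in> W"
      using cylinder_hom [OF that] Id_classes(1) [OF cofibrant_Obj [OF A]] W_cancel_left [of a A K s A] by simp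
  qed
  show "a \<in> Cof" "a \<in> W" "b \<in> Cof" "b \<in> W"
    using * [OF cyl] * [OF cylinder_swap [OF cyl]] by simp_all
qed

lemma cylinder_cofibrant:
  assumes "cofib A" "cylinder \<C> W Cof A K a b s"
  shows "cofib K"
  using cofibrant_Cof cylinder_Cof(1) [OF assms] cylinder_hom(1) [OF assms(2)] assms(1) by blast

lemma path_Fib:
  assumes "fib B" "cylinder (op_cat \<C>) W Fib B P x y s"
  shows "x \<in> Fib" "x \<in> W" "y \<in> Fib" "y \<in> W"
  using model_category.cylinder_Cof [OF op_model, of B P x y s] assms by (auto simp: fibrant_def)

text \<open>Lifting a path along a cylinder replaces the gluing of cylinders in the proof that homotopy is
  transitive, and also compares left with right homotopy.\<close>

lemma homotopy_path_lift:
  assumes A: "cofib A" and cyl: "cylinder \<C> W Cof A K a b s"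
    and path: "cylinder (op_cat \<C>) W Fib B P x y w"
    and h: "h \<in> hom \<C> K B" and k: "k \<in> hom \<C> A P" and eq: "h \<cdot> b = x \<cdot> k"
  obtains k' where "k' \<in> hom \<C> A P" "x \<cdot> k' = h \<cdot> a" "y \<cdot> k' = y \<cdot> k"
proof -
  note c = cylinder_hom [OF cyl] and p = path_hom [OF path]
  obtain Y m n e where e: "is_coproduct (op_cat \<C>) B B Y m n" "e \<in> hom \<C> P Y" "e \<in> Fib"
     "x = m \<cdot> e" "y = n \<cdot> e"
    using path unfolding cylinder_def by auto
  have mn: "m \<in> hom \<C> Y B" "n \<in> hom \<C> Y B" using e by (auto simp: is_coproduct_def)
  have yks: "y \<cdot> k \<cdot> s \<in> hom \<C> K B" using c p k by (auto simp: hom_iff)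
  \<comment> \<open>\<open>v\<close> pairs the homotopy \<open>h\<close> with the constant homotopy
    at \<open>y \<cdot> k\<close>. A lift of \<open>v\<close> along \<open>b\<close> therefore drags
    the \<open>x\<close>-end of the path \<open>k\<close> along \<open>h\<close> and keeps its
    \<open>y\<close>-end in place.\<close>
  obtain v where v: "v \<in> hom \<C> K Y" "m \<cdot> v = h" "n \<cdot> v = y \<cdot> k \<cdot> s"
    using coproduct_copair [OF e(1), of h K "y \<cdot> k \<cdot> s"] h yks by auto
  have "e \<cdot> k = v \<cdot> b"
  proof (rule category.coproduct_eq [OF op_category e(1)])
    have "(m \<cdot> v) \<cdot> b = (m \<cdot> e) \<cdot> k" using eq v e by simp
    then show "e \<cdot> k \<cdot>\<^bsub>op_cat \<C>\<^esub> m = v \<cdot> b \<cdot>\<^bsub>op_cat \<C>\<^esub> m" using e(2) v(1) c mn k by (simp add: hom_iff)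
    have "(n \<cdot> v) \<cdot> b = y \<cdot> k" using c p k v by (simp add: hom_iff)
    then show "e \<cdot> k \<cdot>\<^bsub>op_cat \<C>\<^esub> n = v \<cdot> b \<cdot>\<^bsub>op_cat \<C>\<^esub> n" using e(2,5) v(1) c mn k by (simp add: hom_iff)
  qed (use e(2) v c mn k in \<open>auto simp: hom_iff\<close>)
  then obtain d where d: "d \<in> hom \<C> K P" "d \<cdot> b = k" "e \<cdot> d = v"
    using has_liftingD [OF lift_trivcof_fib c(2) e(2) k v(1)] cylinder_Cof [OF A cyl] e(3) by auto
  have "x \<cdot> d = h" "y \<cdot> d = y \<cdot> k \<cdot> s"
    using d v e mn by (simp_all add: hom_iff)
  then have "(x \<cdot> d) \<cdot> a = h \<cdot> a" "(y \<cdot> d) \<cdot> a = y \<cdot> k"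
    using c k p by (simp_all add: hom_iff)
  then show ?thesis using d c p by (intro that [of "d \<cdot> a"]) (auto simp: hom_iff)
qed

end

section \<open>The homotopy relation\<close>

context category
begin

lemma left_homotopicE:
  assumes "left_homotopic \<C> W Cof f g" "f \<in> hom \<C> A B"
  obtains K a b s h where "cylinder \<C> W Cof A K a b s" "h \<in> hom \<C> K B" "h \<cdot> a = f" "h \<cdot> b = g"
proof -
  obtain A' B' K a b s h where h: "cylinder \<C> W Cof A' K a b s" "h \<in> hom \<C> K B'" "h \<cdot> a = f" "h \<cdot> b = g"
    using assms(1) unfolding left_homotopic_iff by blast
  have "f \<in> hom \<C> A' B'" using h cylinder_hom [OF h(1)] by (auto intro: Comp_hom)
  then have "A' = A" "B' = B" using assms(2) by (auto simp: hom_def)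
  then show ?thesis using that h by blast
qed

lemma right_homotopicE:
  assumes "right_homotopic \<C> W Fib f g" "f \<in> hom \<C> A B"
  obtains P x y s h where "cylinder (op_cat \<C>) W Fib B P x y s" "h \<in> hom \<C> A P" "x \<cdot> h = f" "y \<cdot> h = g"
  using category.left_homotopicE [OF op_category, of W Fib f g B A] assms
  unfolding right_homotopic_def op_cat_simps hom_op_cat by metis

lemma left_homotopic_hom:
  assumes "left_homotopic \<C> W Cof f g" "f \<in> hom \<C> A B"
  shows "g \<in> hom \<C> A B"
  using left_homotopicE [OF assms] cylinder_hom Comp_hom by metis

lemma left_homotopic_sym: "left_homotopic \<C> W Cof f g \<Longrightarrow> left_homotopic \<C> W Cof g f"
  unfolding left_homotopic_iff using cylinder_swap [of \<C>] by metis

lemma left_homotopic_post: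
  assumes "left_homotopic \<C> W Cof f g" "f \<in> hom \<C> A B" "k \<in> hom \<C> B B'"
  shows "left_homotopic \<C> W Cof (k \<cdot> f) (k \<cdot> g)"
proof -
  obtain K a b s h where h: "cylinder \<C> W Cof A K a b s" "h \<in> hom \<C> K B" "h \<cdot> a = f" "h \<cdot> b = g"
    using left_homotopicE assms(1,2) by blast
  have "(k \<cdot> h) \<cdot> a = k \<cdot> f" "(k \<cdot> h) \<cdot> b = k \<cdot> g" "k \<cdot> h \<in> hom \<C> K B'"
    using h cylinder_hom [OF h(1)] assms(3) by (auto simp: hom_iff)
  then show ?thesis unfolding left_homotopic_iff using h(1) by blast
qed

lemma right_homotopic_pre:
  assumes "right_homotopic \<C> W Fib f g" "f \<in> hom \<C> A B" "k \<in> hom \<C> A' A"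
  shows "right_homotopic \<C> W Fib (f \<cdot> k) (g \<cdot> k)"
  using category.left_homotopic_post [OF op_category, of W Fib f g B A k A'] assms
  by (simp add: right_homotopic_def)

end

context model_category
begin

lemma left_homotopic_refl:
  assumes "f \<in> hom \<C> A B"
  shows "left_htp f f"
proof -
  obtain K a b s where c: "cylinder \<C> W Cof A K a b s"
    using cylinder_exists hom_Obj [OF assms] by metis
  have "f \<cdot> s \<in> hom \<C> K B" "(f \<cdot> s) \<cdot> a = f" "(f \<cdot> s) \<cdot> b = f"
    using cylinder_hom [OF c] assms by (auto simp: hom_iff)
  then show ?thesis unfolding left_homotopic_iff using c by blast
qed

lemma right_homotopic_refl: "f \<in> hom \<C> A B \<Longrightarrow> right_htp f f"
  using model_category.left_homotopic_refl [OF op_model, of f B A] by (simp add: right_homotopic_def)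

text \<open>The right homotopy from \<open>g\<close> to \<open>k\<close> has its
  \<open>g\<close>-end moved to \<open>f\<close> along the left homotopy. With \<open>g = k\<close>
  and a constant path this turns left homotopy into right homotopy; in general it yields
  transitivity.\<close>

lemma left_right_homotopic_trans:
  assumes "cofib A" "f \<in> hom \<C> A B"
    and "left_htp f g" "right_htp g k"
  shows "right_htp f k"
proof -
  have g: "g \<in> hom \<C> A B" using left_homotopic_hom assms by blast
  obtain K a b s h where h: "cylinder \<C> W Cof A K a b s" "h \<in> hom \<C> K B" "h \<cdot> a = f" "h \<cdot> b = g"
    using left_homotopicE assms by blast
  obtain P x y w h' where h': "cylinder (op_cat \<C>) W Fib B P x y w" "h' \<in> hom \<C> A P" "x \<cdot> h' = g" "y \<cdot> h' = k"
    using right_homotopicE g assms by blast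
  obtain k' where "k' \<in> hom \<C> A P" "x \<cdot> k' = f" "y \<cdot> k' = k"
    using homotopy_path_lift [OF assms(1) h(1) h'(1) h(2) h'(2)] h h' by metis
  then show ?thesis unfolding right_homotopic_iff using h'(1) by blast
qed

lemma left_imp_right_homotopic:
  assumes "cofib A" "f \<in> hom \<C> A B" "left_htp f g"
  shows "right_htp f g"
  using left_right_homotopic_trans [OF assms] right_homotopic_refl left_homotopic_hom assms by blast

lemma right_imp_left_homotopic:
  assumes "fib B" "f \<in> hom \<C> A B" "right_htp f g"
  shows "left_htp f g"
  using model_category.left_imp_right_homotopic [OF op_model, of B f A g] assms
  by (simp add: right_homotopic_def fibrant_def)

abbreviation htp :: "'o \<Rightarrow> 'o \<Rightarrow> ('a \<times> 'a) set" where "htp A B \<equiv> homotopy_rel \<C> W Cof Fib A B"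

lemma htp_hom: "(f, g) \<in> htp A B \<Longrightarrow> f \<in> hom \<C> A B" "(f, g) \<in> htp A B \<Longrightarrow> g \<in> hom \<C> A B"
  by (auto simp: homotopy_rel_def)

lemma htp_left:
  assumes "cofib A"
  shows "(f, g) \<in> htp A B \<longleftrightarrow> f \<in> hom \<C> A B \<and> left_htp f g"
  using left_imp_right_homotopic [OF assms] left_homotopic_hom unfolding homotopy_rel_def by blast

lemma htp_right:
  assumes "cofib A" "fib B"
  shows "(f, g) \<in> htp A B \<longleftrightarrow> f \<in> hom \<C> A B \<and> right_htp f g"
  using right_imp_left_homotopic [OF assms(2)] htp_left [OF assms(1)] unfolding homotopy_rel_def by blast

context
  fixes A B
  assumes AB: "cofib A" "fib B"
begin

lemma htp_refl: "f \<in> hom \<C> A B \<Longrightarrow> (f, f) \<in> htp A B"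
  using htp_left [OF AB(1)] left_homotopic_refl by blast

lemma htp_sym: "(f, g) \<in> htp A B \<Longrightarrow> (g, f) \<in> htp A B"
  unfolding htp_left [OF AB(1)] using left_homotopic_sym left_homotopic_hom by blast

lemma htp_trans: "(f, g) \<in> htp A B \<Longrightarrow> (g, k) \<in> htp A B \<Longrightarrow> (f, k) \<in> htp A B"
  using left_right_homotopic_trans [OF AB(1), of f B g k] unfolding htp_right [OF AB]
  using right_imp_left_homotopic [OF AB(2), of f A g] by blast

lemma equiv_htp: "equiv (hom \<C> A B) (htp A B)"
proof (rule equivI)
  show "htp A B \<subseteq> hom \<C> A B \<times> hom \<C> A B" by (auto dest: htp_hom)
  show "refl_on (hom \<C> A B) (htp A B)" by (rule refl_onI) (rule htp_refl)
  show "sym (htp A B)" by (rule symI) (rule htp_sym)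
  show "trans (htp A B)" by (rule transI) (rule htp_trans)
qed

end

section \<open>Weak equivalences between fibrant objects act bijectively on homotopy classes\<close>

lemma htp_post:
  assumes "cofib A" "(f, g) \<in> htp A B" "k \<in> hom \<C> B B'"
  shows "(k \<cdot> f, k \<cdot> g) \<in> htp A B'"
  using assms left_homotopic_post by (auto simp: htp_left intro: Comp_hom)

text \<open>The homotopy in \<open>B'\<close> is lifted through \<open>w\<close> relative to its
  ends: the map from \<open>A + A\<close> into the cylinder is a cofibration, and \<open>w\<close>
  is a trivial fibration.\<close>

lemma trivial_Fib_htp_reflect:
  assumes A: "cofib A" and w: "w \<in> hom \<C> B B'" "w \<in> Fib" "w \<in> W"
    and fg: "f \<in> hom \<C> A B" "g \<in> hom \<C> A B" and wfg: "(w \<cdot> f, w \<cdot> g) \<in> htp A B'"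
  shows "(f, g) \<in> htp A B"
proof -
  obtain K a b s h where h: "cylinder \<C> W Cof A K a b s" "h \<in> hom \<C> K B'" "h \<cdot> a = w \<cdot> f" "h \<cdot> b = w \<cdot> g"
    using left_homotopicE wfg htp_left [OF A] by metis
  obtain X m n c where c: "is_coproduct \<C> A A X m n" "c \<in> hom \<C> X K" "c \<in> Cof" "a = c \<cdot> m" "b = c \<cdot> n"
    using h(1) unfolding cylinder_def by blast
  have mn: "m \<in> hom \<C> A X" "n \<in> hom \<C> A X" using c by (auto simp: is_coproduct_def)
  obtain u where u: "u \<in> hom \<C> X B" "u \<cdot> m = f" "u \<cdot> n = g" using coproduct_copair [OF c(1) fg] .
  have "w \<cdot> u = h \<cdot> c"
  proof (rule coproduct_eq [OF c(1)])
    show "w \<cdot> u \<in> hom \<C> X B'" "h \<cdot> c \<in> hom \<C> X B'" using Comp_hom u(1) w(1) h(2) c(2) by blast+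
    show "w \<cdot> u \<cdot> m = h \<cdot> c \<cdot> m" "w \<cdot> u \<cdot> n = h \<cdot> c \<cdot> n"
      using u mn w(1) h c by (simp_all add: hom_iff)
  qed
  then obtain d where d: "d \<in> hom \<C> K B" "d \<cdot> c = u"
    using has_liftingD [OF lift_cof_trivfib c(2) w(1) u(1) h(2)] w c(3) by auto
  have "d \<cdot> a = f" "d \<cdot> b = g" using d c mn u Comp_assoc by metis+
  then show ?thesis using fg d(1) h(1) unfolding htp_left [OF A] left_homotopic_iff by blast
qed

text \<open>Fibrancy of \<open>B\<close> gives the retraction. The homotopy from
  \<open>w \<cdot> r\<close> to the identity is known on \<open>B\<close>, where it can be taken
  constant, and it extends along the trivial cofibration \<open>w\<close> because the map from the
  path object to the product is a fibration.\<close>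

lemma trivial_Cof_retraction:
  assumes w: "w \<in> hom \<C> B B'" "w \<in> Cof" "w \<in> W" and B: "fib B"
  obtains r where "r \<in> hom \<C> B' B" "r \<cdot> w = Id \<C> B" "right_htp (w \<cdot> r) (Id \<C> B')"
proof -
  note ob = hom_Obj [OF w(1)]
  obtain r where r: "r \<in> hom \<C> B' B" "r \<cdot> w = Id \<C> B"
    using fibrant_lift [OF B w Id_hom [OF ob(1)]] .
  obtain P x y s where path: "cylinder (op_cat \<C>) W Fib B' P x y s"
    using model_category.cylinder_exists [OF op_model, of B'] ob by simp blast
  note p = path_hom [OF path]
  obtain Y m n e where e: "is_coproduct (op_cat \<C>) B' B' Y m n" "e \<in> hom \<C> P Y" "e \<in> Fib"
     "x = m \<cdot> e" "y = n \<cdot> e"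
    using path unfolding cylinder_def by auto
  have mn: "m \<in> hom \<C> Y B'" "n \<in> hom \<C> Y B'" using e by (auto simp: is_coproduct_def)
  obtain v where v: "v \<in> hom \<C> B' Y" "m \<cdot> v = w \<cdot> r" "n \<cdot> v = Id \<C> B'"
    using coproduct_copair [OF e(1), of "w \<cdot> r" B' "Id \<C> B'"] w r Id_hom [OF ob(2)] Comp_hom by auto
  \<comment> \<open>The top of the lifting square is the constant path \<open>s \<cdot> w\<close>.
    The square commutes since both components of \<open>v\<close> restrict to \<open>w\<close> along
    \<open>w\<close>.\<close>
  have "e \<cdot> (s \<cdot> w) = v \<cdot> w"
  proof (rule category.coproduct_eq [OF op_category e(1)])
    have "(m \<cdot> e) \<cdot> s = Id \<C> B'" "(n \<cdot> e) \<cdot> s = Id \<C> B'" using p e by simp_all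
    then have *: "m \<cdot> (e \<cdot> (s \<cdot> w)) = w" "n \<cdot> (e \<cdot> (s \<cdot> w)) = w"
      using p(3) e(2) mn w by (simp_all add: hom_iff flip: Comp_assoc_simp)
    have "(m \<cdot> v) \<cdot> w = w" "(n \<cdot> v) \<cdot> w = w" using v(2,3) w r by (simp_all add: hom_iff)
    then have "m \<cdot> (v \<cdot> w) = w" "n \<cdot> (v \<cdot> w) = w" using v(1) mn w by (simp_all add: hom_iff)
    then show "e \<cdot> (s \<cdot> w) \<cdot>\<^bsub>op_cat \<C>\<^esub> m = v \<cdot> w \<cdot>\<^bsub>op_cat \<C>\<^esub> m"
      "e \<cdot> (s \<cdot> w) \<cdot>\<^bsub>op_cat \<C>\<^esub> n = v \<cdot> w \<cdot>\<^bsub>op_cat \<C>\<^esub> n"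
      using * by simp_all
  qed (use p(3) e(2) v(1) w in \<open>auto simp: hom_iff\<close>)
  then obtain d where d: "d \<in> hom \<C> B' P" "e \<cdot> d = v"
    using has_liftingD [OF lift_trivcof_fib w(1) e(2) _ v(1)] w p(3) e(3) Comp_hom by (metis IntI)
  have "x \<cdot> d = w \<cdot> r" "y \<cdot> d = Id \<C> B'"
    using d v e mn by (simp_all add: hom_iff)
  then have "right_htp (w \<cdot> r) (Id \<C> B')"
    unfolding right_homotopic_iff using path d(1) by blast
  then show ?thesis using that r by blast
qed

lemma fact_weq:
  assumes w: "w \<in> hom \<C> B B'" "w \<in> W"
  obtains K c e where "c \<in> hom \<C> B K" "c \<in> Cof" "c \<in> W" "e \<in> hom \<C> K B'" "e \<in> Fib" "e \<in> W" "e \<cdot> c = w"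
proof -
  obtain K c e where *: "c \<in> hom \<C> B K" "c \<in> Cof" "e \<in> hom \<C> K B'" "e \<in> Fib \<inter> W" "e \<cdot> c = w"
    using fact_obtains [OF fact_cof_trivfib w(1)] by metis
  then have "c \<in> W" using W_cancel_left [of c B K e B'] w by auto
  then show ?thesis using that * by blast
qed

text \<open>Split \<open>w\<close> into a trivial cofibration \<open>c\<close> and a trivial
  fibration \<open>e\<close>: homotopies lift through \<open>e\<close>, and \<open>c\<close> is
  undone by its retraction.\<close>

lemma weq_htp_reflect:
  assumes A: "cofib A" and BB': "fib B" "fib B'"
    and w: "w \<in> hom \<C> B B'" "w \<in> W"
    and fg: "f \<in> hom \<C> A B" "g \<in> hom \<C> A B" and wfg: "(w \<cdot> f, w \<cdot> g) \<in> htp A B'"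
  shows "(f, g) \<in> htp A B"
proof -
  obtain K c e where ce: "c \<in> hom \<C> B K" "c \<in> Cof" "c \<in> W" "e \<in> hom \<C> K B'" "e \<in> Fib" "e \<in> W" "e \<cdot> c = w"
    using fact_weq [OF w] .
  have "(c \<cdot> f, c \<cdot> g) \<in> htp A K"
  proof (rule trivial_Fib_htp_reflect [OF A ce(4-6)])
    show "(e \<cdot> (c \<cdot> f), e \<cdot> (c \<cdot> g)) \<in> htp A B'"
      using wfg Comp_assoc [OF _ ce(1,4)] fg ce(7) by metis
  qed (use fg ce Comp_hom in blast)+
  moreover obtain r where r: "r \<in> hom \<C> K B" "r \<cdot> c = Id \<C> B"
    using trivial_Cof_retraction [OF ce(1-3) BB'(1)] by metis
  ultimately have "(r \<cdot> (c \<cdot> f), r \<cdot> (c \<cdot> g)) \<in> htp A B" using htp_post [OF A] by blast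
  then show ?thesis using fg r ce(1) Comp_assoc [OF _ ce(1) r(1)] Id_Comp by metis
qed

text \<open>In the same splitting, \<open>f\<close> lifts strictly through \<open>e\<close>. It then
  lifts through \<open>c\<close> only up to homotopy, by means of the retraction; the middle object
  is fibrant because \<open>e\<close> is a fibration onto \<open>B'\<close>.\<close>

lemma weq_htp_surj:
  assumes A: "cofib A" and BB': "fib B" "fib B'"
    and w: "w \<in> hom \<C> B B'" "w \<in> W" and f: "f \<in> hom \<C> A B'"
  obtains g where "g \<in> hom \<C> A B" "(w \<cdot> g, f) \<in> htp A B'"
proof -
  obtain K c e where ce: "c \<in> hom \<C> B K" "c \<in> Cof" "c \<in> W" "e \<in> hom \<C> K B'" "e \<in> Fib" "e \<in> W" "e \<cdot> c = w"
    using fact_weq [OF w] .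
  obtain f' where f': "f' \<in> hom \<C> A K" "e \<cdot> f' = f" using cofibrant_lift [OF A ce(4-6) f] .
  obtain r where r: "r \<in> hom \<C> K B" "right_htp (c \<cdot> r) (Id \<C> K)"
    using trivial_Cof_retraction [OF ce(1-3) BB'(1)] by metis
  have K: "fib K" using fibrant_Fib BB'(2) ce by blast
  have "right_htp ((c \<cdot> r) \<cdot> f') (Id \<C> K \<cdot> f')"
    using right_homotopic_pre [OF r(2)] f'(1) Comp_hom [OF r(1) ce(1)] by blast
  then have "(c \<cdot> r \<cdot> f', f') \<in> htp A K"
    unfolding htp_right [OF A K] using f'(1) r(1) ce(1) by (auto simp: hom_iff)
  then have "(e \<cdot> (c \<cdot> r \<cdot> f'), f) \<in> htp A B'" using htp_post [OF A _ ce(4)] f'(2) by metis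
  moreover have "e \<cdot> (c \<cdot> r \<cdot> f') = w \<cdot> (r \<cdot> f')" using f'(1) r(1) ce(1,4) ce(7) [symmetric] by (simp add: hom_iff)
  ultimately show ?thesis using that [of "r \<cdot> f'"] f'(1) r(1) Comp_hom by metis
qed

section \<open>Cofibrant and fibrant replacement\<close>

abbreviation Qo where "Qo \<equiv> ob (cof_repl \<C> \<Phi>)"
abbreviation Qa where "Qa \<equiv> ar (cof_repl \<C> \<Phi>)"
abbreviation p where "p \<equiv> cof_repl_map \<C> \<Phi>"

lemma from_init_square:
  assumes "f \<in> hom \<C> A B"
  shows "is_square \<C> (from_init \<C> A) (from_init \<C> B) (Id \<C> (init_obj \<C>)) f"
proof -
  note i = from_init_hom [OF finite_colimits]
  have ob: "A \<in> Obj \<C>" "B \<in> Obj \<C>" using assms hom_Obj by blast+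
  have "f \<cdot> from_init \<C> A = from_init \<C> B"
    by (rule from_init_unique [OF finite_colimits, of _ B]) (use i ob Comp_hom assms in blast)+
  then show ?thesis using i [OF ob(1)] i [OF ob(2)] assms init_obj_Obj [OF finite_colimits]
    by (auto simp: is_square_def hom_iff)
qed

lemma Q_object:
  assumes "A \<in> Obj \<C>"
  shows "cofib (Qo A)" "p A \<in> hom \<C> (Qo A) A" "p A \<in> Fib" "p A \<in> W"
proof -
  have i: "from_init \<C> A \<in> Arr \<C>" "Dom \<C> (from_init \<C> A) = init_obj \<C>" "Cod \<C> (from_init \<C> A) = A"
    using from_init_hom [OF finite_colimits assms] by (auto simp: hom_iff)
  have *: "lft \<Phi> (from_init \<C> A) \<in> hom \<C> (init_obj \<C>) (Qo A) \<inter> Cof" "p A \<in> hom \<C> (Qo A) A \<inter> (Fib \<inter> W)"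
    using fact_cof_trivfib i
    unfolding functorial_factorisation_def cof_repl_def cof_repl_map_def by auto
  have Q: "Qo A \<in> Obj \<C>" using * hom_Obj by blast
  have "lft \<Phi> (from_init \<C> A) = from_init \<C> (Qo A)"
    using from_init_hom [OF finite_colimits Q] * by (intro from_init_unique [OF finite_colimits]) auto
  then show "cofib (Qo A)" using Q * by (simp add: cofibrant_def)
  show "p A \<in> hom \<C> (Qo A) A" "p A \<in> Fib" "p A \<in> W" using * by auto
qed

lemma Q_arrow:
  assumes f: "f \<in> hom \<C> A B"
  shows "Qa f \<in> hom \<C> (Qo A) (Qo B)" "p B \<cdot> Qa f = f \<cdot> p A"
  using fact_cof_trivfib from_init_square [OF f] homD(2,3) [OF f]
  unfolding functorial_factorisation_def cof_repl_def cof_repl_map_def by auto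

lemma Q_Id: "A \<in> Obj \<C> \<Longrightarrow> Qa (Id \<C> A) = Id \<C> (Qo A)"
  using fact_cof_trivfib from_init_hom [OF finite_colimits, of A] Id_hom [of A]
  unfolding functorial_factorisation_def cof_repl_def by (auto simp: hom_iff)

lemma Q_Comp:
  assumes f: "f \<in> hom \<C> A B" and g: "g \<in> hom \<C> B D"
  shows "Qa (g \<cdot> f) = Qa g \<cdot> Qa f"
proof -
  note gf = Comp_hom [OF f g]
  have "\<forall>f g h u v u' v'. is_square \<C> f g u v \<and> is_square \<C> g h u' v' \<longrightarrow>
        mmap \<Phi> f h (u' \<cdot> u) (v' \<cdot> v) = mmap \<Phi> g h u' v' \<cdot> mmap \<Phi> f g u v"
    using fact_cof_trivfib unfolding functorial_factorisation_def by blast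
  from this [rule_format, OF conjI, OF from_init_square [OF f] from_init_square [OF g]]
  show ?thesis
    using homD(2,3) [OF f] homD(2,3) [OF g] homD(2,3) [OF gf] init_obj_Obj [OF finite_colimits]
    by (simp add: cof_repl_def)
qed

lemma Q_weq:
  assumes f: "f \<in> hom \<C> A B"
  shows "Qa f \<in> W \<longleftrightarrow> f \<in> W"
proof -
  note AB = hom_Obj [OF f]
  note A = Q_object [OF AB(1)] and B = Q_object [OF AB(2)] and Q = Q_arrow [OF f]
  show ?thesis
  proof
    assume "Qa f \<in> W"
    then have "f \<cdot> p A \<in> W" using W_Comp [OF Q(1) B(2)] Q(2) B by simp
    then show "f \<in> W" using W_cancel_right [OF A(2) f] A by simp
  next
    assume "f \<in> W"
    then have "p B \<cdot> Qa f \<in> W" using W_Comp [OF A(2) f] Q(2) A by simp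
    then show "Qa f \<in> W" using W_cancel_left [OF Q(1) B(2)] B by simp
  qed
qed

text \<open>Fibrant replacement is cofibrant replacement in the opposite category, so it is
  functorial by the lemmas on \<open>Q\<close>, and \<open>q A\<close> is a trivial
  cofibration.\<close>

abbreviation Ro where "Ro \<equiv> ob (cof_repl (op_cat \<C>) (op_fact \<Psi>))"
abbreviation Ra where "Ra \<equiv> ar (cof_repl (op_cat \<C>) (op_fact \<Psi>))"
abbreviation q where "q \<equiv> cof_repl_map (op_cat \<C>) (op_fact \<Psi>)"

lemma R_object:
  assumes "A \<in> Obj \<C>"
  shows "fib (Ro A)" "q A \<in> hom \<C> A (Ro A)" "q A \<in> Cof" "q A \<in> W"
  using model_category.Q_object [OF op_model, of A] assms by (auto simp: fibrant_def)

lemma R_arrow: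
  assumes "f \<in> hom \<C> A B"
  shows "Ra f \<in> hom \<C> (Ro A) (Ro B)" "Ra f \<cdot> q A = q B \<cdot> f"
  using model_category.Q_arrow [OF op_model, of f B A] assms by auto

lemma R_Id: "A \<in> Obj \<C> \<Longrightarrow> Ra (Id \<C> A) = Id \<C> (Ro A)"
  using model_category.Q_Id [OF op_model, of A] by simp

lemma R_Comp: "f \<in> hom \<C> A B \<Longrightarrow> g \<in> hom \<C> B D \<Longrightarrow> Ra (g \<cdot> f) = Ra g \<cdot> Ra f"
  using model_category.Q_Comp [OF op_model, of g D B f A] by simp

lemma R_weq: "f \<in> hom \<C> A B \<Longrightarrow> Ra f \<in> W \<longleftrightarrow> f \<in> W"
  using model_category.Q_weq [OF op_model, of f B A] by simp

text \<open>Since \<open>q A\<close> is a cofibration, \<open>Ro (Qo A)\<close> is both cofibrant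
  and fibrant.\<close>

lemma R_cofibrant: "cofib A \<Longrightarrow> cofib (Ro A)"
  using cofibrant_Cof R_object [of A] cofibrant_Obj by blast

end

section \<open>The homotopy category\<close>

context category
begin

lemma is_zigzag_Obj: "is_zigzag \<C> W A xs B \<Longrightarrow> A \<in> Obj \<C> \<and> B \<in> Obj \<C>"
proof (induction xs arbitrary: A)
  case (Cons x xs)
  then show ?case by (cases x) auto
qed auto

lemma is_zigzag_append:
  "is_zigzag \<C> W A (xs @ ys) D \<longleftrightarrow> (\<exists>B. is_zigzag \<C> W A xs B \<and> is_zigzag \<C> W B ys D)"
proof (induction xs arbitrary: A)
  case Nil
  then show ?case using is_zigzag_Obj by auto
next
  case (Cons x xs)
  then show ?case by (cases x) auto
qed

lemma zz_equiv_zigzag: "zz_equiv \<C> W A B xs ys \<Longrightarrow> is_zigzag \<C> W A xs B \<and> is_zigzag \<C> W A ys B"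
  by (induction rule: zz_equiv.induct) (auto simp: is_zigzag_append hom_iff)

text \<open>A malformed list is related to nothing and so has an empty class. Well-formedness of
  \<open>xs\<close> puts \<open>xs\<close> into its own class, from which the relation can be read
  off.\<close>

lemma ho_class_eq_iff:
  assumes "is_zigzag \<C> W A xs B"
  shows "ho_class \<C> W A B xs = ho_class \<C> W A' B' ys \<longleftrightarrow> A = A' \<and> B = B' \<and> zz_equiv \<C> W A B xs ys"
proof -
  have "zz_equiv \<C> W A B xs zs \<longleftrightarrow> zz_equiv \<C> W A B ys zs" if "zz_equiv \<C> W A B xs ys" for zs
    using that zz_sym [OF that] zz_trans by (intro iffI)
  moreover have "zz_equiv \<C> W A B xs ys" if "Collect (zz_equiv \<C> W A B xs) = Collect (zz_equiv \<C> W A B ys)"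
  proof (rule zz_sym)
    have "xs \<in> Collect (zz_equiv \<C> W A B ys)" unfolding that [symmetric] using zz_refl [OF assms] by simp
    then show "zz_equiv \<C> W A B ys xs" by simp
  qed
  ultimately show ?thesis unfolding ho_class_def by auto
qed

lemma ho_Comp:
  assumes "is_zigzag \<C> W A xs B" "is_zigzag \<C> W B ys D"
  shows "ho_class \<C> W B D ys \<cdot>\<^bsub>ho_cat \<C> W\<^esub> ho_class \<C> W A B xs = ho_class \<C> W A D (xs @ ys)"
proof -
  have "(\<exists>xs'\<in>{xs'. zz_equiv \<C> W A B xs xs'}. \<exists>ys'\<in>{ys'. zz_equiv \<C> W B D ys ys'}.
      zz_equiv \<C> W A D (xs' @ ys') zs) \<longleftrightarrow> zz_equiv \<C> W A D (xs @ ys) zs" for zs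
  proof
    assume "\<exists>xs'\<in>{xs'. zz_equiv \<C> W A B xs xs'}. \<exists>ys'\<in>{ys'. zz_equiv \<C> W B D ys ys'}.
      zz_equiv \<C> W A D (xs' @ ys') zs"
    then obtain xs' ys' where "zz_equiv \<C> W A B xs xs'" "zz_equiv \<C> W B D ys ys'" "zz_equiv \<C> W A D (xs' @ ys') zs"
      by blast
    then show "zz_equiv \<C> W A D (xs @ ys) zs" by (rule zz_trans [OF zz_append])
  qed (use zz_refl [OF assms(1)] zz_refl [OF assms(2)] in blast)
  then show ?thesis by (auto simp: ho_class_def ho_cat_def)
qed

lemma ho_cat_simps [simp]:
  "Obj (ho_cat \<C> W) = Obj \<C>" "Dom (ho_cat \<C> W) (ho_class \<C> W A B xs) = A"
  "Cod (ho_cat \<C> W) (ho_class \<C> W A B xs) = B" "Id (ho_cat \<C> W) A = ho_class \<C> W A A []"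
  by (auto simp: ho_cat_def ho_class_def)

lemma ho_ArrE:
  assumes "x \<in> Arr (ho_cat \<C> W)"
  obtains A B xs where "x = ho_class \<C> W A B xs" "is_zigzag \<C> W A xs B"
  using assms by (auto simp: ho_cat_def)

lemma ho_homE:
  assumes "x \<in> hom (ho_cat \<C> W) A B"
  obtains xs where "x = ho_class \<C> W A B xs" "is_zigzag \<C> W A xs B"
  using assms by (auto simp: hom_iff elim!: ho_ArrE)

lemma ho_class_Arr: "is_zigzag \<C> W A xs B \<Longrightarrow> ho_class \<C> W A B xs \<in> Arr (ho_cat \<C> W)"
  by (auto simp: ho_cat_def)

lemma ho_class_hom: "is_zigzag \<C> W A xs B \<Longrightarrow> ho_class \<C> W A B xs \<in> hom (ho_cat \<C> W) A B"
  by (auto simp: hom_iff ho_class_Arr)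

lemma ho_category: "category (ho_cat \<C> W)"
proof
  fix f g h A B D E
  show "f \<in> Arr (ho_cat \<C> W) \<Longrightarrow> Dom (ho_cat \<C> W) f \<in> Obj (ho_cat \<C> W)"
    "f \<in> Arr (ho_cat \<C> W) \<Longrightarrow> Cod (ho_cat \<C> W) f \<in> Obj (ho_cat \<C> W)"
    using is_zigzag_Obj by (auto elim!: ho_ArrE)
  show "A \<in> Obj (ho_cat \<C> W) \<Longrightarrow> Id (ho_cat \<C> W) A \<in> hom (ho_cat \<C> W) A A"
    by (auto intro!: ho_class_hom)
  assume "f \<in> hom (ho_cat \<C> W) A B"
  then obtain xs where f [simp]: "f = ho_class \<C> W A B xs" and xs: "is_zigzag \<C> W A xs B" by (rule ho_homE)
  note AB = is_zigzag_Obj [OF xs]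
  show "f \<cdot>\<^bsub>ho_cat \<C> W\<^esub> Id (ho_cat \<C> W) A = f" "Id (ho_cat \<C> W) B \<cdot>\<^bsub>ho_cat \<C> W\<^esub> f = f"
    using ho_Comp [of W A "[]" A xs B] ho_Comp [of W A xs B "[]" B] xs AB by simp_all
  assume "g \<in> hom (ho_cat \<C> W) B D"
  then obtain ys where g [simp]: "g = ho_class \<C> W B D ys" and ys: "is_zigzag \<C> W B ys D" by (rule ho_homE)
  have xy: "is_zigzag \<C> W A (xs @ ys) D" using xs ys by (auto simp: is_zigzag_append)
  then show "g \<cdot>\<^bsub>ho_cat \<C> W\<^esub> f \<in> hom (ho_cat \<C> W) A D"
    using ho_class_hom by (simp add: ho_Comp [OF xs ys])
  assume "h \<in> hom (ho_cat \<C> W) D E"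
  then obtain zs where h [simp]: "h = ho_class \<C> W D E zs" and zs: "is_zigzag \<C> W D zs E" by (rule ho_homE)
  have yz: "is_zigzag \<C> W B (ys @ zs) E" using ys zs by (auto simp: is_zigzag_append)
  show "h \<cdot>\<^bsub>ho_cat \<C> W\<^esub> (g \<cdot>\<^bsub>ho_cat \<C> W\<^esub> f) = h \<cdot>\<^bsub>ho_cat \<C> W\<^esub> g \<cdot>\<^bsub>ho_cat \<C> W\<^esub> f"
    by (simp add: ho_Comp [OF xs ys] ho_Comp [OF ys zs] ho_Comp [OF xy zs] ho_Comp [OF xs yz])
qed

end

context model_category
begin

abbreviation Ho where "Ho \<equiv> ho_cat \<C> W"
abbreviation \<gamma> where "\<gamma> \<equiv> to_ho \<C> W"
abbreviation ho_comp (infixl "\<odot>" 55) where "x \<odot> y \<equiv> x \<cdot>\<^bsub>Ho\<^esub> y"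

lemma ho_Obj [simp]: "Obj Ho = Obj \<C>"
  by (simp add: ho_cat_def)

lemma \<gamma>_simps [simp]:
  assumes "f \<in> Arr \<C>"
  shows "\<gamma> f \<in> Arr Ho" "Dom Ho (\<gamma> f) = Dom \<C> f" "Cod Ho (\<gamma> f) = Cod \<C> f"
  using assms unfolding to_ho_def by (auto intro!: ho_class_Arr)

lemma \<gamma>_Id [simp]: "A \<in> Obj \<C> \<Longrightarrow> \<gamma> (Id \<C> A) = Id Ho A"
  unfolding to_ho_def by (simp add: ho_class_eq_iff zz_Id)

lemma \<gamma>_Comp:
  assumes "f \<in> Arr \<C>" "g \<in> Arr \<C>" "Cod \<C> f = Dom \<C> g"
  shows "\<gamma> (g \<cdot> f) = \<gamma> g \<odot> \<gamma> f"
proof -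
  have fg: "f \<in> hom \<C> (Dom \<C> f) (Cod \<C> f)" "g \<in> hom \<C> (Cod \<C> f) (Cod \<C> g)"
    using assms by (auto simp: hom_iff)
  have "\<gamma> g \<odot> \<gamma> f = ho_class \<C> W (Dom \<C> f) (Cod \<C> g) [Fwd f, Fwd g]"
    unfolding to_ho_def using assms by (simp add: ho_Comp)
  also have "\<dots> = \<gamma> (g \<cdot> f)"
    unfolding to_ho_def using assms zz_Comp [OF fg] by (simp add: ho_class_eq_iff)
  finally show ?thesis ..
qed

lemma inverse_arrows_weq:
  assumes w: "w \<in> hom \<C> A B" "w \<in> W"
  shows "inverse_arrows Ho (\<gamma> w) (ho_class \<C> W B A [Bwd w])"
proof -
  note w' = homD [OF w(1)] hom_Obj [OF w(1)]
  have z: "is_zigzag \<C> W A [Fwd w] B" "is_zigzag \<C> W B [Bwd w] A" using w w' by auto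
  have "ho_class \<C> W B A [Bwd w] \<odot> ho_class \<C> W A B [Fwd w] = Id Ho A"
    "ho_class \<C> W A B [Fwd w] \<odot> ho_class \<C> W B A [Bwd w] = Id Ho B"
    using zz_Fwd_Bwd [OF w] zz_Bwd_Fwd [OF w] w' w
    by (simp_all add: ho_Comp [OF z] ho_Comp [OF z(2,1)] ho_class_eq_iff)
  then show ?thesis unfolding inverse_arrows_def to_ho_def w'(2,3)
    using ho_class_hom [OF z(1)] ho_class_hom [OF z(2)] by blast
qed

end

sublocale model_category \<subseteq> Ho: category "ho_cat \<C> W"
  by (rule ho_category)

context model_category
begin

lemma \<gamma>_weq_iso [simp]: "w \<in> W \<Longrightarrow> is_iso Ho (\<gamma> w)"
  using inverse_arrows_weq [of w "Dom \<C> w" "Cod \<C> w"] classes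
  unfolding is_iso_def hom_iff by blast

lemma inv_\<gamma>: "w \<in> hom \<C> A B \<Longrightarrow> w \<in> W \<Longrightarrow> inv_arr Ho (\<gamma> w) = ho_class \<C> W B A [Bwd w]"
  using inverse_arrows_weq Ho.inverse_arrows_unique Ho.inv_arr_inverse \<gamma>_weq_iso by blast

text \<open>Induction over a representing zigzag, removing steps at its end: the source stays fixed,
  the target varies, and each step is a composition on the left.\<close>

lemma Ho_induct [consumes 1, case_names Id Fwd Bwd]:
  assumes x: "x \<in> hom Ho A B"
    and Id: "P A (Id Ho A)"
    and Fwd: "\<And>x B f B'. x \<in> hom Ho A B \<Longrightarrow> P B x \<Longrightarrow> f \<in> hom \<C> B B' \<Longrightarrow> P B' (\<gamma> f \<odot> x)"
    and Bwd: "\<And>x B w B'. x \<in> hom Ho A B \<Longrightarrow> P B x \<Longrightarrow> w \<in> hom \<C> B' B \<Longrightarrow> w \<in> W \<Longrightarrow>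
        P B' (inv_arr Ho (\<gamma> w) \<odot> x)"
  shows "P B x"
proof -
  have "is_zigzag \<C> W A xs B \<Longrightarrow> P B (ho_class \<C> W A B xs)" for xs B
  proof (induction xs arbitrary: B rule: rev_induct)
    case Nil
    then show ?case using Id by simp
  next
    case (snoc s xs)
    then obtain D where D: "is_zigzag \<C> W A xs D" "is_zigzag \<C> W D [s] B" by (auto simp: is_zigzag_append)
    note IH = snoc.IH [OF D(1)] ho_class_hom [OF D(1)]
    show ?case
    proof (cases s)
      case (Fwd f)
      then have f: "f \<in> hom \<C> D B" using D(2) by (auto simp: hom_iff)
      then have "\<gamma> f \<odot> ho_class \<C> W A D xs = ho_class \<C> W A B (xs @ [s])"
        using ho_Comp [OF D] Fwd by (simp add: to_ho_def hom_iff)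
      then show ?thesis using assms(3) [OF IH(2,1) f] by simp
    next
      case (Bwd w)
      then have w: "w \<in> hom \<C> B D" "w \<in> W" using D(2) by (auto simp: hom_iff)
      then have "inv_arr Ho (\<gamma> w) \<odot> ho_class \<C> W A D xs = ho_class \<C> W A B (xs @ [s])"
        using ho_Comp [OF D] Bwd by (simp add: inv_\<gamma>)
      then show ?thesis using assms(4) [OF IH(2,1) w] by simp
    qed
  qed
  then show ?thesis using x by (auto elim!: ho_homE)
qed

declare ho_cat_simps(4) [simp del]

text \<open>Both ends of a cylinder are sections of \<open>s\<close>, and \<open>s\<close> becomes
  invertible, so the ends have the same image.\<close>

lemma left_homotopic_\<gamma>:
  assumes "left_htp f g"
  shows "\<gamma> f = \<gamma> g"
proof -
  obtain A B K a b s h where h: "cylinder \<C> W Cof A K a b s" "h \<in> hom \<C> K B" "h \<cdot> a = f" "h \<cdot> b = g"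
    using assms unfolding left_homotopic_iff by blast
  note c = cylinder_hom [OF h(1)]
  have c': "a \<in> Arr \<C>" "b \<in> Arr \<C>" "s \<in> Arr \<C>" "h \<in> Arr \<C>" "Dom \<C> a = A" "Dom \<C> b = A" "Dom \<C> s = K" "Cod \<C> a = K" "Cod \<C> b = K"
    "Cod \<C> s = A" "Dom \<C> h = K"
    using c h(2) by (auto simp: hom_iff)
  have "\<gamma> s \<odot> \<gamma> a = \<gamma> s \<odot> \<gamma> b" using c(5,6) c' \<gamma>_Comp by metis
  then have "\<gamma> a = \<gamma> b"
    using c' c(4) by (rule_tac Ho.iso_cancel_left [of "\<gamma> s"]) auto
  then show ?thesis using \<gamma>_Comp [of a h] \<gamma>_Comp [of b h] c' h(3,4) by simp
qed

lemma htp_\<gamma>: "(f, g) \<in> htp A B \<Longrightarrow> \<gamma> f = \<gamma> g"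
  by (auto simp: homotopy_rel_def intro: left_homotopic_\<gamma>)

end

text \<open>For a cofibrant object \<open>A\<^sub>0\<close>, sending \<open>A\<close> to the homotopy classes of maps \<open>A\<^sub>0 \<rightarrow> RA\<close> inverts the
  weak equivalences; \<open>zz_rel\<close> is the graph of its action on zigzags.\<close>

fun (in model_category) zz_rel :: "'o \<Rightarrow> 'o \<Rightarrow> 'a step list \<Rightarrow> 'a \<Rightarrow> 'a \<Rightarrow> bool" where
  "zz_rel A\<^sub>0 A [] f g \<longleftrightarrow> (f, g) \<in> htp A\<^sub>0 (Ro A)"
| "zz_rel A\<^sub>0 A (Fwd h # zs) f g \<longleftrightarrow> zz_rel A\<^sub>0 (Cod \<C> h) zs (Ra h \<cdot> f) g"
| "zz_rel A\<^sub>0 A (Bwd w # zs) f g \<longleftrightarrow>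
     (\<exists>f'\<in>hom \<C> A\<^sub>0 (Ro (Dom \<C> w)). (Ra w \<cdot> f', f) \<in> htp A\<^sub>0 (Ro A) \<and> zz_rel A\<^sub>0 (Dom \<C> w) zs f' g)"

context model_category
begin

context
  fixes A\<^sub>0
  assumes A\<^sub>0: "cofib A\<^sub>0"
begin

lemma htpR_sym: "A \<in> Obj \<C> \<Longrightarrow> (f, g) \<in> htp A\<^sub>0 (Ro A) \<Longrightarrow> (g, f) \<in> htp A\<^sub>0 (Ro A)"
  and htpR_trans: "A \<in> Obj \<C> \<Longrightarrow> (f, g) \<in> htp A\<^sub>0 (Ro A) \<Longrightarrow> (g, k) \<in> htp A\<^sub>0 (Ro A) \<Longrightarrow> (f, k) \<in> htp A\<^sub>0 (Ro A)"
  and htpR_refl: "A \<in> Obj \<C> \<Longrightarrow> f \<in> hom \<C> A\<^sub>0 (Ro A) \<Longrightarrow> (f, f) \<in> htp A\<^sub>0 (Ro A)"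
  by (rule htp_sym [OF A\<^sub>0 R_object(1)] htp_trans [OF A\<^sub>0 R_object(1)] htp_refl [OF A\<^sub>0 R_object(1)];
      assumption)+

text \<open>The action is well defined on homotopy classes: a forward step respects homotopy by
  postcomposition, and a backward step mentions the map only up to homotopy.\<close>

lemma zz_rel_htp:
  "is_zigzag \<C> W A xs B \<Longrightarrow> (f, f') \<in> htp A\<^sub>0 (Ro A) \<Longrightarrow> zz_rel A\<^sub>0 A xs f g \<longleftrightarrow> zz_rel A\<^sub>0 A xs f' g"
proof (induction xs arbitrary: A f f')
  case Nil
  have "A \<in> Obj \<C>" using is_zigzag_Obj [OF Nil.prems(1)] by blast
  then show ?case using htpR_sym htpR_trans Nil.prems(2) unfolding zz_rel.simps by blast
next
  case (Cons s xs)
  show ?case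
  proof (cases s)
    case (Fwd h)
    then have h: "h \<in> hom \<C> A (Cod \<C> h)" "is_zigzag \<C> W (Cod \<C> h) xs B"
      using Cons.prems by (auto simp: hom_iff)
    have "(Ra h \<cdot> f, Ra h \<cdot> f') \<in> htp A\<^sub>0 (Ro (Cod \<C> h))"
      using htp_post [OF A\<^sub>0 Cons.prems(2) R_arrow(1) [OF h(1)]] .
    then show ?thesis using Cons.IH [OF h(2)] Fwd by simp
  next
    case (Bwd w)
    have "A \<in> Obj \<C>" using Cons.prems(1) is_zigzag_Obj by blast
    then have "(k, f) \<in> htp A\<^sub>0 (Ro A) \<longleftrightarrow> (k, f') \<in> htp A\<^sub>0 (Ro A)" for k
      using htpR_sym htpR_trans Cons.prems(2) by blast
    then show ?thesis using Bwd by simp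
  qed
qed

lemma zz_rel_append:
  "is_zigzag \<C> W A xs B \<Longrightarrow> is_zigzag \<C> W B ys D \<Longrightarrow> f \<in> hom \<C> A\<^sub>0 (Ro A) \<Longrightarrow>
   zz_rel A\<^sub>0 A (xs @ ys) f g \<longleftrightarrow> (\<exists>k\<in>hom \<C> A\<^sub>0 (Ro B). zz_rel A\<^sub>0 A xs f k \<and> zz_rel A\<^sub>0 B ys k g)"
proof (induction xs arbitrary: A f)
  case Nil
  then have A: "A = B" "B \<in> Obj \<C>" by auto
  have "zz_rel A\<^sub>0 B ys f g \<longleftrightarrow> zz_rel A\<^sub>0 B ys k g" if "(f, k) \<in> htp A\<^sub>0 (Ro B)" for k
    by (rule zz_rel_htp [OF Nil.prems(2) that])
  then show ?case using htpR_refl [OF A(2)] htp_hom Nil.prems(3) unfolding A(1) append_Nil zz_rel.simps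
    by blast
next
  case (Cons s xs)
  show ?case
  proof (cases s)
    case (Fwd h)
    then have h: "h \<in> hom \<C> A (Cod \<C> h)" "is_zigzag \<C> W (Cod \<C> h) xs B"
      using Cons.prems by (auto simp: hom_iff)
    then have "Ra h \<cdot> f \<in> hom \<C> A\<^sub>0 (Ro (Cod \<C> h))"
      using R_arrow(1) Cons.prems(3) Comp_hom by blast
    then show ?thesis using Cons.IH [OF h(2) Cons.prems(2)] Fwd by simp
  next
    case (Bwd w)
    then have "is_zigzag \<C> W (Dom \<C> w) xs B" using Cons.prems by auto
    note IH = Cons.IH [OF this Cons.prems(2)]
    show ?thesis unfolding Bwd append_Cons zz_rel.simps using IH by blast
  qed
qed

text \<open>The generating relations are checked one by one. Identities and composites follow from
  functoriality of \<open>R\<close>. Going along \<open>w\<close> and back is trivial because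
  \<open>Ra w\<close> is injective on homotopy classes; going back first and then along
  \<open>w\<close> is trivial because it is surjective.\<close>

lemma zz_rel_equiv:
  "zz_equiv \<C> W A B xs ys \<Longrightarrow> f \<in> hom \<C> A\<^sub>0 (Ro A) \<Longrightarrow> g \<in> hom \<C> A\<^sub>0 (Ro B) \<Longrightarrow>
   zz_rel A\<^sub>0 A xs f g \<longleftrightarrow> zz_rel A\<^sub>0 A ys f g"
proof (induction arbitrary: f g rule: zz_equiv.induct)
  case (zz_append A B xs xs' D ys ys')
  have z: "is_zigzag \<C> W A xs B" "is_zigzag \<C> W A xs' B" "is_zigzag \<C> W B ys D" "is_zigzag \<C> W B ys' D"
    using zz_append.hyps zz_equiv_zigzag by blast+
  show ?case
    unfolding zz_rel_append [OF z(1,3) zz_append.prems(1)] zz_rel_append [OF z(2,4) zz_append.prems(1)]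
    using zz_append.IH zz_append.prems by blast
next
  case (zz_Id A)
  then show ?case by (simp add: R_Id Id_Comp)
next
  case (zz_Comp h A B k D)
  have "Ra k \<cdot> (Ra h \<cdot> f) = Ra (k \<cdot> h) \<cdot> f"
    using R_Comp [OF zz_Comp.hyps] Comp_assoc [OF zz_Comp.prems(1) R_arrow(1) R_arrow(1), OF zz_Comp.hyps] by simp
  then show ?case using homD [OF zz_Comp.hyps(2)] homD [OF Comp_hom [OF zz_Comp.hyps]] by simp
next
  case (zz_Fwd_Bwd w A B)
  note w = zz_Fwd_Bwd.hyps and ob = hom_Obj [OF zz_Fwd_Bwd.hyps(1)]
  note R = R_object(1) [OF ob(1)] R_object(1) [OF ob(2)] R_arrow(1) [OF w(1)]
  have Rw: "Ra w \<in> W" using R_weq w by blast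
  have "zz_rel A\<^sub>0 A [Fwd w, Bwd w] f g \<longleftrightarrow>
      (\<exists>f'\<in>hom \<C> A\<^sub>0 (Ro A). (Ra w \<cdot> f', Ra w \<cdot> f) \<in> htp A\<^sub>0 (Ro B) \<and> (f', g) \<in> htp A\<^sub>0 (Ro A))"
    using homD [OF w(1)] by simp
  also have "\<dots> \<longleftrightarrow> (f, g) \<in> htp A\<^sub>0 (Ro A)"
  proof
    assume "(f, g) \<in> htp A\<^sub>0 (Ro A)"
    moreover have "(Ra w \<cdot> f, Ra w \<cdot> f) \<in> htp A\<^sub>0 (Ro B)"
      using htpR_refl [OF ob(2)] Comp_hom [OF zz_Fwd_Bwd.prems(1) R(3)] by blast
    ultimately show "\<exists>f'\<in>hom \<C> A\<^sub>0 (Ro A). (Ra w \<cdot> f', Ra w \<cdot> f) \<in> htp A\<^sub>0 (Ro B) \<and> (f', g) \<in> htp A\<^sub>0 (Ro A)"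
      using zz_Fwd_Bwd.prems(1) by blast
  next
    assume "\<exists>f'\<in>hom \<C> A\<^sub>0 (Ro A). (Ra w \<cdot> f', Ra w \<cdot> f) \<in> htp A\<^sub>0 (Ro B) \<and> (f', g) \<in> htp A\<^sub>0 (Ro A)"
    then obtain f' where f': "f' \<in> hom \<C> A\<^sub>0 (Ro A)" "(Ra w \<cdot> f', Ra w \<cdot> f) \<in> htp A\<^sub>0 (Ro B)" "(f', g) \<in> htp A\<^sub>0 (Ro A)"
      by blast
    have "(f', f) \<in> htp A\<^sub>0 (Ro A)"
      using weq_htp_reflect [OF A\<^sub>0 R(1-3) Rw f'(1) zz_Fwd_Bwd.prems(1) f'(2)] .
    then show "(f, g) \<in> htp A\<^sub>0 (Ro A)" using f'(3) htpR_sym [OF ob(1)] htpR_trans [OF ob(1)] by blast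
  qed
  finally show ?case by simp
next
  case (zz_Bwd_Fwd w A B)
  note w = zz_Bwd_Fwd.hyps and ob = hom_Obj [OF zz_Bwd_Fwd.hyps(1)]
  note R = R_object(1) [OF ob(1)] R_object(1) [OF ob(2)] R_arrow(1) [OF w(1)]
  have Rw: "Ra w \<in> W" using R_weq w by blast
  have "zz_rel A\<^sub>0 B [Bwd w, Fwd w] f g \<longleftrightarrow>
      (\<exists>f'\<in>hom \<C> A\<^sub>0 (Ro A). (Ra w \<cdot> f', f) \<in> htp A\<^sub>0 (Ro B) \<and> (Ra w \<cdot> f', g) \<in> htp A\<^sub>0 (Ro B))"
    using homD [OF w(1)] by simp
  also have "\<dots> \<longleftrightarrow> (f, g) \<in> htp A\<^sub>0 (Ro B)"
    using weq_htp_surj [OF A\<^sub>0 R Rw zz_Bwd_Fwd.prems(1)] htpR_sym [OF ob(2)] htpR_trans [OF ob(2)] by metis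
  finally show ?case by simp
qed auto

end

text \<open>An evaluation in the style of Yoneda: the zigzag \<open>[Fwd f]\<close> sends
  \<open>q A\<close>, which stands for the identity of \<open>A\<close>, to
  \<open>Ra f \<cdot> q A = q B \<cdot> f\<close>. As \<open>B\<close> is fibrant,
  \<open>q B\<close> can then be cancelled up to homotopy.\<close>

theorem \<gamma>_eq_iff_htp:
  assumes AB: "cofib A" "fib B" and fg: "f \<in> hom \<C> A B" "g \<in> hom \<C> A B"
  shows "\<gamma> f = \<gamma> g \<longleftrightarrow> (f, g) \<in> htp A B"
proof
  assume "\<gamma> f = \<gamma> g"
  moreover have z: "is_zigzag \<C> W A [Fwd f] B" using homD [OF fg(1)] hom_Obj [OF fg(1)] by simp
  ultimately have eq: "zz_equiv \<C> W A B [Fwd f] [Fwd g]"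
    using homD [OF fg(1)] homD [OF fg(2)] ho_class_eq_iff [OF z] by (simp add: to_ho_def)
  note q = R_object [OF cofibrant_Obj [OF AB(1)]] R_object [OF fibrant_Obj [OF AB(2)]]
  have qg: "q B \<cdot> g \<in> hom \<C> A (Ro B)" using Comp_hom [OF fg(2) q(6)] .
  have "zz_rel A A [Fwd g] (q A) (q B \<cdot> g)"
    using R_arrow(2) [OF fg(2)] homD [OF fg(2)] htp_refl [OF AB(1) q(5) qg] by simp
  then have "zz_rel A A [Fwd f] (q A) (q B \<cdot> g)"
    using zz_rel_equiv [OF AB(1) eq q(2) qg] by simp
  then have "(q B \<cdot> f, q B \<cdot> g) \<in> htp A (Ro B)"
    using R_arrow(2) [OF fg(1)] homD [OF fg(1)] by simp
  then show "(f, g) \<in> htp A B" using weq_htp_reflect [OF AB q(5,6,8) fg] by simp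
qed (rule htp_\<gamma>)

text \<open>The objects that a zigzag passes through need not be fibrant, so the induction
  represents \<open>x\<close> followed by \<open>q\<close> at the current target. Only at the end,
  where \<open>B\<close> is fibrant, is \<open>q B\<close> removed.\<close>

theorem Ho_arrow_lift:
  assumes AB: "cofib A" "fib B" and x: "x \<in> hom Ho A B"
  obtains f where "f \<in> hom \<C> A B" "\<gamma> f = x"
proof -
  from x have "\<exists>f\<in>hom \<C> A (Ro B). \<gamma> (q B) \<odot> x = \<gamma> f"
  proof (induction rule: Ho_induct)
    case Id
    then show ?case using R_object [OF cofibrant_Obj [OF AB(1)]] by (auto simp: hom_iff intro!: bexI [of _ "q A"])
  next
    case (Fwd x B g B')
    obtain f where f: "f \<in> hom \<C> A (Ro B)" "\<gamma> (q B) \<odot> x = \<gamma> f" using Fwd.IH by blast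
    note g = R_arrow [OF Fwd.hyps(2)] and ob = hom_Obj [OF Fwd.hyps(2)]
    note q = R_object(2) [OF ob(1)] R_object(2) [OF ob(2)]
    have "\<gamma> (q B') \<odot> (\<gamma> g \<odot> x) = (\<gamma> (q B') \<odot> \<gamma> g) \<odot> x"
      using q Fwd.hyps by (simp add: hom_iff)
    also have "\<dots> = (\<gamma> (Ra g) \<odot> \<gamma> (q B)) \<odot> x"
      using g q Fwd.hyps(2) by (simp add: hom_iff flip: \<gamma>_Comp)
    also have "\<dots> = \<gamma> (Ra g \<cdot> f)"
      using g q Fwd.hyps(1) f by (simp add: hom_iff \<gamma>_Comp)
    finally show ?case using Comp_hom [OF f(1) g(1)] by blast
  next
    case (Bwd x B w B')
    obtain f where f: "f \<in> hom \<C> A (Ro B)" "\<gamma> (q B) \<odot> x = \<gamma> f" using Bwd.IH by blast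
    note g = R_arrow [OF Bwd.hyps(2)] and ob = hom_Obj [OF Bwd.hyps(2)]
    note q = R_object [OF ob(1)] R_object [OF ob(2)]
    have w: "Ra w \<in> W" using R_weq Bwd.hyps(2,3) by blast
    obtain f' where f': "f' \<in> hom \<C> A (Ro B')" "(Ra w \<cdot> f', f) \<in> htp A (Ro B)"
      using weq_htp_surj [OF AB(1) q(1,5) g(1) w f(1)] .
    have s: "w \<in> Arr \<C>" "Dom \<C> w = B'" "Cod \<C> w = B" "x \<in> Arr Ho" "Cod Ho x = B"
       "f' \<in> Arr \<C>" "Cod \<C> f' = Ro B'" "Ra w \<in> Arr \<C>" "Dom \<C> (Ra w) = Ro B'" "Cod \<C> (Ra w) = Ro B"
       "q B \<in> Arr \<C>" "Dom \<C> (q B) = B" "Cod \<C> (q B) = Ro B"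
       "q B' \<in> Arr \<C>" "Dom \<C> (q B') = B'" "Cod \<C> (q B') = Ro B'"
      using Bwd.hyps(1,2) f'(1) g(1) q by (auto simp: hom_iff)
    have "\<gamma> (Ra w) \<odot> (\<gamma> (q B') \<odot> (inv_arr Ho (\<gamma> w) \<odot> x)) = (\<gamma> (Ra w) \<odot> \<gamma> (q B')) \<odot> (inv_arr Ho (\<gamma> w) \<odot> x)"
      using s Bwd.hyps(3) by simp
    also have "\<dots> = (\<gamma> (q B) \<odot> \<gamma> w) \<odot> (inv_arr Ho (\<gamma> w) \<odot> x)"
      using g(2) s by (simp flip: \<gamma>_Comp)
    also have "\<dots> = \<gamma> f" using s Bwd.hyps(3) f(2) by simp
    also have "\<dots> = \<gamma> (Ra w) \<odot> \<gamma> f'" using htp_\<gamma> [OF f'(2)] s by (simp add: \<gamma>_Comp)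
    finally have "\<gamma> (q B') \<odot> (inv_arr Ho (\<gamma> w) \<odot> x) = \<gamma> f'"
      by (rule Ho.iso_cancel_left [OF \<gamma>_weq_iso [OF w], rotated -1]) (use s Bwd.hyps(3) in auto)
    then show ?case using f'(1) by blast
  qed
  then obtain f where f: "f \<in> hom \<C> A (Ro B)" "\<gamma> (q B) \<odot> x = \<gamma> f" by blast
  note q = R_object [OF fibrant_Obj [OF AB(2)]]
  obtain g where g: "g \<in> hom \<C> A B" "(q B \<cdot> g, f) \<in> htp A (Ro B)"
    using weq_htp_surj [OF AB q(1,2,4) f(1)] .
  have "\<gamma> (q B) \<odot> \<gamma> g = \<gamma> (q B) \<odot> x"
    using htp_\<gamma> [OF g(2)] f(2) g(1) q(2) by (simp add: hom_iff \<gamma>_Comp)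
  then have "\<gamma> g = x"
    by (rule Ho.iso_cancel_left [OF \<gamma>_weq_iso [OF q(4)], rotated -1]) (use g(1) x q in \<open>auto simp: hom_iff\<close>)
  then show ?thesis using that g(1) by blast
qed

section \<open>Saturation of the class of weak equivalences\<close>

lemma left_homotopic_to_Id_weq:
  assumes "cofib A" "left_htp f (Id \<C> A)"
  shows "f \<in> W"
proof -
  have A: "A \<in> Obj \<C>" using cofibrant_Obj assms(1) .
  obtain K a b s h where h: "cylinder \<C> W Cof A K a b s" "h \<in> hom \<C> K A" "h \<cdot> a = Id \<C> A" "h \<cdot> b = f"
    using left_homotopicE [OF left_homotopic_sym [OF assms(2)] Id_hom [OF A]] .
  note c = cylinder_hom [OF h(1)] and ab = cylinder_Cof [OF assms(1) h(1)]
  have "h \<in> W" using W_cancel_right [OF c(1) h(2) ab(2)] h(3) Id_classes(1) [OF A] by simp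
  then show ?thesis using W_Comp [OF c(2) h(2) ab(4)] h(4) by simp
qed

text \<open>The inverse in \<open>Ho\<close> is represented by a map \<open>s\<close> with
  \<open>e \<cdot> s\<close> homotopic to the identity. Lifting this homotopy through the fibration
  \<open>e\<close>, starting at \<open>s\<close>, replaces \<open>s\<close> by a strict section
  \<open>r\<close>. Then \<open>r \<cdot> e\<close> is homotopic to the identity, hence a weak
  equivalence, and \<open>e\<close> is a retract of it.\<close>

lemma bifibrant_Fib_saturated:
  assumes A: "cofib A" "fib A" and B: "cofib B" "fib B"
    and e: "e \<in> hom \<C> A B" "e \<in> Fib" and iso: "is_iso Ho (\<gamma> e)"
  shows "e \<in> W"
proof -
  note ob = hom_Obj [OF e(1)] and e' = homD [OF e(1)]
  have "inv_arr Ho (\<gamma> e) \<in> hom Ho B A" using iso e' by (auto simp: hom_iff)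
  then obtain s where s: "s \<in> hom \<C> B A" "\<gamma> s = inv_arr Ho (\<gamma> e)"
    by (rule Ho_arrow_lift [OF B(1) A(2)])
  note s' = homD [OF s(1)]
  have "\<gamma> (e \<cdot> s) = \<gamma> (Id \<C> B)" using s(2) s' e' iso ob by (simp add: \<gamma>_Comp)
  then have "left_htp (e \<cdot> s) (Id \<C> B)"
    using \<gamma>_eq_iff_htp [OF B Comp_hom [OF s(1) e(1)] Id_hom [OF ob(2)]] htp_left [OF B(1)] by simp
  then obtain K a b t h where h: "cylinder \<C> W Cof B K a b t" "h \<in> hom \<C> K B" "h \<cdot> a = e \<cdot> s" "h \<cdot> b = Id \<C> B"
    using left_homotopicE Comp_hom [OF s(1) e(1)] by metis
  note c = cylinder_hom [OF h(1)] and ab = cylinder_Cof [OF B(1) h(1)]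
  obtain d where d: "d \<in> hom \<C> K A" "d \<cdot> a = s" "e \<cdot> d = h"
    using has_liftingD [OF lift_trivcof_fib c(1) e(1) s(1) h(2)] ab e(2) h(3) by auto
  define r where "r = d \<cdot> b"
  have r: "r \<in> hom \<C> B A" unfolding r_def using Comp_hom [OF c(2) d(1)] .
  have er: "e \<cdot> r = Id \<C> B" unfolding r_def using Comp_assoc [OF c(2) d(1) e(1)] d(3) h(4) by simp
  have "left_htp s r" unfolding left_homotopic_iff r_def using h(1) d by blast
  then have "\<gamma> r = inv_arr Ho (\<gamma> e)" using left_homotopic_\<gamma> s(2) by metis
  then have "\<gamma> (r \<cdot> e) = \<gamma> (Id \<C> A)" using homD [OF r] e' iso ob by (simp add: \<gamma>_Comp)
  then have "left_htp (r \<cdot> e) (Id \<C> A)"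
    using \<gamma>_eq_iff_htp [OF A Comp_hom [OF e(1) r] Id_hom [OF ob(1)]] htp_left [OF A(1)] by simp
  then have re: "r \<cdot> e \<in> W" by (rule left_homotopic_to_Id_weq [OF A(1)])
  \<comment> \<open>On sources the retract is given by identities of \<open>A\<close>; on targets it
    is \<open>r\<close> followed by \<open>e\<close>, whose composite is the identity by
    \<open>er\<close>.\<close>
  have "is_retract \<C> e (r \<cdot> e)"
  proof -
    have "Id \<C> A \<cdot> Id \<C> A = Id \<C> A" "r \<cdot> e \<cdot> Id \<C> A = r \<cdot> e" "e \<cdot> Id \<C> A = e \<cdot> (r \<cdot> e)"
      using homD [OF r] e' ob er by (simp_all flip: Comp_assoc_simp)
    then show ?thesis unfolding is_retract_def
      using e(1) Comp_hom [OF e(1) r] Id_hom [OF ob(1)] r er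
        Comp_Id [OF e(1)] by metis
  qed
  then show ?thesis using W_retract re by blast
qed

text \<open>Factor \<open>f\<close> as a trivial cofibration followed by a fibration. The middle
  object is bifibrant again, and the fibration inherits invertibility in \<open>Ho\<close>.\<close>

lemma bifibrant_saturated:
  assumes A: "cofib A" "fib A" and B: "cofib B" "fib B"
    and f: "f \<in> hom \<C> A B" and iso: "is_iso Ho (\<gamma> f)"
  shows "f \<in> W"
proof -
  obtain K c e where ce: "c \<in> hom \<C> A K" "c \<in> Cof \<inter> W" "e \<in> hom \<C> K B" "e \<in> Fib" "e \<cdot> c = f"
    using fact_obtains [OF fact_trivcof_fib f] by metis
  have "is_iso Ho (\<gamma> e)"
    using ce iso by (rule_tac Ho.is_iso_cancel_right [of "\<gamma> c"]) (auto simp: hom_iff \<gamma>_Comp)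
  moreover have "cofib K" "fib K"
    using cofibrant_Cof [OF A(1) ce(1)] fibrant_Fib [OF B(2) ce(3)] ce by auto
  ultimately have "e \<in> W" using bifibrant_Fib_saturated B ce by blast
  then show ?thesis using W_Comp [OF ce(1,3)] ce by auto
qed

text \<open>The naturality squares of \<open>p\<close> and of \<open>q\<close> carry invertibility
  from \<open>f\<close> to \<open>Ra (Qa f)\<close>, which joins bifibrant objects, and the property
  of being a weak equivalence back to \<open>f\<close>.\<close>

theorem saturated:
  assumes "f \<in> Arr \<C>"
  shows "is_iso Ho (\<gamma> f) \<longleftrightarrow> f \<in> W"
proof
  assume iso: "is_iso Ho (\<gamma> f)"
  have f: "f \<in> hom \<C> (Dom \<C> f) (Cod \<C> f)" using assms by (simp add: hom_iff)
  note ob = hom_Obj [OF f]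
  note A = Q_object [OF ob(1)] and B = Q_object [OF ob(2)] and Qf = Q_arrow [OF f]
  note QA = R_object [OF cofibrant_Obj [OF A(1)]] and QB = R_object [OF cofibrant_Obj [OF B(1)]]
    and Rf = R_arrow [OF Qf(1)]
  have "is_iso Ho (\<gamma> f \<odot> \<gamma> (p (Dom \<C> f)))"
    using iso A assms by (rule_tac Ho.is_iso_Comp) (auto simp: hom_iff)
  then have "is_iso Ho (\<gamma> (p (Cod \<C> f)) \<odot> \<gamma> (Qa f))"
    using assms A B Qf by (simp add: hom_iff flip: \<gamma>_Comp)
  then have "is_iso Ho (\<gamma> (Qa f))"
    using B Qf by (rule_tac Ho.is_iso_cancel_left [of "\<gamma> (p (Cod \<C> f))"]) (auto simp: hom_iff)
  then have "is_iso Ho (\<gamma> (q (Qo (Cod \<C> f))) \<odot> \<gamma> (Qa f))"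
    using Qf QB by (rule_tac Ho.is_iso_Comp) (auto simp: hom_iff)
  then have "is_iso Ho (\<gamma> (Ra (Qa f)) \<odot> \<gamma> (q (Qo (Dom \<C> f))))"
    using Qf Rf QA QB by (simp add: hom_iff flip: \<gamma>_Comp)
  then have "is_iso Ho (\<gamma> (Ra (Qa f)))"
    using Rf QA by (rule_tac Ho.is_iso_cancel_right [of "\<gamma> (q (Qo (Dom \<C> f)))"]) (auto simp: hom_iff)
  then have "Ra (Qa f) \<in> W"
    by (rule bifibrant_saturated [OF R_cofibrant [OF A(1)] QA(1) R_cofibrant [OF B(1)] QB(1) Rf(1)])
  then show "f \<in> W" using R_weq [OF Qf(1)] Q_weq [OF f] by simp
qed simp

end

section \<open>Detecting weak equivalences by homotopy classes\<close>

context model_category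
begin

lemma weq_left_cancel_\<gamma>:
  assumes "a \<in> hom \<C> X K" "b \<in> hom \<C> X K" "s \<in> hom \<C> K A" "s \<in> W" "s \<cdot> a = s \<cdot> b"
  shows "\<gamma> a = \<gamma> b"
proof (rule Ho.iso_cancel_left [of "\<gamma> s"])
  show "\<gamma> s \<odot> \<gamma> a = \<gamma> s \<odot> \<gamma> b"
    using assms \<gamma>_Comp [of a s] \<gamma>_Comp [of b s] by (simp add: hom_iff)
qed (use assms in \<open>auto simp: hom_iff\<close>)

lemma weq_right_cancel_\<gamma>:
  assumes "a \<in> hom \<C> K X" "b \<in> hom \<C> K X" "s \<in> hom \<C> A K" "s \<in> W" "a \<cdot> s = b \<cdot> s"
  shows "\<gamma> a = \<gamma> b"
proof (rule Ho.iso_cancel_right [of "\<gamma> s"])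
  show "\<gamma> a \<odot> \<gamma> s = \<gamma> b \<odot> \<gamma> s"
    using assms \<gamma>_Comp [of s a] \<gamma>_Comp [of s b] by (simp add: hom_iff)
qed (use assms in \<open>auto simp: hom_iff\<close>)

text \<open>The first clause is well-definedness and injectivity at once, the second is
  surjectivity. Stating both through \<gamma> avoids quotient sets, so that such functions can be
  composed and cancelled directly.\<close>

definition \<gamma>_bij :: "'o \<Rightarrow> 'o \<Rightarrow> 'o \<Rightarrow> 'o \<Rightarrow> ('a \<Rightarrow> 'a) \<Rightarrow> bool" where
  "\<gamma>_bij X Y X' Y' F \<longleftrightarrow>
     (\<forall>f\<in>hom \<C> X Y. \<forall>g\<in>hom \<C> X Y. \<gamma> (F f) = \<gamma> (F g) \<longleftrightarrow> \<gamma> f = \<gamma> g) \<and>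
     (\<forall>k\<in>hom \<C> X' Y'. \<exists>f\<in>hom \<C> X Y. \<gamma> (F f) = \<gamma> k)"

lemma \<gamma>_bij_cong:
  assumes "\<And>f. f \<in> hom \<C> X Y \<Longrightarrow> F f = G f"
  shows "\<gamma>_bij X Y X' Y' F \<longleftrightarrow> \<gamma>_bij X Y X' Y' G"
  using assms by (simp add: \<gamma>_bij_def)

text \<open>Cancellation of an outer bijection; it strips \<open>\<phi>\<close> from the outside of
  a composite.\<close>

lemma \<gamma>_bij_comp_left:
  assumes "\<gamma>_bij X' Y' X'' Y'' G" "\<And>f. f \<in> hom \<C> X Y \<Longrightarrow> F f \<in> hom \<C> X' Y'"
    "\<And>f. f \<in> hom \<C> X' Y' \<Longrightarrow> G f \<in> hom \<C> X'' Y''"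
  shows "\<gamma>_bij X Y X'' Y'' (\<lambda>f. G (F f)) \<longleftrightarrow> \<gamma>_bij X Y X' Y' F"
proof -
  have G: "\<gamma> (G f) = \<gamma> (G g) \<longleftrightarrow> \<gamma> f = \<gamma> g" if "f \<in> hom \<C> X' Y'" "g \<in> hom \<C> X' Y'" for f g
    using that assms(1) by (simp add: \<gamma>_bij_def)
  have surj: "\<exists>f\<in>hom \<C> X' Y'. \<gamma> (G f) = \<gamma> k" if "k \<in> hom \<C> X'' Y''" for k
    using that assms(1) by (simp add: \<gamma>_bij_def)
  show ?thesis
  proof
    assume *: "\<gamma>_bij X Y X'' Y'' (\<lambda>f. G (F f))"
    show "\<gamma>_bij X Y X' Y' F" unfolding \<gamma>_bij_def
    proof (intro conjI ballI)
      fix f g assume "f \<in> hom \<C> X Y" "g \<in> hom \<C> X Y"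
      then show "\<gamma> (F f) = \<gamma> (F g) \<longleftrightarrow> \<gamma> f = \<gamma> g"
        using * G [of "F f" "F g"] assms(2) by (simp add: \<gamma>_bij_def)
    next
      fix k assume k: "k \<in> hom \<C> X' Y'"
      then obtain f where "f \<in> hom \<C> X Y" "\<gamma> (G (F f)) = \<gamma> (G k)"
        using * assms(3) unfolding \<gamma>_bij_def by blast
      then show "\<exists>f\<in>hom \<C> X Y. \<gamma> (F f) = \<gamma> k" using G k assms(2) by blast
    qed
  next
    assume *: "\<gamma>_bij X Y X' Y' F"
    show "\<gamma>_bij X Y X'' Y'' (\<lambda>f. G (F f))" unfolding \<gamma>_bij_def
    proof (intro conjI ballI)
      fix f g assume "f \<in> hom \<C> X Y" "g \<in> hom \<C> X Y"
      then show "\<gamma> (G (F f)) = \<gamma> (G (F g)) \<longleftrightarrow> \<gamma> f = \<gamma> g"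
        using * G [of "F f" "F g"] assms(2) by (simp add: \<gamma>_bij_def)
    next
      fix k assume "k \<in> hom \<C> X'' Y''"
      then obtain f' where f': "f' \<in> hom \<C> X' Y'" "\<gamma> (G f') = \<gamma> k" using surj by blast
      then obtain f where f: "f \<in> hom \<C> X Y" "\<gamma> (F f) = \<gamma> f'" using * by (auto simp: \<gamma>_bij_def)
      then show "\<exists>f\<in>hom \<C> X Y. \<gamma> (G (F f)) = \<gamma> k" using G [OF assms(2) f'(1)] f'(2) by metis
    qed
  qed
qed

text \<open>Here \<open>G\<close> is bijective on maps and not only up to \<gamma>, as
  \<open>\<phi>\<close> is. Statements about all maps in its target then become statements about all
  maps in its source.\<close>

lemma \<gamma>_bij_comp_right:
  assumes "\<gamma>_bij X Y X' Y' G" "bij_betw G (hom \<C> X Y) (hom \<C> X' Y')"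
  shows "\<gamma>_bij X Y X'' Y'' (\<lambda>f. F (G f)) \<longleftrightarrow> \<gamma>_bij X' Y' X'' Y'' F"
proof -
  have img: "hom \<C> X' Y' = G ` hom \<C> X Y" using assms(2) by (simp add: bij_betw_def)
  have "\<gamma> (G f) = \<gamma> (G g) \<longleftrightarrow> \<gamma> f = \<gamma> g" if "f \<in> hom \<C> X Y" "g \<in> hom \<C> X Y" for f g
    using that assms(1) by (simp add: \<gamma>_bij_def)
  then show ?thesis unfolding \<gamma>_bij_def img by simp
qed

text \<open>A Yoneda argument in \<open>Ho\<close>, where fibrant objects are enough because each
  object is isomorphic to its fibrant replacement. Surjectivity at \<open>Ro X\<close> yields a left
  inverse of \<open>\<gamma> m\<close>, injectivity at \<open>Ro Y\<close> shows that it is also a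
  right inverse, and saturation concludes.\<close>

theorem weq_iff_precomp_bij:
  assumes X: "cofib X" and Y: "cofib Y" and m: "m \<in> hom \<C> X Y"
  shows "m \<in> W \<longleftrightarrow> (\<forall>B. fib B \<longrightarrow> \<gamma>_bij Y B X B (\<lambda>f. f \<cdot> m))"
proof
  note m' = homD [OF m]
  assume W: "m \<in> W"
  show "\<forall>B. fib B \<longrightarrow> \<gamma>_bij Y B X B (\<lambda>f. f \<cdot> m)"
    unfolding \<gamma>_bij_def
  proof (intro allI impI conjI ballI)
    fix B f g assume "f \<in> hom \<C> Y B" "g \<in> hom \<C> Y B"
    then have s: "f \<in> Arr \<C>" "Dom \<C> f = Y" "Cod \<C> f = B" "g \<in> Arr \<C>" "Dom \<C> g = Y" "Cod \<C> g = B"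
      by (auto simp: hom_iff)
    show "\<gamma> (f \<cdot> m) = \<gamma> (g \<cdot> m) \<longleftrightarrow> \<gamma> f = \<gamma> g"
      using s m' W Ho.iso_cancel_right [of "\<gamma> m" "\<gamma> f" "\<gamma> g"] by (auto simp: \<gamma>_Comp)
  next
    fix B k assume B: "fib B" and k: "k \<in> hom \<C> X B"
    have "\<gamma> k \<odot> inv_arr Ho (\<gamma> m) \<in> hom Ho Y B"
      using k m' W by (auto simp: hom_iff)
    then obtain f where f: "f \<in> hom \<C> Y B" "\<gamma> f = \<gamma> k \<odot> inv_arr Ho (\<gamma> m)"
      by (rule Ho_arrow_lift [OF Y B])
    then have "\<gamma> (f \<cdot> m) = \<gamma> k" using m' W k by (simp add: hom_iff \<gamma>_Comp)
    then show "\<exists>f\<in>hom \<C> Y B. \<gamma> (f \<cdot> m) = \<gamma> k" using f by blast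
  qed
next
  note m' = homD [OF m]
  assume *: "\<forall>B. fib B \<longrightarrow> \<gamma>_bij Y B X B (\<lambda>f. f \<cdot> m)"
  note qX = R_object [OF cofibrant_Obj [OF X]] and qY = R_object [OF cofibrant_Obj [OF Y]]
  obtain f where f: "f \<in> hom \<C> Y (Ro X)" "\<gamma> (f \<cdot> m) = \<gamma> (q X)"
    using * qX(1,2) unfolding \<gamma>_bij_def by blast
  define e where "e = inv_arr Ho (\<gamma> (q X)) \<odot> \<gamma> f"
  have s: "e \<in> Arr Ho" "Dom Ho e = Y" "Cod Ho e = X" "m \<in> Arr \<C>" "Dom \<C> m = X" "Cod \<C> m = Y"
    "q Y \<in> Arr \<C>" "Dom \<C> (q Y) = Y" "Cod \<C> (q Y) = Ro Y" "X \<in> Obj \<C>" "Y \<in> Obj \<C>"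
    using f qX qY m' cofibrant_Obj X Y unfolding e_def by (auto simp: hom_iff)
  have em: "e \<odot> \<gamma> m = Id Ho X"
    using f qX m' unfolding e_def by (simp add: hom_iff flip: \<gamma>_Comp)
  have "\<gamma> (q Y) \<odot> \<gamma> m \<odot> e \<in> hom Ho Y (Ro Y)" using s by (auto simp: hom_iff)
  \<comment> \<open>\<open>g\<close> represents \<open>q Y\<close> after the idempotent
    \<open>m e\<close>. It agrees with \<open>q Y\<close> once precomposed with \<open>m\<close>,
    since \<open>e\<close> is a left inverse of \<open>m\<close>, and injectivity then removes
    \<open>m\<close>.\<close>
  then obtain g where g: "g \<in> hom \<C> Y (Ro Y)" "\<gamma> g = \<gamma> (q Y) \<odot> \<gamma> m \<odot> e"
    by (rule Ho_arrow_lift [OF Y qY(1)])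
  have "\<gamma> (g \<cdot> m) = \<gamma> (q Y \<cdot> m)" using g s em by (simp add: hom_iff \<gamma>_Comp)
  then have "\<gamma> g = \<gamma> (q Y)" using * qY(1,2) g(1) unfolding \<gamma>_bij_def by blast
  then have "\<gamma> (q Y) \<odot> (\<gamma> m \<odot> e) = \<gamma> (q Y) \<odot> Id Ho Y" using g(2) s by simp
  then have "\<gamma> m \<odot> e = Id Ho Y"
    by (rule Ho.iso_cancel_left [OF \<gamma>_weq_iso [OF qY(4)], rotated -1]) (use s in auto)
  then have "is_iso Ho (\<gamma> m)" using s em by (rule_tac Ho.is_isoI [of _ e]) auto
  then show "m \<in> W" using saturated m' by simp
qed

text \<open>The mirror image of the argument for precomposition, with \<open>p\<close> and
  \<open>Q\<close> in place of \<open>q\<close> and \<open>R\<close>. It is carried out directly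
  because an instance of \<open>op_model\<close> would speak of the localisation of the opposite
  category.\<close>

theorem weq_iff_postcomp_bij:
  assumes X: "fib X" and Y: "fib Y" and m: "m \<in> hom \<C> X Y"
  shows "m \<in> W \<longleftrightarrow> (\<forall>A. cofib A \<longrightarrow> \<gamma>_bij A X A Y (\<lambda>f. m \<cdot> f))"
proof
  note m' = homD [OF m]
  assume W: "m \<in> W"
  show "\<forall>A. cofib A \<longrightarrow> \<gamma>_bij A X A Y (\<lambda>f. m \<cdot> f)"
    unfolding \<gamma>_bij_def
  proof (intro allI impI conjI ballI)
    fix A f g assume "f \<in> hom \<C> A X" "g \<in> hom \<C> A X"
    then have s: "f \<in> Arr \<C>" "Dom \<C> f = A" "Cod \<C> f = X" "g \<in> Arr \<C>" "Dom \<C> g = A" "Cod \<C> g = X"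
      by (auto simp: hom_iff)
    show "\<gamma> (m \<cdot> f) = \<gamma> (m \<cdot> g) \<longleftrightarrow> \<gamma> f = \<gamma> g"
      using s m' W Ho.iso_cancel_left [of "\<gamma> m" "\<gamma> f" "\<gamma> g"] by (auto simp: \<gamma>_Comp)
  next
    fix A k assume A: "cofib A" and k: "k \<in> hom \<C> A Y"
    have "inv_arr Ho (\<gamma> m) \<odot> \<gamma> k \<in> hom Ho A X"
      using k m' W by (auto simp: hom_iff)
    then obtain f where f: "f \<in> hom \<C> A X" "\<gamma> f = inv_arr Ho (\<gamma> m) \<odot> \<gamma> k"
      by (rule Ho_arrow_lift [OF A X])
    then have "\<gamma> (m \<cdot> f) = \<gamma> k" using m' W k by (simp add: hom_iff \<gamma>_Comp)
    then show "\<exists>f\<in>hom \<C> A X. \<gamma> (m \<cdot> f) = \<gamma> k" using f by blast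
  qed
next
  note m' = homD [OF m]
  assume *: "\<forall>A. cofib A \<longrightarrow> \<gamma>_bij A X A Y (\<lambda>f. m \<cdot> f)"
  note pX = Q_object [OF fibrant_Obj [OF X]] and pY = Q_object [OF fibrant_Obj [OF Y]]
  obtain f where f: "f \<in> hom \<C> (Qo Y) X" "\<gamma> (m \<cdot> f) = \<gamma> (p Y)"
    using * pY(1,2) unfolding \<gamma>_bij_def by blast
  define e where "e = \<gamma> f \<odot> inv_arr Ho (\<gamma> (p Y))"
  have s: "e \<in> Arr Ho" "Dom Ho e = Y" "Cod Ho e = X" "m \<in> Arr \<C>" "Dom \<C> m = X" "Cod \<C> m = Y"
    "p X \<in> Arr \<C>" "Dom \<C> (p X) = Qo X" "Cod \<C> (p X) = X" "X \<in> Obj \<C>" "Y \<in> Obj \<C>"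
    using f pX pY m' fibrant_Obj X Y unfolding e_def by (auto simp: hom_iff)
  have "(\<gamma> m \<odot> \<gamma> f) \<odot> inv_arr Ho (\<gamma> (p Y)) = Id Ho Y"
    using f pY m' by (simp add: hom_iff flip: \<gamma>_Comp del: Ho.Comp_assoc_simp)
  then have me: "\<gamma> m \<odot> e = Id Ho Y"
    using f(1) pY m' unfolding e_def by (simp add: hom_iff)
  have "e \<odot> \<gamma> m \<odot> \<gamma> (p X) \<in> hom Ho (Qo X) X" using s by (auto simp: hom_iff)
  then obtain g where g: "g \<in> hom \<C> (Qo X) X" "\<gamma> g = e \<odot> \<gamma> m \<odot> \<gamma> (p X)"
    by (rule Ho_arrow_lift [OF pX(1) X])
  have "\<gamma> (m \<cdot> g) = (\<gamma> m \<odot> e) \<odot> (\<gamma> m \<odot> \<gamma> (p X))" using g s by (simp add: hom_iff \<gamma>_Comp)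
  also have "\<dots> = \<gamma> (m \<cdot> p X)" using me s by (simp add: hom_iff \<gamma>_Comp)
  finally have "\<gamma> g = \<gamma> (p X)" using * pX(1,2) g(1) unfolding \<gamma>_bij_def by blast
  then have "(e \<odot> \<gamma> m) \<odot> \<gamma> (p X) = Id Ho X \<odot> \<gamma> (p X)" using g(2) s by simp
  then have "e \<odot> \<gamma> m = Id Ho X"
    by (rule Ho.iso_cancel_right [OF \<gamma>_weq_iso [OF pX(4)], rotated -1]) (use s in auto)
  then have "is_iso Ho (\<gamma> m)" using s me by (rule_tac Ho.is_isoI [of _ e]) auto
  then show "m \<in> W" using saturated m' by simp
qed

text \<open>On both sides the homotopy classes are the fibres of \<gamma>, by cofibrancy of the
  sources and fibrancy of the targets.\<close>

theorem bij_on_homotopy_classes_iff: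
  assumes AB: "cofib A" "fib B" and AB': "cofib A'" "fib B'"
    and F: "\<And>f. f \<in> hom \<C> A B \<Longrightarrow> F f \<in> hom \<C> A' B'"
  shows "bij_on_homotopy_classes \<C> W Cof Fib A B A' B' F \<longleftrightarrow> \<gamma>_bij A B A' B' F"
proof -
  note E = equiv_htp [OF AB] and E' = equiv_htp [OF AB']
  have cls: "htp A B `` {f} = htp A B `` {g} \<longleftrightarrow> \<gamma> f = \<gamma> g" if "f \<in> hom \<C> A B" "g \<in> hom \<C> A B" for f g
    using eq_equiv_class_iff [OF E that] \<gamma>_eq_iff_htp [OF AB that] by simp
  have cls': "htp A' B' `` {f} = htp A' B' `` {g} \<longleftrightarrow> \<gamma> f = \<gamma> g"
    if "f \<in> hom \<C> A' B'" "g \<in> hom \<C> A' B'" for f g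
    using eq_equiv_class_iff [OF E' that] \<gamma>_eq_iff_htp [OF AB' that] by simp
  have quo: "hom \<C> A B // htp A B = (\<lambda>f. htp A B `` {f}) ` hom \<C> A B"
    "hom \<C> A' B' // htp A' B' = (\<lambda>f. htp A' B' `` {f}) ` hom \<C> A' B'"
    by (auto simp: quotient_def)
  show ?thesis
  proof
    assume "bij_on_homotopy_classes \<C> W Cof Fib A B A' B' F"
    then obtain F' where F': "bij_betw F' (hom \<C> A B // htp A B) (hom \<C> A' B' // htp A' B')"
      "\<And>f. f \<in> hom \<C> A B \<Longrightarrow> F' (htp A B `` {f}) = htp A' B' `` {F f}"
      unfolding bij_on_homotopy_classes_def Let_def by blast
    show "\<gamma>_bij A B A' B' F" unfolding \<gamma>_bij_def
    proof (intro conjI ballI)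
      fix f g assume fg: "f \<in> hom \<C> A B" "g \<in> hom \<C> A B"
      have "\<gamma> (F f) = \<gamma> (F g) \<longleftrightarrow> F' (htp A B `` {f}) = F' (htp A B `` {g})"
        using cls' F F'(2) fg by simp
      also have "\<dots> \<longleftrightarrow> \<gamma> f = \<gamma> g"
        using inj_on_eq_iff [OF bij_betw_imp_inj_on [OF F'(1)]] fg cls quo by simp
      finally show "\<gamma> (F f) = \<gamma> (F g) \<longleftrightarrow> \<gamma> f = \<gamma> g" .
    next
      fix k assume k: "k \<in> hom \<C> A' B'"
      then have "htp A' B' `` {k} \<in> F' ` (hom \<C> A B // htp A B)"
        using F'(1) by (auto simp: bij_betw_def quo)
      then obtain f where f: "f \<in> hom \<C> A B" "htp A' B' `` {k} = F' (htp A B `` {f})" by (auto simp: quo)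
      then have "htp A' B' `` {k} = htp A' B' `` {F f}" using F'(2) by simp
      then have "\<gamma> (F f) = \<gamma> k" using cls' [OF k F [OF f(1)]] by simp
      then show "\<exists>f\<in>hom \<C> A B. \<gamma> (F f) = \<gamma> k" using f(1) by blast
    qed
  next
    assume *: "\<gamma>_bij A B A' B' F"
    \<comment> \<open>The induced function applies \<open>F\<close> to an arbitrary representative;
      \<open>\<gamma>_bij\<close> makes the class of the result independent of the choice.\<close>
    define F' where "F' c = htp A' B' `` {F (SOME f. f \<in> hom \<C> A B \<and> htp A B `` {f} = c)}" for c
    have F': "F' (htp A B `` {f}) = htp A' B' `` {F f}" if f: "f \<in> hom \<C> A B" for f
    proof -
      define g where "g = (SOME g. g \<in> hom \<C> A B \<and> htp A B `` {g} = htp A B `` {f})"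
      have "g \<in> hom \<C> A B \<and> htp A B `` {g} = htp A B `` {f}"
        unfolding g_def by (rule someI [of _ f]) (use f in simp)
      then have g: "g \<in> hom \<C> A B" "\<gamma> g = \<gamma> f" using cls f by auto
      then have "\<gamma> (F g) = \<gamma> (F f)" using * f by (auto simp: \<gamma>_bij_def)
      then show ?thesis unfolding F'_def g_def [symmetric] using cls' F g f by blast
    qed
    have "bij_betw F' (hom \<C> A B // htp A B) (hom \<C> A' B' // htp A' B')"
      unfolding bij_betw_def quo
    proof
      have "htp A B `` {f} = htp A B `` {g}"
        if fg: "f \<in> hom \<C> A B" "g \<in> hom \<C> A B" and eq: "F' (htp A B `` {f}) = F' (htp A B `` {g})" for f g
      proof -
        have "\<gamma> (F f) = \<gamma> (F g)" using eq cls' [OF F F] fg unfolding F' [OF fg(1)] F' [OF fg(2)] by simp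
        then show ?thesis using * fg cls [OF fg] by (simp add: \<gamma>_bij_def)
      qed
      then show "inj_on F' ((\<lambda>f. htp A B `` {f}) ` hom \<C> A B)" by (rule_tac inj_onI) blast
      have "htp A' B' `` {k} \<in> F' ` (\<lambda>f. htp A B `` {f}) ` hom \<C> A B" if k: "k \<in> hom \<C> A' B'" for k
      proof -
        obtain f where f: "f \<in> hom \<C> A B" "\<gamma> (F f) = \<gamma> k" using * k by (auto simp: \<gamma>_bij_def)
        then have "htp A' B' `` {k} = F' (htp A B `` {f})"
          using F' [OF f(1)] cls' [OF k F [OF f(1)]] by simp
        then show ?thesis using f(1) by blast
      qed
      then show "F' ` (\<lambda>f. htp A B `` {f}) ` hom \<C> A B = (\<lambda>f. htp A' B' `` {f}) ` hom \<C> A' B'"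
        using F' F by (auto simp: image_image)
    qed
    then show "bij_on_homotopy_classes \<C> W Cof Fib A B A' B' F"
      unfolding bij_on_homotopy_classes_def Let_def using F F' by blast
  qed
qed

end

section \<open>Monoidal skew closed model categories\<close>

locale monoidal_skew_closed_model =
  model_category \<C> W Cof Fib \<Phi> \<Psi> + monoidal_skew_closed \<C> T H I \<alpha> l r L i j \<phi>
  for \<C> :: "('o, 'a) cat" (structure)
    and W Cof Fib :: "'a set" and \<Phi> \<Psi> :: "('o, 'a) ffact"
    and T H :: "('o \<times> 'o, 'a \<times> 'a, 'o, 'a) func"
    and I :: "'o"
    and \<alpha> :: "'o \<Rightarrow> 'o \<Rightarrow> 'o \<Rightarrow> 'a" and l r :: "'o \<Rightarrow> 'a"
    and L :: "'o \<Rightarrow> 'o \<Rightarrow> 'o \<Rightarrow> 'a" and i j :: "'o \<Rightarrow> 'a"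
    and \<phi> :: "'o \<Rightarrow> 'o \<Rightarrow> 'o \<Rightarrow> 'a \<Rightarrow> 'a" +
  assumes MC: "axiom_MC \<C> W Cof T I"
begin

lemmas tensor_simps [simp] = bifunctorD [OF tensor_functor]
lemmas ihom_simps [simp] = bifunctorD [OF hom_functor, unfolded op_cat_simps]

lemma tensor_hom: "f \<in> hom \<C> A A' \<Longrightarrow> g \<in> hom \<C> B B' \<Longrightarrow> f \<otimes>\<^sub>a g \<in> hom \<C> (A \<otimes> B) (A' \<otimes> B')"
  by (simp add: hom_iff)

lemma ihom_hom: "f \<in> hom \<C> A' A \<Longrightarrow> g \<in> hom \<C> B B' \<Longrightarrow> \<lbrace>f, g\<rbrace>\<^sub>a \<in> hom \<C> \<lbrace>A, B\<rbrace> \<lbrace>A', B'\<rbrace>"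
  by (simp add: hom_iff)

lemma \<phi>_hom: "A \<in> Obj \<C> \<Longrightarrow> B \<in> Obj \<C> \<Longrightarrow> f \<in> hom \<C> (A \<otimes> B) D \<Longrightarrow> \<phi> A B D f \<in> hom \<C> A \<lbrace>B, D\<rbrace>"
  using \<phi>_bij [of A B D] hom_Obj bij_betwE by blast

lemma \<phi>_inj:
  assumes "A \<in> Obj \<C>" "B \<in> Obj \<C>" "f \<in> hom \<C> (A \<otimes> B) D" "g \<in> hom \<C> (A \<otimes> B) D" "\<phi> A B D f = \<phi> A B D g"
  shows "f = g"
  using \<phi>_bij [of A B D] assms hom_Obj(2) [OF assms(3)] by (auto simp: bij_betw_def dest: inj_onD)

lemma \<phi>_surj:
  assumes "A \<in> Obj \<C>" "B \<in> Obj \<C>" "D \<in> Obj \<C>" "k \<in> hom \<C> A \<lbrace>B, D\<rbrace>"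
  obtains f where "f \<in> hom \<C> (A \<otimes> B) D" "\<phi> A B D f = k"
proof -
  have "k \<in> \<phi> A B D ` hom \<C> (A \<otimes> B) D" using \<phi>_bij [OF assms(1-3)] assms(4) by (simp add: bij_betw_def)
  then show ?thesis using that by blast
qed

lemma \<phi>_post:
  assumes "A \<in> Obj \<C>" "B \<in> Obj \<C>" "f \<in> hom \<C> (A \<otimes> B) D" "d \<in> hom \<C> D D'"
  shows "\<phi> A B D' (d \<cdot> f) = \<lbrace>\<one> B, d\<rbrace>\<^sub>a \<cdot> \<phi> A B D f"
  using \<phi>_natural [OF Id_hom [OF assms(1)] Id_hom [OF assms(2)] assms(4,3)] assms \<phi>_hom [OF assms(1-3)]
  by (simp add: hom_iff)

lemma \<phi>_pre:
  assumes "a \<in> hom \<C> A' A" "B \<in> Obj \<C>" "f \<in> hom \<C> (A \<otimes> B) D"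
  shows "\<phi> A' B D (f \<cdot> (a \<otimes>\<^sub>a \<one> B)) = \<phi> A B D f \<cdot> a"
proof -
  note A = hom_Obj [OF assms(1)] and D = hom_Obj [OF assms(3)]
  note k = \<phi>_hom [OF A(2) assms(2,3)]
  have "f \<cdot> (a \<otimes>\<^sub>a \<one> B) = \<one> D \<cdot> f \<cdot> (a \<otimes>\<^sub>a \<one> B)" using assms(2,3) by (simp add: hom_iff)
  also have "\<phi> A' B D \<dots> = \<lbrace>\<one> B, \<one> D\<rbrace>\<^sub>a \<cdot> \<phi> A B D f \<cdot> a"
    by (rule \<phi>_natural [OF assms(1) Id_hom [OF assms(2)] Id_hom [OF D(2)] assms(3)])
  also have "\<dots> = \<phi> A B D f \<cdot> a" using k assms(1,2) D(2) by (simp add: hom_iff)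
  finally show ?thesis .
qed

text \<open>A square from \<open>m\<close> to \<open>\<lbrace>1, e\<rbrace>\<close> transposes to a
  square from \<open>m \<otimes> 1\<close> to \<open>e\<close>, and a lift there transposes back, by
  naturality of \<open>\<phi>\<close>.\<close>

lemma has_lifting_transpose:
  assumes m: "m \<in> hom \<C> K N" and X: "X \<in> Obj \<C>" and e: "e \<in> hom \<C> U V"
    and lift: "has_lifting \<C> (m \<otimes>\<^sub>a \<one> X) e"
  shows "has_lifting \<C> m \<lbrace>\<one> X, e\<rbrace>\<^sub>a"
  unfolding has_lifting_def
proof (intro allI ballI impI; elim conjE)
  fix K' N' U' V' u v
  assume h: "u \<in> hom \<C> K' U'" "v \<in> hom \<C> N' V'" "m \<in> hom \<C> K' N'" "\<lbrace>\<one> X, e\<rbrace>\<^sub>a \<in> hom \<C> U' V'"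
    and eq: "\<lbrace>\<one> X, e\<rbrace>\<^sub>a \<cdot> u = v \<cdot> m"
  note KN = hom_Obj [OF m] and UV = hom_Obj [OF e]
  have [simp]: "K' = K" "N' = N" "U' = \<lbrace>X, U\<rbrace>" "V' = \<lbrace>X, V\<rbrace>"
    using h m ihom_hom [OF Id_hom [OF X] e] by (auto simp: hom_iff)
  obtain u' where u': "u' \<in> hom \<C> (K \<otimes> X) U" "\<phi> K X U u' = u" using \<phi>_surj [OF KN(1) X UV(1)] h by auto
  obtain v' where v': "v' \<in> hom \<C> (N \<otimes> X) V" "\<phi> N X V v' = v" using \<phi>_surj [OF KN(2) X UV(2)] h by auto
  note mX = tensor_hom [OF m Id_hom [OF X]]
  have "e \<cdot> u' = v' \<cdot> (m \<otimes>\<^sub>a \<one> X)"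
  proof (rule \<phi>_inj [OF KN(1) X])
    show "\<phi> K X V (e \<cdot> u') = \<phi> K X V (v' \<cdot> (m \<otimes>\<^sub>a \<one> X))"
      using \<phi>_post [OF KN(1) X u'(1) e] \<phi>_pre [OF m X v'(1)] eq u' v' by simp
  qed (use Comp_hom u' v' e mX in blast)+
  then obtain d where d: "d \<in> hom \<C> (N \<otimes> X) U" "d \<cdot> (m \<otimes>\<^sub>a \<one> X) = u'" "e \<cdot> d = v'"
    using has_liftingD [OF lift mX e u'(1) v'(1)] by blast
  have "\<phi> N X U d \<cdot> m = u" using \<phi>_pre [OF m X d(1)] d(2) u' by simp
  moreover have "\<lbrace>\<one> X, e\<rbrace>\<^sub>a \<cdot> \<phi> N X U d = v" using \<phi>_post [OF KN(2) X d(1) e] d(3) v' by simp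
  ultimately show "\<exists>d\<in>hom \<C> N' U'. d \<cdot> m = u \<and> \<lbrace>\<one> X, e\<rbrace>\<^sub>a \<cdot> d = v"
    using \<phi>_hom [OF KN(2) X d(1)] by auto
qed

section \<open>Consequences of Axiom MC for the tensor and the internal hom\<close>

lemma I_cofibrant: "cofib I"
  using MC by (simp add: axiom_MC_def)

lemma tensor_Cof:
  assumes "cofib X"
  shows "f \<in> Cof \<Longrightarrow> f \<otimes>\<^sub>a \<one> X \<in> Cof" "f \<in> Cof \<Longrightarrow> f \<in> W \<Longrightarrow> f \<otimes>\<^sub>a \<one> X \<in> W"
  using MC assms by (auto simp: axiom_MC_def left_quillen_def)

lemma tensor_right_weq:
  assumes "cofib Y" "cofib A" "cofib B" "w \<in> hom \<C> A B" "w \<in> W"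
  shows "\<one> Y \<otimes>\<^sub>a w \<in> W"
  using MC assms by (auto simp: axiom_MC_def)

text \<open>Axiom MC is stated for the left adjoint. Its right adjoint preserves trivial fibrations
  because these are exactly the maps with the lifting property against all cofibrations.\<close>

lemma ihom_trivial_Fib:
  assumes X: "cofib X" and e: "e \<in> Fib" "e \<in> W"
  shows "\<lbrace>\<one> X, e\<rbrace>\<^sub>a \<in> Fib" "\<lbrace>\<one> X, e\<rbrace>\<^sub>a \<in> W"
proof -
  have X': "X \<in> Obj \<C>" using cofibrant_Obj X .
  have e': "e \<in> hom \<C> (Dom \<C> e) (Cod \<C> e)" using e classes by (auto simp: hom_iff)
  have "has_lifting \<C> m \<lbrace>\<one> X, e\<rbrace>\<^sub>a" if "m \<in> Cof" for m
    using that tensor_Cof [OF X, of m] classes lift_cof_trivfib [of "m \<otimes>\<^sub>a \<one> X" e] e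
    by (intro has_lifting_transpose [OF _ X' e']) (auto simp: hom_iff)
  then have "\<lbrace>\<one> X, e\<rbrace>\<^sub>a \<in> Fib \<inter> W" unfolding trivial_Fib_iff using X' e' by (auto simp: hom_iff)
  then show "\<lbrace>\<one> X, e\<rbrace>\<^sub>a \<in> Fib" "\<lbrace>\<one> X, e\<rbrace>\<^sub>a \<in> W" by auto
qed

lemma ihom_fibrant:
  assumes X: "cofib X" and B: "fib B"
  shows "fib \<lbrace>X, B\<rbrace>"
  unfolding fibrant_iff
proof (intro conjI allI ballI)
  note X' = cofibrant_Obj [OF X] and B' = fibrant_Obj [OF B]
  show "\<lbrace>X, B\<rbrace> \<in> Obj \<C>" using X' B' by simp
  fix K N m v assume m: "m \<in> hom \<C> K N \<inter> Cof \<inter> W" and v: "v \<in> hom \<C> K \<lbrace>X, B\<rbrace>"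
  then have m': "m \<in> hom \<C> K N" by simp
  note KN = hom_Obj [OF m']
  obtain v' where v': "v' \<in> hom \<C> (K \<otimes> X) B" "\<phi> K X B v' = v" using \<phi>_surj [OF KN(1) X' B' v] .
  obtain d where d: "d \<in> hom \<C> (N \<otimes> X) B" "d \<cdot> (m \<otimes>\<^sub>a \<one> X) = v'"
    using fibrant_lift [OF B tensor_hom [OF m' Id_hom [OF X']] _ _ v'(1)] tensor_Cof [OF X] m by auto
  have "\<phi> N X B d \<cdot> m = v" using \<phi>_pre [OF m' X' d(1)] d(2) v'(2) by simp
  then show "\<exists>d\<in>hom \<C> N \<lbrace>X, B\<rbrace>. d \<cdot> m = v" using \<phi>_hom [OF KN(2) X' d(1)] by blast
qed

text \<open>Lifting a map out of \<open>A \<otimes> X\<close> through a trivial fibration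
  \<open>e\<close> is the same as lifting its transpose out of \<open>A\<close> through
  \<open>\<lbrace>1, e\<rbrace>\<close>, which is again a trivial fibration.\<close>

lemma tensor_cofibrant:
  assumes A: "cofib A" and X: "cofib X"
  shows "cofib (A \<otimes> X)"
  unfolding cofibrant_iff
proof (intro conjI allI ballI)
  note A' = cofibrant_Obj [OF A] and X' = cofibrant_Obj [OF X]
  show "A \<otimes> X \<in> Obj \<C>" using A' X' by simp
  fix U V e v assume e: "e \<in> hom \<C> U V \<inter> Fib \<inter> W" and v: "v \<in> hom \<C> (A \<otimes> X) V"
  then have e': "e \<in> hom \<C> U V" by simp
  note UV = hom_Obj [OF e']
  obtain d where d: "d \<in> hom \<C> A \<lbrace>X, U\<rbrace>" "\<lbrace>\<one> X, e\<rbrace>\<^sub>a \<cdot> d = \<phi> A X V v"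
    using cofibrant_lift [OF A ihom_hom [OF Id_hom [OF X'] e'] _ _ \<phi>_hom [OF A' X' v]]
      ihom_trivial_Fib [OF X] e by auto
  obtain d' where d': "d' \<in> hom \<C> (A \<otimes> X) U" "\<phi> A X U d' = d" using \<phi>_surj [OF A' X' UV(1) d(1)] .
  have "e \<cdot> d' = v"
    using \<phi>_post [OF A' X' d'(1) e'] d(2) d'(2) by (intro \<phi>_inj [OF A' X' Comp_hom [OF d'(1) e'] v]) simp
  then show "\<exists>d\<in>hom \<C> (A \<otimes> X) U. e \<cdot> d = v" using d'(1) by blast
qed

text \<open>Ken Brown's argument: factor \<open>[w, 1] : A + B \<rightarrow> B\<close>.\<close>

lemma tensor_left_weq:
  assumes A: "cofib A" and B: "cofib B" and X: "cofib X"
    and w: "w \<in> hom \<C> A B" "w \<in> W"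
  shows "w \<otimes>\<^sub>a \<one> X \<in> W"
proof -
  note A' = cofibrant_Obj [OF A] and B' = cofibrant_Obj [OF B] and X' = cofibrant_Obj [OF X]
  obtain Y m n where Y: "is_coproduct \<C> A B Y m n" using has_coproduct [OF finite_colimits A' B'] .
  have mn: "m \<in> hom \<C> A Y" "n \<in> hom \<C> B Y" using Y by (auto simp: is_coproduct_def)
  have mnC: "m \<in> Cof" "n \<in> Cof"
    using cofibrant_coproduct_injection [OF Y B] cofibrant_coproduct_injection [OF is_coproduct_swap [OF Y] A] .
  obtain h where h: "h \<in> hom \<C> Y B" "h \<cdot> m = w" "h \<cdot> n = \<one> B"
    using coproduct_copair [OF Y w(1) Id_hom [OF B']] .
  obtain K c e where ce: "c \<in> hom \<C> Y K" "c \<in> Cof" "e \<in> hom \<C> K B" "e \<in> Fib \<inter> W" "e \<cdot> c = h"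
    using fact_obtains [OF fact_cof_trivfib h(1)] by metis
  note cm = Comp_hom [OF mn(1) ce(1)] and cn = Comp_hom [OF mn(2) ce(1)]
  have e: "e \<cdot> (c \<cdot> m) = w" "e \<cdot> (c \<cdot> n) = \<one> B"
    using Comp_assoc [OF mn(1) ce(1,3)] Comp_assoc [OF mn(2) ce(1,3)] h ce(5) by auto
  have cmW: "c \<cdot> m \<in> W" "c \<cdot> m \<in> Cof"
    using W_cancel_left [OF cm ce(3)] e(1) w(2) ce(4) Cof_Comp [OF mn(1) ce(1)] mnC ce(2) by auto
  have cnW: "c \<cdot> n \<in> W" "c \<cdot> n \<in> Cof"
    using W_cancel_left [OF cn ce(3)] e(2) Id_classes(1) [OF B'] ce(4) Cof_Comp [OF mn(2) ce(1)] mnC ce(2) by auto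
  note t = tensor_hom [OF _ Id_hom [OF X']]
  have s: "e \<in> Arr \<C>" "Dom \<C> e = K" "Cod \<C> e = B" "c \<cdot> m \<in> Arr \<C>" "Dom \<C> (c \<cdot> m) = A" "Cod \<C> (c \<cdot> m) = K"
    "c \<cdot> n \<in> Arr \<C>" "Dom \<C> (c \<cdot> n) = B" "Cod \<C> (c \<cdot> n) = K"
    using homD [OF ce(3)] homD [OF cm] homD [OF cn] by auto
  \<comment> \<open>The trivial cofibration \<open>c \<cdot> n\<close> is a section of
    \<open>e\<close>. Tensoring preserves trivial cofibrations, so two-out-of-three handles
    \<open>e \<otimes> 1\<close>, although nothing is assumed about tensoring fibrations.\<close>
  have "(e \<otimes>\<^sub>a \<one> X) \<cdot> ((c \<cdot> n) \<otimes>\<^sub>a \<one> X) = \<one> (B \<otimes> X)" using s e X' B' by simp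
  then have "e \<otimes>\<^sub>a \<one> X \<in> W"
    using W_cancel_right [OF t [OF cn] t [OF ce(3)]] tensor_Cof [OF X] cnW Id_classes(1) [of "B \<otimes> X"] B' X' by auto
  moreover have "(e \<otimes>\<^sub>a \<one> X) \<cdot> ((c \<cdot> m) \<otimes>\<^sub>a \<one> X) = w \<otimes>\<^sub>a \<one> X" using s e X' by simp
  ultimately show ?thesis
    using W_Comp [OF t [OF cm] t [OF ce(3)]] tensor_Cof [OF X] cmW by auto
qed

lemma tensor_weq:
  assumes "cofib A" "cofib A'" "cofib B" "cofib B'"
    and f: "f \<in> hom \<C> A A'" "f \<in> W" and g: "g \<in> hom \<C> B B'" "g \<in> W"
  shows "f \<otimes>\<^sub>a g \<in> W"
proof -
  note o = cofibrant_Obj [OF assms(2)] cofibrant_Obj [OF assms(3)]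
  have "f \<otimes>\<^sub>a g = (\<one> A' \<otimes>\<^sub>a g) \<cdot> (f \<otimes>\<^sub>a \<one> B)" using f g o by (simp add: hom_iff)
  then show ?thesis
    using W_Comp [OF tensor_hom [OF f(1) Id_hom [OF o(2)]] tensor_hom [OF Id_hom [OF o(1)] g(1)]]
      tensor_left_weq [OF assms(1-3) f] tensor_right_weq [OF assms(2-4) g] by simp
qed

text \<open>The tensored projection \<open>s\<close> is still a weak equivalence, since
  \<open>K\<close> and \<open>A\<close> are cofibrant, and the tensored ends are both sections of
  it. This also covers \<open>X \<otimes> -\<close>, for which Axiom MC gives only preservation of
  weak equivalences.\<close>

lemma cylinder_tensor:
  assumes A: "cofib A" and X: "cofib X" and cyl: "cylinder \<C> W Cof A K a b s"
  shows "\<gamma> (a \<otimes>\<^sub>a \<one> X) = \<gamma> (b \<otimes>\<^sub>a \<one> X)" "\<gamma> (\<one> X \<otimes>\<^sub>a a) = \<gamma> (\<one> X \<otimes>\<^sub>a b)"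
proof -
  note c = cylinder_hom [OF cyl] and K = cylinder_cofibrant [OF A cyl] and 1 = Id_hom [OF cofibrant_Obj [OF X]]
  show "\<gamma> (a \<otimes>\<^sub>a \<one> X) = \<gamma> (b \<otimes>\<^sub>a \<one> X)"
    using c 1 by (intro weq_left_cancel_\<gamma> [OF tensor_hom [OF c(1) 1] tensor_hom [OF c(2) 1] tensor_hom [OF c(3) 1]
        tensor_left_weq [OF K A X c(3,4)]]) (simp add: hom_iff)
  show "\<gamma> (\<one> X \<otimes>\<^sub>a a) = \<gamma> (\<one> X \<otimes>\<^sub>a b)"
    using c 1 by (intro weq_left_cancel_\<gamma> [OF tensor_hom [OF 1 c(1)] tensor_hom [OF 1 c(2)] tensor_hom [OF 1 c(3)]
        tensor_right_weq [OF X K A c(3,4)]]) (simp add: hom_iff)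
qed

text \<open>Fibrancy of \<open>B\<close> turns equality under \<gamma> into a left homotopy, and its
  cylinder is then tensored.\<close>

lemma \<gamma>_tensor_Id:
  assumes A: "cofib A" and X: "cofib X" and B: "fib B"
    and fg: "f \<in> hom \<C> A B" "g \<in> hom \<C> A B" "\<gamma> f = \<gamma> g"
  shows "\<gamma> (f \<otimes>\<^sub>a \<one> X) = \<gamma> (g \<otimes>\<^sub>a \<one> X)" "\<gamma> (\<one> X \<otimes>\<^sub>a f) = \<gamma> (\<one> X \<otimes>\<^sub>a g)"
proof -
  have "left_htp f g" using \<gamma>_eq_iff_htp [OF A B fg(1,2)] fg(3) htp_left [OF A] by blast
  then obtain K a b s h where h: "cylinder \<C> W Cof A K a b s" "h \<in> hom \<C> K B" "h \<cdot> a = f" "h \<cdot> b = g"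
    using left_homotopicE fg(1) by blast
  note c = cylinder_hom [OF h(1)] and 1 = Id_hom [OF cofibrant_Obj [OF X]]
  have "\<gamma> (f \<otimes>\<^sub>a \<one> X) = \<gamma> (h \<otimes>\<^sub>a \<one> X) \<odot> \<gamma> (a \<otimes>\<^sub>a \<one> X)" "\<gamma> (g \<otimes>\<^sub>a \<one> X) = \<gamma> (h \<otimes>\<^sub>a \<one> X) \<odot> \<gamma> (b \<otimes>\<^sub>a \<one> X)"
    "\<gamma> (\<one> X \<otimes>\<^sub>a f) = \<gamma> (\<one> X \<otimes>\<^sub>a h) \<odot> \<gamma> (\<one> X \<otimes>\<^sub>a a)" "\<gamma> (\<one> X \<otimes>\<^sub>a g) = \<gamma> (\<one> X \<otimes>\<^sub>a h) \<odot> \<gamma> (\<one> X \<otimes>\<^sub>a b)"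
    using h(2-4) c(1,2) 1 by (auto simp: hom_iff simp flip: \<gamma>_Comp)
  then show "\<gamma> (f \<otimes>\<^sub>a \<one> X) = \<gamma> (g \<otimes>\<^sub>a \<one> X)" "\<gamma> (\<one> X \<otimes>\<^sub>a f) = \<gamma> (\<one> X \<otimes>\<^sub>a g)"
    using cylinder_tensor [OF A X h(1)] by simp_all
qed

text \<open>A left homotopy between the transposes comes from a map out of
  \<open>K \<otimes> B\<close>, where the tensored ends agree under \<gamma>. Conversely a right
  homotopy between \<open>f\<close> and \<open>g\<close> transposes to a map into
  \<open>\<lbrace>B, P\<rbrace>\<close>, where the two evaluations agree under \<gamma>. Each
  direction uses the kind of homotopy that \<open>\<phi>\<close> can transport.\<close>

theorem \<gamma>_\<phi>:
  assumes A: "cofib A" and B: "cofib B" and D: "fib D"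
    and fg: "f \<in> hom \<C> (A \<otimes> B) D" "g \<in> hom \<C> (A \<otimes> B) D"
  shows "\<gamma> (\<phi> A B D f) = \<gamma> (\<phi> A B D g) \<longleftrightarrow> \<gamma> f = \<gamma> g"
proof
  note A' = cofibrant_Obj [OF A] and B' = cofibrant_Obj [OF B] and D' = fibrant_Obj [OF D]
  note BD = ihom_fibrant [OF B D] and AB = tensor_cofibrant [OF A B]
  note \<phi>fg = \<phi>_hom [OF A' B' fg(1)] \<phi>_hom [OF A' B' fg(2)] and 1 = Id_hom [OF B']
  {
    assume "\<gamma> (\<phi> A B D f) = \<gamma> (\<phi> A B D g)"
    then have "left_htp (\<phi> A B D f) (\<phi> A B D g)"
      using \<gamma>_eq_iff_htp [OF A BD \<phi>fg] htp_left [OF A] by blast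
    then obtain K a b s h where h: "cylinder \<C> W Cof A K a b s" "h \<in> hom \<C> K \<lbrace>B, D\<rbrace>"
      "h \<cdot> a = \<phi> A B D f" "h \<cdot> b = \<phi> A B D g"
      using left_homotopicE \<phi>fg(1) by blast
    note c = cylinder_hom [OF h(1)]
    obtain h' where h': "h' \<in> hom \<C> (K \<otimes> B) D" "\<phi> K B D h' = h"
      using \<phi>_surj [OF hom_Obj(2) [OF c(1)] B' D' h(2)] .
    note ab = tensor_hom [OF c(1) 1] tensor_hom [OF c(2) 1]
    have "f = h' \<cdot> (a \<otimes>\<^sub>a \<one> B)"
      using \<phi>_pre [OF c(1) B' h'(1)] h h'(2) by (intro \<phi>_inj [OF A' B' fg(1) Comp_hom [OF ab(1) h'(1)]]) simp
    moreover have "g = h' \<cdot> (b \<otimes>\<^sub>a \<one> B)"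
      using \<phi>_pre [OF c(2) B' h'(1)] h h'(2) by (intro \<phi>_inj [OF A' B' fg(2) Comp_hom [OF ab(2) h'(1)]]) simp
    ultimately show "\<gamma> f = \<gamma> g"
      using cylinder_tensor(1) [OF A B h(1)] homD [OF h'(1)] homD [OF ab(1)] homD [OF ab(2)] by (simp add: \<gamma>_Comp)
  next
    assume "\<gamma> f = \<gamma> g"
    then have "right_htp f g"
      using \<gamma>_eq_iff_htp [OF AB D fg] htp_right [OF AB D] by blast
    then obtain P x y s k where k: "cylinder (op_cat \<C>) W Fib D P x y s" "k \<in> hom \<C> (A \<otimes> B) P" "x \<cdot> k = f" "y \<cdot> k = g"
      using right_homotopicE fg(1) by blast
    note c = path_hom [OF k(1)] and xy = path_Fib [OF D k(1)]
    note x = ihom_hom [OF 1 c(1)] and y = ihom_hom [OF 1 c(2)] and s = ihom_hom [OF 1 c(3)]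
    have eq: "\<lbrace>\<one> B, x\<rbrace>\<^sub>a \<cdot> \<lbrace>\<one> B, s\<rbrace>\<^sub>a = \<one> \<lbrace>B, D\<rbrace>" "\<lbrace>\<one> B, y\<rbrace>\<^sub>a \<cdot> \<lbrace>\<one> B, s\<rbrace>\<^sub>a = \<one> \<lbrace>B, D\<rbrace>"
      using c B' D' by (simp_all add: hom_iff)
    have "\<lbrace>\<one> B, s\<rbrace>\<^sub>a \<in> W"
      using W_cancel_left [OF s x] ihom_trivial_Fib [OF B xy(1,2)] eq(1) Id_classes(1) [OF fibrant_Obj [OF BD]] by simp
    then have "\<gamma> \<lbrace>\<one> B, x\<rbrace>\<^sub>a = \<gamma> \<lbrace>\<one> B, y\<rbrace>\<^sub>a"
      using weq_right_cancel_\<gamma> [OF x y s] eq by simp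
    then have "\<gamma> (\<lbrace>\<one> B, x\<rbrace>\<^sub>a \<cdot> \<phi> A B P k) = \<gamma> (\<lbrace>\<one> B, y\<rbrace>\<^sub>a \<cdot> \<phi> A B P k)"
      using homD [OF x] homD [OF y] homD [OF \<phi>_hom [OF A' B' k(2)]] by (simp add: \<gamma>_Comp)
    then show "\<gamma> (\<phi> A B D f) = \<gamma> (\<phi> A B D g)"
      using \<phi>_post [OF A' B' k(2) c(1)] \<phi>_post [OF A' B' k(2) c(2)] k(3,4) by simp
  }
qed

section \<open>The three conditions as statements about \<open>l\<close>, \<open>r\<close> and
  \<alpha>\<close>

lemma \<phi>_\<gamma>_bij:
  assumes A: "cofib A" and B: "cofib B" and D: "fib D"
  shows "\<gamma>_bij (A \<otimes> B) D A \<lbrace>B, D\<rbrace> (\<phi> A B D)"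
  unfolding \<gamma>_bij_def
  using \<gamma>_\<phi> [OF assms] \<phi>_surj [OF cofibrant_Obj [OF A] cofibrant_Obj [OF B] fibrant_Obj [OF D]] by metis

text \<open>For fixed \<open>A\<close>, the function \<open>v\<close> into each fibrant
  \<open>B\<close> is precomposition with \<open>l A\<close> followed by \<open>\<phi>\<close>. As
  \<open>\<phi>\<close> is bijective up to \<gamma>, the test on all \<open>B\<close> is the one
  that detects whether \<open>l A\<close> is a weak equivalence.\<close>

theorem v_bij_iff:
  assumes A: "cofib A"
  shows "(\<forall>B. fib B \<longrightarrow> bij_on_homotopy_classes \<C> W Cof Fib A B I \<lbrace>A, B\<rbrace> (v_map \<C> H j A)) \<longleftrightarrow> l A \<in> W"
proof -
  note A' = cofibrant_Obj [OF A] and I' = cofibrant_Obj [OF I_cofibrant]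
  note l = l_hom [OF A']
  have "bij_on_homotopy_classes \<C> W Cof Fib A B I \<lbrace>A, B\<rbrace> (v_map \<C> H j A) \<longleftrightarrow> \<gamma>_bij A B (I \<otimes> A) B (\<lambda>f. f \<cdot> l A)"
    if B: "fib B" for B
  proof -
    note B' = fibrant_Obj [OF B]
    have v: "v_map \<C> H j A f = \<phi> I A B (f \<cdot> l A)" if "f \<in> hom \<C> A B" for f
      using \<phi>_l [OF that] by simp
    have "bij_on_homotopy_classes \<C> W Cof Fib A B I \<lbrace>A, B\<rbrace> (v_map \<C> H j A) \<longleftrightarrow>
        \<gamma>_bij A B I \<lbrace>A, B\<rbrace> (v_map \<C> H j A)"
      by (rule bij_on_homotopy_classes_iff [OF A B I_cofibrant ihom_fibrant [OF A B]])
        (simp only: v \<phi>_hom [OF I' A' Comp_hom [OF l]])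
    also have "\<dots> \<longleftrightarrow> \<gamma>_bij A B I \<lbrace>A, B\<rbrace> (\<lambda>f. \<phi> I A B (f \<cdot> l A))"
      by (rule \<gamma>_bij_cong) (rule v)
    also have "\<dots> \<longleftrightarrow> \<gamma>_bij A B (I \<otimes> A) B (\<lambda>f. f \<cdot> l A)"
      by (rule \<gamma>_bij_comp_left [OF \<phi>_\<gamma>_bij [OF I_cofibrant A B] Comp_hom [OF l] \<phi>_hom [OF I' A']])
    finally show ?thesis .
  qed
  then show ?thesis using weq_iff_precomp_bij [OF tensor_cofibrant [OF I_cofibrant A] A l] by blast
qed

text \<open>The two sides are not matched object by object: \<open>r A\<close> is tested on all
  fibrant \<open>B\<close>, and \<open>i B\<close> on all cofibrant \<open>A\<close>. Both amount to
  the same family of bijections indexed by the pairs, with the quantifiers in either order.\<close>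

theorem i_weq_iff:
  "(\<forall>B. fib B \<longrightarrow> i B \<in> W) \<longleftrightarrow> (\<forall>A. cofib A \<longrightarrow> r A \<in> W)"
proof -
  have "\<gamma>_bij (A \<otimes> I) B A B (\<lambda>g. g \<cdot> r A) \<longleftrightarrow> \<gamma>_bij A \<lbrace>I, B\<rbrace> A B (\<lambda>g. i B \<cdot> g)"
    if A: "cofib A" and B: "fib B" for A B
  proof -
    note A' = cofibrant_Obj [OF A] and I' = cofibrant_Obj [OF I_cofibrant] and B' = fibrant_Obj [OF B]
    have "\<gamma>_bij (A \<otimes> I) B A B (\<lambda>g. g \<cdot> r A) \<longleftrightarrow> \<gamma>_bij (A \<otimes> I) B A B (\<lambda>g. i B \<cdot> \<phi> A I B g)"
      by (rule \<gamma>_bij_cong) (rule \<phi>_r [OF A'])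
    also have "\<dots> \<longleftrightarrow> \<gamma>_bij A \<lbrace>I, B\<rbrace> A B (\<lambda>g. i B \<cdot> g)"
      by (rule \<gamma>_bij_comp_right [OF \<phi>_\<gamma>_bij [OF A I_cofibrant B] \<phi>_bij [OF A' I' B']])
    finally show ?thesis .
  qed
  then show ?thesis
    using weq_iff_precomp_bij [OF _ tensor_cofibrant [OF _ I_cofibrant] r_hom] cofibrant_Obj
      weq_iff_postcomp_bij [OF ihom_fibrant [OF I_cofibrant] _ i_hom] fibrant_Obj by blast
qed

lemma t_hom:
  assumes "A \<in> Obj \<C>" "B \<in> Obj \<C>" "D \<in> Obj \<C>"
  shows "t_map \<C> T H L \<phi> A B D \<in> hom \<C> \<lbrace>A \<otimes> B, D\<rbrace> \<lbrace>A, \<lbrace>B, D\<rbrace>\<rbrace>"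
proof -
  have "u_map \<C> T \<phi> A B \<in> hom \<C> A \<lbrace>B, A \<otimes> B\<rbrace>"
    unfolding u_map_def using assms by (intro \<phi>_hom Id_hom) auto
  then show ?thesis unfolding t_map_def
    using L_hom [of B "A \<otimes> B" D] assms by (auto simp: hom_iff)
qed

text \<open>With \<open>B\<close> and \<open>D\<close> fixed, the quantifiers over \<open>A\<close>
  and \<open>E\<close> are exchanged in the same manner. Two uses of \<open>\<phi>\<close> are
  stripped on the side of \<open>\<alpha>\<close> and one on the side of \<open>t\<close>.\<close>

theorem t_weq_iff:
  assumes B: "cofib B" and D: "cofib D"
  shows "(\<forall>E. fib E \<longrightarrow> t_map \<C> T H L \<phi> B D E \<in> W) \<longleftrightarrow> (\<forall>A. cofib A \<longrightarrow> \<alpha> A B D \<in> W)"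
proof -
  note B' = cofibrant_Obj [OF B] and D' = cofibrant_Obj [OF D] and BD = tensor_cofibrant [OF B D]
  have "\<gamma>_bij (A \<otimes> (B \<otimes> D)) E ((A \<otimes> B) \<otimes> D) E (\<lambda>h. h \<cdot> \<alpha> A B D) \<longleftrightarrow>
      \<gamma>_bij A \<lbrace>B \<otimes> D, E\<rbrace> A \<lbrace>B, \<lbrace>D, E\<rbrace>\<rbrace> (\<lambda>k. t_map \<C> T H L \<phi> B D E \<cdot> k)"
    if A: "cofib A" and E: "fib E" for A E
  proof -
    note A' = cofibrant_Obj [OF A] and E' = fibrant_Obj [OF E] and AB = tensor_cofibrant [OF A B]
    note DE = ihom_fibrant [OF D E]
    note \<alpha> = \<alpha>_hom [OF A' B' D']
    note \<phi>1 = \<phi>_hom [OF cofibrant_Obj [OF AB] D'] and \<phi>2 = \<phi>_hom [OF A' B']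
    have "\<gamma>_bij (A \<otimes> (B \<otimes> D)) E ((A \<otimes> B) \<otimes> D) E (\<lambda>h. h \<cdot> \<alpha> A B D) \<longleftrightarrow>
        \<gamma>_bij (A \<otimes> (B \<otimes> D)) E (A \<otimes> B) \<lbrace>D, E\<rbrace> (\<lambda>h. \<phi> (A \<otimes> B) D E (h \<cdot> \<alpha> A B D))"
      by (rule \<gamma>_bij_comp_left [OF \<phi>_\<gamma>_bij [OF AB D E] Comp_hom [OF \<alpha>] \<phi>1, symmetric])
    also have "\<dots> \<longleftrightarrow> \<gamma>_bij (A \<otimes> (B \<otimes> D)) E A \<lbrace>B, \<lbrace>D, E\<rbrace>\<rbrace> (\<lambda>h. \<phi> A B \<lbrace>D, E\<rbrace> (\<phi> (A \<otimes> B) D E (h \<cdot> \<alpha> A B D)))"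
      by (rule \<gamma>_bij_comp_left [OF \<phi>_\<gamma>_bij [OF A B DE] \<phi>1 [OF Comp_hom [OF \<alpha>]] \<phi>2, symmetric])
    also have "\<dots> \<longleftrightarrow> \<gamma>_bij (A \<otimes> (B \<otimes> D)) E A \<lbrace>B, \<lbrace>D, E\<rbrace>\<rbrace> (\<lambda>h. t_map \<C> T H L \<phi> B D E \<cdot> \<phi> A (B \<otimes> D) E h)"
      by (rule \<gamma>_bij_cong) (rule \<phi>_\<alpha> [OF A' B' D'])
    also have "\<dots> \<longleftrightarrow> \<gamma>_bij A \<lbrace>B \<otimes> D, E\<rbrace> A \<lbrace>B, \<lbrace>D, E\<rbrace>\<rbrace> (\<lambda>k. t_map \<C> T H L \<phi> B D E \<cdot> k)"
      by (rule \<gamma>_bij_comp_right [OF \<phi>_\<gamma>_bij [OF A BD E] \<phi>_bij [OF A' cofibrant_Obj [OF BD] E']])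
    finally show ?thesis .
  qed
  moreover have "t_map \<C> T H L \<phi> B D E \<in> W \<longleftrightarrow> (\<forall>A. cofib A \<longrightarrow>
      \<gamma>_bij A \<lbrace>B \<otimes> D, E\<rbrace> A \<lbrace>B, \<lbrace>D, E\<rbrace>\<rbrace> (\<lambda>k. t_map \<C> T H L \<phi> B D E \<cdot> k))" if E: "fib E" for E
    by (rule weq_iff_postcomp_bij [OF ihom_fibrant [OF BD E] ihom_fibrant [OF B ihom_fibrant [OF D E]]
          t_hom [OF B' D' fibrant_Obj [OF E]]])
  moreover have "\<alpha> A B D \<in> W \<longleftrightarrow> (\<forall>E. fib E \<longrightarrow>
      \<gamma>_bij (A \<otimes> (B \<otimes> D)) E ((A \<otimes> B) \<otimes> D) E (\<lambda>h. h \<cdot> \<alpha> A B D))" if A: "cofib A" for A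
    by (rule weq_iff_precomp_bij [OF tensor_cofibrant [OF tensor_cofibrant [OF A B] D] tensor_cofibrant [OF A BD]
          \<alpha>_hom [OF cofibrant_Obj [OF A] B' D']])
  ultimately show ?thesis by blast
qed

end

section \<open>The derived tensor product\<close>

context model_category
begin

lemma Ho_Dom_Cod_Obj [simp]:
  assumes "x \<in> Arr Ho"
  shows "Dom Ho x \<in> Obj \<C>" "Cod Ho x \<in> Obj \<C>"
  using Ho.Dom_Obj [OF assms] Ho.Cod_Obj [OF assms] by simp_all

lemma Qo_Obj [simp]: "A \<in> Obj \<C> \<Longrightarrow> Qo A \<in> Obj \<C>"
  and Ro_Obj [simp]: "A \<in> Obj \<C> \<Longrightarrow> Ro A \<in> Obj \<C>"
  using Q_object(1) cofibrant_Obj R_object(1) fibrant_Obj by blast+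

lemma p_simps [simp]:
  assumes "A \<in> Obj \<C>"
  shows "p A \<in> Arr \<C>" "Dom \<C> (p A) = Qo A" "Cod \<C> (p A) = A" "p A \<in> W"
  using Q_object [OF assms] by (auto simp: hom_iff)

lemma q_simps [simp]:
  assumes "A \<in> Obj \<C>"
  shows "q A \<in> Arr \<C>" "Dom \<C> (q A) = A" "Cod \<C> (q A) = Ro A" "q A \<in> W"
  using R_object [OF assms] by (auto simp: hom_iff)

lemma Qa_simps [simp]:
  assumes "f \<in> Arr \<C>"
  shows "Qa f \<in> Arr \<C>" "Dom \<C> (Qa f) = Qo (Dom \<C> f)" "Cod \<C> (Qa f) = Qo (Cod \<C> f)"
  using Q_arrow(1) [of f "Dom \<C> f" "Cod \<C> f"] assms by (auto simp: hom_iff)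

lemma Ra_simps [simp]:
  assumes "f \<in> Arr \<C>"
  shows "Ra f \<in> Arr \<C>" "Dom \<C> (Ra f) = Ro (Dom \<C> f)" "Cod \<C> (Ra f) = Ro (Cod \<C> f)"
  using R_arrow(1) [of f "Dom \<C> f" "Cod \<C> f"] assms by (auto simp: hom_iff)

lemma p_natural [simp]: "f \<in> Arr \<C> \<Longrightarrow> Cod \<C> f = B \<Longrightarrow> p B \<cdot> Qa f = f \<cdot> p (Dom \<C> f)"
  using Q_arrow(2) [of f "Dom \<C> f" B] by (simp add: hom_iff)

lemma Qa_Id [simp]: "A \<in> Obj \<C> \<Longrightarrow> Qa (Id \<C> A) = Id \<C> (Qo A)"
  by (rule Q_Id)

lemma \<gamma>_Comp_simp [simp]:
  "f \<in> Arr \<C> \<Longrightarrow> g \<in> Arr \<C> \<Longrightarrow> Cod \<C> f = Dom \<C> g \<Longrightarrow> \<gamma> g \<odot> \<gamma> f = \<gamma> (g \<cdot> f)"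
  by (simp add: \<gamma>_Comp)

lemma \<gamma>_Comp_assoc [simp]:
  assumes "f \<in> Arr \<C>" "g \<in> Arr \<C>" "Cod \<C> f = Dom \<C> g" "x \<in> Arr Ho" "Cod Ho x = Dom \<C> f"
  shows "\<gamma> g \<odot> (\<gamma> f \<odot> x) = \<gamma> (g \<cdot> f) \<odot> x"
  using assms by (intro Ho.Comp_assoc_subst) auto

text \<open>Naturality against an inverted weak equivalence follows from naturality against the weak
  equivalence, so it is enough to check images of arrows of \<open>\<C>\<close>. The functors are
  given by bare actions, which allows instances where all but one variable of a bifunctor are
  fixed.\<close>

lemma Ho_natural:
  assumes F: "\<And>x. x \<in> Arr Ho \<Longrightarrow> Fa x \<in> hom Ho (Fo (Dom Ho x)) (Fo (Cod Ho x))"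
      "\<And>A. A \<in> Obj \<C> \<Longrightarrow> Fa (Id Ho A) = Id Ho (Fo A)"
      "\<And>x y. x \<in> Arr Ho \<Longrightarrow> y \<in> Arr Ho \<Longrightarrow> Cod Ho x = Dom Ho y \<Longrightarrow> Fa (y \<odot> x) = Fa y \<odot> Fa x"
    and G: "\<And>x. x \<in> Arr Ho \<Longrightarrow> Ga x \<in> hom Ho (Go (Dom Ho x)) (Go (Cod Ho x))"
      "\<And>A. A \<in> Obj \<C> \<Longrightarrow> Ga (Id Ho A) = Id Ho (Go A)"
      "\<And>x y. x \<in> Arr Ho \<Longrightarrow> y \<in> Arr Ho \<Longrightarrow> Cod Ho x = Dom Ho y \<Longrightarrow> Ga (y \<odot> x) = Ga y \<odot> Ga x"
    and \<eta>: "\<And>A. A \<in> Obj \<C> \<Longrightarrow> \<eta> A \<in> hom Ho (Fo A) (Go A)"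
    and nat: "\<And>f. f \<in> Arr \<C> \<Longrightarrow> \<eta> (Cod \<C> f) \<odot> Fa (\<gamma> f) = Ga (\<gamma> f) \<odot> \<eta> (Dom \<C> f)"
    and x: "x \<in> hom Ho A B"
  shows "\<eta> B \<odot> Fa x = Ga x \<odot> \<eta> A"
proof -
  have F' [simp]: "Fa x \<in> Arr Ho" "Dom Ho (Fa x) = Fo (Dom Ho x)" "Cod Ho (Fa x) = Fo (Cod Ho x)"
    and G' [simp]: "Ga x \<in> Arr Ho" "Dom Ho (Ga x) = Go (Dom Ho x)" "Cod Ho (Ga x) = Go (Cod Ho x)"
    if "x \<in> Arr Ho" for x
    using F(1) G(1) that by (auto simp: hom_iff)
  have \<eta>' [simp]: "\<eta> A \<in> Arr Ho" "Dom Ho (\<eta> A) = Fo A" "Cod Ho (\<eta> A) = Go A" if "A \<in> Obj \<C>" for A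
    using \<eta> that by (auto simp: hom_iff)
  show ?thesis using x
  proof (induction rule: Ho_induct)
    case Id
    have A: "A \<in> Obj \<C>" using Ho.hom_Obj(1) [OF x] by simp
    have "Fo A \<in> Obj Ho" "Go A \<in> Obj Ho" using Ho.Dom_Obj [of "\<eta> A"] Ho.Cod_Obj [of "\<eta> A"] A by auto
    then show ?case using A F(2) G(2) by simp
  next
    case (Fwd x B f B')
    note s = homD [OF Fwd.hyps(1)] homD [OF Fwd.hyps(2)]
    have ob: "A \<in> Obj \<C>" "B \<in> Obj \<C>" "B' \<in> Obj \<C>"
      using Ho.hom_Obj [OF Fwd.hyps(1)] hom_Obj [OF Fwd.hyps(2)] by auto
    have "\<eta> B' \<odot> Fa (\<gamma> f \<odot> x) = (\<eta> B' \<odot> Fa (\<gamma> f)) \<odot> Fa x" using s ob by (simp add: F(3))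
    also have "\<dots> = (Ga (\<gamma> f) \<odot> \<eta> B) \<odot> Fa x" using nat [of f] s by simp
    also have "\<dots> = Ga (\<gamma> f) \<odot> (\<eta> B \<odot> Fa x)" using s ob by simp
    also have "\<dots> = Ga (\<gamma> f \<odot> x) \<odot> \<eta> A" using Fwd.IH s ob by (simp add: G(3))
    finally show ?case .
  next
    case (Bwd x B w B')
    note s = homD [OF Bwd.hyps(1)] homD [OF Bwd.hyps(2)]
    have ob: "A \<in> Obj \<C>" "B \<in> Obj \<C>" "B' \<in> Obj \<C>"
      using Ho.hom_Obj [OF Bwd.hyps(1)] hom_Obj [OF Bwd.hyps(2)] by auto
    define v where "v = inv_arr Ho (\<gamma> w)"
    have v: "v \<in> Arr Ho" "Dom Ho v = B" "Cod Ho v = B'" "\<gamma> w \<odot> v = Id Ho B" "v \<odot> \<gamma> w = Id Ho B'"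
      using s Bwd.hyps(3) unfolding v_def by auto
    have FG: "Fa (\<gamma> w) \<odot> Fa v = Id Ho (Fo B)" "Ga (\<gamma> w) \<odot> Ga v = Id Ho (Go B)" "Ga v \<odot> Ga (\<gamma> w) = Id Ho (Go B')"
      using F(3) [of v "\<gamma> w"] G(3) [of v "\<gamma> w"] G(3) [of "\<gamma> w" v] s v ob F(2) G(2) by simp_all
    \<comment> \<open>The identity on the left is expanded to
      \<open>Ga v \<odot> Ga (\<gamma> w)\<close>; then \<open>\<eta>\<close> is moved across
      \<open>w\<close>, and \<open>w\<close> cancels against \<open>v\<close> inside
      \<open>Fa\<close>.\<close>
    have "\<eta> B' \<odot> Fa (v \<odot> x) = Id Ho (Go B') \<odot> (\<eta> B' \<odot> (Fa v \<odot> Fa x))"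
      using s v ob by (simp add: F(3))
    also have "\<dots> = Ga v \<odot> (Ga (\<gamma> w) \<odot> \<eta> B') \<odot> (Fa v \<odot> Fa x)"
      unfolding FG(3) [symmetric] using s v ob by simp
    also have "\<dots> = Ga v \<odot> (\<eta> B \<odot> Fa (\<gamma> w)) \<odot> (Fa v \<odot> Fa x)" using nat [of w] s by simp
    also have "\<dots> = Ga v \<odot> (\<eta> B \<odot> ((Fa (\<gamma> w) \<odot> Fa v) \<odot> Fa x))" using s v ob by simp
    also have "\<dots> = Ga v \<odot> (\<eta> B \<odot> Fa x)" using s FG(1) by simp
    also have "\<dots> = Ga (v \<odot> x) \<odot> \<eta> A" using Bwd.IH s v ob by (simp add: G(3))
    finally show ?case unfolding v_def .
  qed
qed

end

context monoidal_skew_closed_model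
begin

lemma tensor_Comp_assoc [simp]:
  assumes "f \<in> Arr \<C>" "g \<in> Arr \<C>" "f' \<in> Arr \<C>" "g' \<in> Arr \<C>" "Cod \<C> f = Dom \<C> f'" "Cod \<C> g = Dom \<C> g'"
    "x \<in> Arr \<C>" "Cod \<C> x = Dom \<C> f \<otimes> Dom \<C> g"
  shows "(f' \<otimes>\<^sub>a g') \<cdot> ((f \<otimes>\<^sub>a g) \<cdot> x) = ((f' \<cdot> f) \<otimes>\<^sub>a (g' \<cdot> g)) \<cdot> x"
  using assms by (intro Comp_assoc_subst) auto

text \<open>The product splits as \<open>(1 \<otimes> g) \<cdot> (f \<otimes> 1)\<close>. Hence
  \<open>X'\<close> has two duties: fibrant as the target of \<open>f\<close>, cofibrant as the
  object that \<open>g\<close> is tensored with.\<close>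

lemma \<gamma>_tensor_cong:
  assumes X: "cofib X" and X': "cofib X'" "fib X'"
    and Y: "cofib Y" and Y': "fib Y'"
    and f: "f \<in> hom \<C> X X'" "f' \<in> hom \<C> X X'" "\<gamma> f = \<gamma> f'"
    and g: "g \<in> hom \<C> Y Y'" "g' \<in> hom \<C> Y Y'" "\<gamma> g = \<gamma> g'"
  shows "\<gamma> (f \<otimes>\<^sub>a g) = \<gamma> (f' \<otimes>\<^sub>a g')"
proof -
  have *: "\<gamma> (f \<otimes>\<^sub>a g) = \<gamma> (\<one> X' \<otimes>\<^sub>a g) \<odot> \<gamma> (f \<otimes>\<^sub>a \<one> Y)" if "f \<in> hom \<C> X X'" "g \<in> hom \<C> Y Y'" for f g
    using that cofibrant_Obj [OF X'(1)] cofibrant_Obj [OF Y] by (simp add: hom_iff)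
  show ?thesis
    using \<gamma>_tensor_Id(1) [OF X Y X'(2) f] \<gamma>_tensor_Id(2) [OF Y X'(1) Y' g] * f(1,2) g(1,2) by simp
qed

section \<open>Bifibrant lifts of arrows of the homotopy category\<close>

definition bif :: "'o \<Rightarrow> 'o" where "bif A = Ro (Qo A)"
definition to_bif :: "'o \<Rightarrow> ('o, 'a) ho_arr" where "to_bif A = \<gamma> (q (Qo A)) \<odot> inv_arr Ho (\<gamma> (p A))"

text \<open>A lift is a map of \<open>\<C>\<close> that represents \<open>x\<close> up to the
  isomorphisms \<open>to_bif\<close>. Bifibrancy ensures that one exists, and invertibility of
  \<open>to_bif\<close> that its image under \<gamma> is unique.\<close>

definition lift_of :: "('o, 'a) ho_arr \<Rightarrow> 'a \<Rightarrow> bool" where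
  "lift_of x f \<longleftrightarrow> x \<in> Arr Ho \<and> f \<in> hom \<C> (bif (Dom Ho x)) (bif (Cod Ho x)) \<and>
     \<gamma> f \<odot> to_bif (Dom Ho x) = to_bif (Cod Ho x) \<odot> x"

definition tensor_to_bif :: "'o \<Rightarrow> 'o \<Rightarrow> ('o, 'a) ho_arr" where
  "tensor_to_bif A B = \<gamma> (q (Qo A) \<otimes>\<^sub>a q (Qo B))"

text \<open>The tensor has to act on classes of zigzags, which carry no preferred map, so lifts are
  chosen arbitrarily and tensored in \<open>\<C>\<close>. The outer arrows bring the result from the
  bifibrant objects back to the prescribed objects \<open>Qo A \<otimes> Qo B\<close>.\<close>

definition derived_tensor :: "('o \<times> 'o, ('o, 'a) ho_arr \<times> ('o, 'a) ho_arr, 'o, ('o, 'a) ho_arr) func" where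
  "derived_tensor = \<lparr>ob = (\<lambda>(A, B). Qo A \<otimes> Qo B),
     ar = (\<lambda>(x, y). inv_arr Ho (tensor_to_bif (Cod Ho x) (Cod Ho y)) \<odot>
        \<gamma> ((SOME f. lift_of x f) \<otimes>\<^sub>a (SOME g. lift_of y g)) \<odot> tensor_to_bif (Dom Ho x) (Dom Ho y))\<rparr>"

lemma bif_simps [simp]:
  assumes "A \<in> Obj \<C>"
  shows "bif A \<in> Obj \<C>" "cofib (bif A)" "fib (bif A)"
    "to_bif A \<in> Arr Ho" "Dom Ho (to_bif A) = A" "Cod Ho (to_bif A) = bif A" "is_iso Ho (to_bif A)"
proof -
  show "is_iso Ho (to_bif A)" unfolding to_bif_def
    using assms by (rule_tac Ho.is_iso_Comp) auto
qed (use assms R_object [of "Qo A"] R_cofibrant Q_object [of A] in \<open>auto simp: bif_def to_bif_def\<close>)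

lemma tensor_to_bif_simps [simp]:
  assumes "A \<in> Obj \<C>" "B \<in> Obj \<C>"
  shows "tensor_to_bif A B \<in> Arr Ho" "Dom Ho (tensor_to_bif A B) = Qo A \<otimes> Qo B"
    "Cod Ho (tensor_to_bif A B) = bif A \<otimes> bif B" "is_iso Ho (tensor_to_bif A B)"
proof -
  have "q (Qo A) \<otimes>\<^sub>a q (Qo B) \<in> W"
    using assms Q_object(1) R_object R_cofibrant
    by (intro tensor_weq [of "Qo A" "Ro (Qo A)" "Qo B" "Ro (Qo B)"]) auto
  then show "is_iso Ho (tensor_to_bif A B)" by (simp add: tensor_to_bif_def)
qed (use assms in \<open>auto simp: bif_def tensor_to_bif_def\<close>)

lemma lift_of_exists:
  assumes x: "x \<in> Arr Ho"
  shows "\<exists>f. lift_of x f"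
proof -
  have ob: "Dom Ho x \<in> Obj \<C>" "Cod Ho x \<in> Obj \<C>" using Ho.Dom_Obj [OF x] Ho.Cod_Obj [OF x] by auto
  have "to_bif (Cod Ho x) \<odot> x \<odot> inv_arr Ho (to_bif (Dom Ho x)) \<in> hom Ho (bif (Dom Ho x)) (bif (Cod Ho x))"
    using x ob by (auto simp: hom_iff)
  then obtain f where "f \<in> hom \<C> (bif (Dom Ho x)) (bif (Cod Ho x))"
    "\<gamma> f = to_bif (Cod Ho x) \<odot> x \<odot> inv_arr Ho (to_bif (Dom Ho x))"
    by (rule Ho_arrow_lift [rotated 2]) (use ob in auto)
  then have "lift_of x f" using x ob by (simp add: lift_of_def)
  then show ?thesis by blast
qed

text \<open>Independence of the choice: two lifts of one arrow agree under \<gamma>, and for maps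
  between bifibrant objects the tensor product respects this.\<close>

lemma derived_tensor_lift:
  assumes x: "lift_of x f" and y: "lift_of y g"
  shows "ar derived_tensor (x, y) =
    inv_arr Ho (tensor_to_bif (Cod Ho x) (Cod Ho y)) \<odot> \<gamma> (f \<otimes>\<^sub>a g) \<odot> tensor_to_bif (Dom Ho x) (Dom Ho y)"
proof -
  have *: "\<gamma> f = \<gamma> f'" if "lift_of x f" "lift_of x f'" for x f f'
  proof (rule Ho.iso_cancel_right [of "to_bif (Dom Ho x)"])
    show "\<gamma> f \<odot> to_bif (Dom Ho x) = \<gamma> f' \<odot> to_bif (Dom Ho x)" using that by (simp add: lift_of_def)
  qed (use that in \<open>auto simp: lift_of_def hom_iff\<close>)
  define f' where "f' = (SOME f. lift_of x f)"
  define g' where "g' = (SOME g. lift_of y g)"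
  have f': "lift_of x f'" unfolding f'_def using x by (rule someI)
  have g': "lift_of y g'" unfolding g'_def using y by (rule someI)
  have ob: "Dom Ho x \<in> Obj \<C>" "Cod Ho x \<in> Obj \<C>" "Dom Ho y \<in> Obj \<C>" "Cod Ho y \<in> Obj \<C>"
    using x y Ho.Dom_Obj Ho.Cod_Obj by (auto simp: lift_of_def)
  have "\<gamma> (f' \<otimes>\<^sub>a g') = \<gamma> (f \<otimes>\<^sub>a g)"
    using * [OF f' x] * [OF g' y] f' g' x y ob
    by (intro \<gamma>_tensor_cong [of "bif (Dom Ho x)" "bif (Cod Ho x)" "bif (Dom Ho y)" "bif (Cod Ho y)"])
      (auto simp: lift_of_def)
  then show ?thesis by (simp add: derived_tensor_def f'_def g'_def)
qed

lemma lift_of_Id: "A \<in> Obj \<C> \<Longrightarrow> lift_of (Id Ho A) (Id \<C> (bif A))"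
  by (simp add: lift_of_def hom_iff)

lemma lift_of_Comp:
  assumes x: "lift_of x f" and y: "lift_of y g" and "Cod Ho x = Dom Ho y"
  shows "lift_of (y \<odot> x) (g \<cdot> f)"
proof -
  have s: "x \<in> Arr Ho" "y \<in> Arr Ho" "f \<in> Arr \<C>" "g \<in> Arr \<C>"
    "Dom \<C> f = bif (Dom Ho x)" "Cod \<C> f = bif (Dom Ho y)" "Dom \<C> g = bif (Dom Ho y)" "Cod \<C> g = bif (Cod Ho y)"
    "Dom Ho x \<in> Obj \<C>" "Dom Ho y \<in> Obj \<C>" "Cod Ho y \<in> Obj \<C>"
    using assms Ho.Dom_Obj Ho.Cod_Obj by (auto simp: lift_of_def hom_iff)
  have "\<gamma> (g \<cdot> f) \<odot> to_bif (Dom Ho x) = \<gamma> g \<odot> (\<gamma> f \<odot> to_bif (Dom Ho x))" using s by simp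
  also have "\<dots> = (\<gamma> g \<odot> to_bif (Dom Ho y)) \<odot> x" using x assms(3) s by (simp add: lift_of_def)
  also have "\<dots> = to_bif (Cod Ho y) \<odot> (y \<odot> x)" using y s assms(3) by (simp add: lift_of_def)
  finally show ?thesis using s assms(3) by (simp add: lift_of_def hom_iff)
qed

text \<open>The square is the naturality of \<open>q\<close> at \<open>Qa f\<close> pasted to that
  of \<open>p\<close>, the latter read with \<open>p\<close> inverted.\<close>

lemma lift_of_\<gamma>:
  assumes f: "f \<in> Arr \<C>"
  shows "lift_of (\<gamma> f) (Ra (Qa f))"
proof -
  have Rq: "Ra (Qa f) \<cdot> q (Qo (Dom \<C> f)) = q (Qo (Cod \<C> f)) \<cdot> Qa f"
    using R_arrow(2) [of "Qa f" "Qo (Dom \<C> f)" "Qo (Cod \<C> f)"] f by (simp add: hom_iff)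
  have "\<gamma> (p (Cod \<C> f)) \<odot> (\<gamma> (Qa f) \<odot> inv_arr Ho (\<gamma> (p (Dom \<C> f)))) = \<gamma> f"
    using f by (simp flip: \<gamma>_Comp_simp)
  then have "inv_arr Ho (\<gamma> (p (Cod \<C> f))) \<odot> \<gamma> f = \<gamma> (Qa f) \<odot> inv_arr Ho (\<gamma> (p (Dom \<C> f)))"
    using f by (metis (no_types, lifting) Dom_Cod_Obj Ho.inv_arr_cancel(1) Ho.Comp_simps(1,3) Ho.inv_arr_simps(1-3)
        Qa_simps \<gamma>_simps \<gamma>_weq_iso p_simps)
  then show ?thesis using f Rq
    by (simp add: lift_of_def hom_iff bif_def to_bif_def flip: \<gamma>_Comp)
qed

text \<open>Lifts of composable arrows compose to a lift of the composite, so functoriality is that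
  of \<open>\<otimes>\<close> on lifts. On images of \<open>f\<close> and \<open>g\<close> the lifts
  \<open>RQf\<close> and \<open>RQg\<close> are used, and naturality of \<open>q\<close> gives the
  prescribed value.\<close>

theorem is_derived_tensor_derived_tensor: "is_derived_tensor \<C> W \<Phi> T derived_tensor"
  unfolding is_derived_tensor_def Let_def
proof (intro conjI ballI)
  show "is_functor (prod_cat Ho Ho) Ho derived_tensor"
  proof (rule bifunctorI)
    fix x y assume x: "x \<in> Arr Ho" and y: "y \<in> Arr Ho"
    obtain f g where f: "lift_of x f" and g: "lift_of y g" using lift_of_exists x y by blast
    have ob: "Dom Ho x \<in> Obj \<C>" "Cod Ho x \<in> Obj \<C>" "Dom Ho y \<in> Obj \<C>" "Cod Ho y \<in> Obj \<C>"
      using Ho.Dom_Obj Ho.Cod_Obj x y by auto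
    show "ar derived_tensor (x, y) \<in> hom Ho (ob derived_tensor (Dom Ho x, Dom Ho y)) (ob derived_tensor (Cod Ho x, Cod Ho y))"
      unfolding derived_tensor_lift [OF f g] using f g ob by (simp add: derived_tensor_def lift_of_def hom_iff)
    fix x' y' assume x': "x' \<in> Arr Ho" "Cod Ho x = Dom Ho x'" and y': "y' \<in> Arr Ho" "Cod Ho y = Dom Ho y'"
    obtain f' g' where f': "lift_of x' f'" and g': "lift_of y' g'" using lift_of_exists x' y' by blast
    have ob': "Cod Ho x' \<in> Obj \<C>" "Cod Ho y' \<in> Obj \<C>"
      using Ho.Cod_Obj x' y' by auto
    note c = lift_of_Comp [OF f f' x'(2)] lift_of_Comp [OF g g' y'(2)]
    have s: "f \<in> Arr \<C>" "Dom \<C> f = bif (Dom Ho x)" "Cod \<C> f = bif (Dom Ho x')"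
      "g \<in> Arr \<C>" "Dom \<C> g = bif (Dom Ho y)" "Cod \<C> g = bif (Dom Ho y')"
      "f' \<in> Arr \<C>" "Dom \<C> f' = bif (Dom Ho x')" "Cod \<C> f' = bif (Cod Ho x')"
      "g' \<in> Arr \<C>" "Dom \<C> g' = bif (Dom Ho y')" "Cod \<C> g' = bif (Cod Ho y')"
      using f g f' g' x'(2) y'(2) by (auto simp: lift_of_def hom_iff)
    show "ar derived_tensor (x' \<odot> x, y' \<odot> y) = ar derived_tensor (x', y') \<odot> ar derived_tensor (x, y)"
      unfolding derived_tensor_lift [OF f g] derived_tensor_lift [OF f' g'] derived_tensor_lift [OF c]
      using s x y x' y' ob ob' by simp
  next
    fix A B assume "A \<in> Obj Ho" "B \<in> Obj Ho"
    then have AB: "A \<in> Obj \<C>" "B \<in> Obj \<C>" by auto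
    then show "ob derived_tensor (A, B) \<in> Obj Ho" by (simp add: derived_tensor_def)
    show "ar derived_tensor (Id Ho A, Id Ho B) = Id Ho (ob derived_tensor (A, B))"
      unfolding derived_tensor_lift [OF lift_of_Id [OF AB(1)] lift_of_Id [OF AB(2)]]
      using AB by (simp add: derived_tensor_def)
  qed (rule ho_category)+
next
  fix A B show "ob derived_tensor (A, B) = Qo A \<otimes> Qo B" by (simp add: derived_tensor_def)
next
  fix f g assume fg: "f \<in> Arr \<C>" "g \<in> Arr \<C>"
  have Rq: "Ra (Qa f) \<cdot> q (Qo (Dom \<C> f)) = q (Qo (Cod \<C> f)) \<cdot> Qa f" if "f \<in> Arr \<C>" for f
    using R_arrow(2) [of "Qa f" "Qo (Dom \<C> f)" "Qo (Cod \<C> f)"] that by (simp add: hom_iff)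
  have "\<gamma> (Ra (Qa f) \<otimes>\<^sub>a Ra (Qa g)) \<odot> tensor_to_bif (Dom \<C> f) (Dom \<C> g) =
      tensor_to_bif (Cod \<C> f) (Cod \<C> g) \<odot> \<gamma> (Qa f \<otimes>\<^sub>a Qa g)"
    unfolding tensor_to_bif_def using fg Rq by simp
  then show "ar derived_tensor (\<gamma> f, \<gamma> g) = \<gamma> (Qa f \<otimes>\<^sub>a Qa g)"
    unfolding derived_tensor_lift [OF lift_of_\<gamma> [OF fg(1)] lift_of_\<gamma> [OF fg(2)]]
    using fg by (simp add: bif_def)
qed

end

section \<open>The derived skew monoidal structure\<close>

context monoidal_skew_closed_model
begin

abbreviation dtensor (infixr "\<boxtimes>" 75) where "x \<boxtimes> y \<equiv> ar derived_tensor (x, y)"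
abbreviation dassoc where "dassoc \<equiv> derived_assoc \<C> W \<Phi> T \<alpha>"
abbreviation dleft where "dleft \<equiv> derived_left_unit \<C> W \<Phi> T I l"
abbreviation dright where "dright \<equiv> derived_right_unit \<C> W \<Phi> T I r"

lemma derived_tensor_functor: "is_functor (prod_cat Ho Ho) Ho derived_tensor"
  using is_derived_tensor_derived_tensor by (simp add: is_derived_tensor_def Let_def)

lemma derived_tensor_ob [simp]: "ob derived_tensor (A, B) = Qo A \<otimes> Qo B"
  by (simp add: derived_tensor_def)

lemmas dtensor_simps [simp] = bifunctorD(2-) [OF derived_tensor_functor, unfolded derived_tensor_ob ho_Obj]

lemma dtensor_Comp_assoc [simp]:
  assumes "x \<in> Arr Ho" "y \<in> Arr Ho" "x' \<in> Arr Ho" "y' \<in> Arr Ho" "Cod Ho x = Dom Ho x'" "Cod Ho y = Dom Ho y'"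
    "z \<in> Arr Ho" "Cod Ho z = Qo (Dom Ho x) \<otimes> Qo (Dom Ho y)"
  shows "(x' \<boxtimes> y') \<odot> ((x \<boxtimes> y) \<odot> z) = ((x' \<odot> x) \<boxtimes> (y' \<odot> y)) \<odot> z"
  using assms by (intro Ho.Comp_assoc_subst) auto

lemma dtensor_\<gamma>: "f \<in> Arr \<C> \<Longrightarrow> g \<in> Arr \<C> \<Longrightarrow> \<gamma> f \<boxtimes> \<gamma> g = \<gamma> (Qa f \<otimes>\<^sub>a Qa g)"
  using is_derived_tensor_derived_tensor by (simp add: is_derived_tensor_def Let_def)

lemma dtensor_\<gamma>_Id:
  assumes "f \<in> Arr \<C>" "A \<in> Obj \<C>"
  shows "\<gamma> f \<boxtimes> Id Ho A = \<gamma> (Qa f \<otimes>\<^sub>a \<one> (Qo A))" "Id Ho A \<boxtimes> \<gamma> f = \<gamma> (\<one> (Qo A) \<otimes>\<^sub>a Qa f)"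
  using dtensor_\<gamma> [of f "\<one> A"] dtensor_\<gamma> [of "\<one> A" f] assms by simp_all

lemma is_iso_dtensor:
  assumes "is_iso Ho x" "is_iso Ho y"
  shows "is_iso Ho (x \<boxtimes> y)"
  using assms Ho.is_iso_Arr [OF assms(1)] Ho.is_iso_Arr [OF assms(2)]
  by (rule_tac Ho.is_isoI [of _ "inv_arr Ho x \<boxtimes> inv_arr Ho y"]) auto

lemma unit_in_Obj [simp]: "I \<in> Obj \<C>"
  using cofibrant_Obj [OF I_cofibrant] .

lemma \<alpha>_simps [simp]:
  assumes "A \<in> Obj \<C>" "B \<in> Obj \<C>" "D \<in> Obj \<C>"
  shows "\<alpha> A B D \<in> Arr \<C>" "Dom \<C> (\<alpha> A B D) = (A \<otimes> B) \<otimes> D" "Cod \<C> (\<alpha> A B D) = A \<otimes> (B \<otimes> D)"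
  using \<alpha>_hom [OF assms] by (auto simp: hom_iff)

lemma lr_simps [simp]:
  assumes "A \<in> Obj \<C>"
  shows "l A \<in> Arr \<C>" "Dom \<C> (l A) = I \<otimes> A" "Cod \<C> (l A) = A"
    "r A \<in> Arr \<C>" "Dom \<C> (r A) = A" "Cod \<C> (r A) = A \<otimes> I"
  using l_hom [OF assms] r_hom [OF assms] by (auto simp: hom_iff)

lemma \<alpha>_nat:
  assumes "f \<in> Arr \<C>" "g \<in> Arr \<C>" "h \<in> Arr \<C>"
  shows "\<alpha> (Cod \<C> f) (Cod \<C> g) (Cod \<C> h) \<cdot> ((f \<otimes>\<^sub>a g) \<otimes>\<^sub>a h) =
    (f \<otimes>\<^sub>a (g \<otimes>\<^sub>a h)) \<cdot> \<alpha> (Dom \<C> f) (Dom \<C> g) (Dom \<C> h)"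
  using assms by (intro \<alpha>_natural) (auto simp: hom_iff)

lemma l_nat: "f \<in> Arr \<C> \<Longrightarrow> l (Cod \<C> f) \<cdot> (\<one> I \<otimes>\<^sub>a f) = f \<cdot> l (Dom \<C> f)"
  by (rule l_natural) (auto simp: hom_iff)

lemma r_nat: "f \<in> Arr \<C> \<Longrightarrow> r (Cod \<C> f) \<cdot> f = (f \<otimes>\<^sub>a \<one> I) \<cdot> r (Dom \<C> f)"
  by (rule r_natural) (auto simp: hom_iff)

abbreviation pp where "pp A B \<equiv> p (Qo A \<otimes> Qo B)"

lemma tensor_p_weq:
  assumes "A \<in> Obj \<C>" "B \<in> Obj \<C>" "D \<in> Obj \<C>"
  shows "\<one> (Qo A) \<otimes>\<^sub>a pp B D \<in> W" "pp A B \<otimes>\<^sub>a \<one> (Qo D) \<in> W"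
proof -
  note Q = Q_object [OF assms(1)] Q_object [OF assms(2)] Q_object [OF assms(3)]
  have c: "cofib (Qo A \<otimes> Qo B)" "cofib (Qo B \<otimes> Qo D)"
    using tensor_cofibrant Q by auto
  note P = Q_object [OF cofibrant_Obj [OF c(1)]] Q_object [OF cofibrant_Obj [OF c(2)]]
  show "\<one> (Qo A) \<otimes>\<^sub>a pp B D \<in> W" by (rule tensor_right_weq [OF Q(1) P(5) c(2) P(6,8)])
  show "pp A B \<otimes>\<^sub>a \<one> (Qo D) \<in> W" by (rule tensor_left_weq [OF P(1) c(1) Q(9) P(2,4)])
qed

lemma tensor_p_unit_weq:
  assumes "A \<in> Obj \<C>"
  shows "\<one> (Qo A) \<otimes>\<^sub>a p I \<in> W" "p I \<otimes>\<^sub>a \<one> (Qo A) \<in> W"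
proof -
  note Q = Q_object [OF assms] Q_object [OF unit_in_Obj]
  show "\<one> (Qo A) \<otimes>\<^sub>a p I \<in> W" by (rule tensor_right_weq [OF Q(1) Q(5) I_cofibrant Q(6,8)])
  show "p I \<otimes>\<^sub>a \<one> (Qo A) \<in> W" by (rule tensor_left_weq [OF Q(5) I_cofibrant Q(1) Q(6,8)])
qed

section \<open>Naturality of the derived structure maps\<close>

lemma dassoc_eq:
  "dassoc A B D = inv_arr Ho (\<gamma> (\<one> (Qo A) \<otimes>\<^sub>a pp B D)) \<odot> \<gamma> (\<alpha> (Qo A) (Qo B) (Qo D)) \<odot> \<gamma> (pp A B \<otimes>\<^sub>a \<one> (Qo D))"
  by (simp add: derived_assoc_def Let_def)

lemma dassoc_simps [simp]:
  assumes "A \<in> Obj \<C>" "B \<in> Obj \<C>" "D \<in> Obj \<C>"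
  shows "dassoc A B D \<in> Arr Ho" "Dom Ho (dassoc A B D) = Qo (Qo A \<otimes> Qo B) \<otimes> Qo D"
    "Cod Ho (dassoc A B D) = Qo A \<otimes> Qo (Qo B \<otimes> Qo D)"
    "\<gamma> (\<one> (Qo A) \<otimes>\<^sub>a pp B D) \<odot> dassoc A B D = \<gamma> (\<alpha> (Qo A) (Qo B) (Qo D) \<cdot> (pp A B \<otimes>\<^sub>a \<one> (Qo D)))"
  using assms tensor_p_weq unfolding dassoc_eq by auto

text \<open>Composing both sides with the invertible \<open>\<gamma> (1 \<otimes> pp)\<close>
  cancels the inverse in the derived associator. What is left is naturality of
  \<open>\<alpha>\<close> and of \<open>p\<close>.\<close>

lemma dassoc_\<gamma>_natural:
  assumes "f \<in> Arr \<C>" "g \<in> Arr \<C>" "h \<in> Arr \<C>"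
  shows "dassoc (Cod \<C> f) (Cod \<C> g) (Cod \<C> h) \<odot> \<gamma> (Qa (Qa f \<otimes>\<^sub>a Qa g) \<otimes>\<^sub>a Qa h) =
    \<gamma> (Qa f \<otimes>\<^sub>a Qa (Qa g \<otimes>\<^sub>a Qa h)) \<odot> dassoc (Dom \<C> f) (Dom \<C> g) (Dom \<C> h)"
    (is "?D' \<odot> ?l = ?r \<odot> ?D")
proof (rule Ho.iso_cancel_left)
  let ?X = "\<gamma> (\<one> (Qo (Cod \<C> f)) \<otimes>\<^sub>a pp (Cod \<C> g) (Cod \<C> h))"
  show "is_iso Ho ?X" using assms tensor_p_weq by simp
  have "?X \<odot> (?D' \<odot> ?l) = (?X \<odot> ?D') \<odot> ?l"
    using assms by (simp del: dassoc_simps(4))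
  also have "\<dots> = \<gamma> (\<alpha> (Cod \<C> (Qa f)) (Cod \<C> (Qa g)) (Cod \<C> (Qa h)) \<cdot> ((Qa f \<otimes>\<^sub>a Qa g) \<otimes>\<^sub>a Qa h)) \<odot>
      \<gamma> (pp (Dom \<C> f) (Dom \<C> g) \<otimes>\<^sub>a \<one> (Qo (Dom \<C> h)))"
    using assms by simp
  also have "\<dots> = \<gamma> (Qa f \<otimes>\<^sub>a (Qa g \<otimes>\<^sub>a Qa h)) \<odot>
      (\<gamma> (\<one> (Qo (Dom \<C> f)) \<otimes>\<^sub>a pp (Dom \<C> g) (Dom \<C> h)) \<odot> ?D)"
    using assms by (subst \<alpha>_nat) auto
  also have "\<dots> = ?X \<odot> (?r \<odot> ?D)"
    using assms by (simp del: dassoc_simps(4))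
  finally show "?X \<odot> (?D' \<odot> ?l) = ?X \<odot> (?r \<odot> ?D)" .
qed (use assms in auto)

text \<open>Extension from \<open>\<C>\<close> to \<open>Ho\<close> works in one variable at a time,
  so the three arrows are treated separately, with identities in the other places, and the three
  squares are pasted.\<close>

lemma dassoc_natural:
  assumes x: "x \<in> hom Ho A A'" and y: "y \<in> hom Ho B B'" and z: "z \<in> hom Ho D D'"
  shows "dassoc A' B' D' \<odot> ((x \<boxtimes> y) \<boxtimes> z) = (x \<boxtimes> (y \<boxtimes> z)) \<odot> dassoc A B D"
proof -
  note s = homD [OF x] homD [OF y] homD [OF z]
  have ob: "A \<in> Obj \<C>" "B \<in> Obj \<C>" "D \<in> Obj \<C>" "A' \<in> Obj \<C>" "B' \<in> Obj \<C>" "D' \<in> Obj \<C>"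
    using Ho.hom_Obj [OF x] Ho.hom_Obj [OF y] Ho.hom_Obj [OF z] by auto
  have 1: "dassoc A' B' D' \<odot> ((x \<boxtimes> Id Ho B') \<boxtimes> Id Ho D') = (x \<boxtimes> Id Ho (Qo B' \<otimes> Qo D')) \<odot> dassoc A B' D'"
    by (rule Ho_natural [OF _ _ _ _ _ _ _ _ x, where Fo = "\<lambda>A. Qo (Qo A \<otimes> Qo B') \<otimes> Qo D'"
          and Fa = "\<lambda>x. (x \<boxtimes> Id Ho B') \<boxtimes> Id Ho D'"
          and Go = "\<lambda>A. Qo A \<otimes> Qo (Qo B' \<otimes> Qo D')" and Ga = "\<lambda>x. x \<boxtimes> Id Ho (Qo B' \<otimes> Qo D')"
          and \<eta> = "\<lambda>A. dassoc A B' D'"])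
      (use ob dassoc_\<gamma>_natural [of _ "\<one> B'" "\<one> D'"] in \<open>simp_all add: hom_iff dtensor_\<gamma>_Id\<close>)
  have 2: "dassoc A B' D' \<odot> ((Id Ho A \<boxtimes> y) \<boxtimes> Id Ho D') = (Id Ho A \<boxtimes> (y \<boxtimes> Id Ho D')) \<odot> dassoc A B D'"
    by (rule Ho_natural [OF _ _ _ _ _ _ _ _ y, where Fo = "\<lambda>B. Qo (Qo A \<otimes> Qo B) \<otimes> Qo D'"
          and Fa = "\<lambda>y. (Id Ho A \<boxtimes> y) \<boxtimes> Id Ho D'"
          and Go = "\<lambda>B. Qo A \<otimes> Qo (Qo B \<otimes> Qo D')" and Ga = "\<lambda>y. Id Ho A \<boxtimes> (y \<boxtimes> Id Ho D')"
          and \<eta> = "\<lambda>B. dassoc A B D'"])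
      (use ob dassoc_\<gamma>_natural [of "\<one> A" _ "\<one> D'"] in \<open>simp_all add: hom_iff dtensor_\<gamma>_Id\<close>)
  have 3: "dassoc A B D' \<odot> (Id Ho (Qo A \<otimes> Qo B) \<boxtimes> z) = (Id Ho A \<boxtimes> (Id Ho B \<boxtimes> z)) \<odot> dassoc A B D"
    by (rule Ho_natural [OF _ _ _ _ _ _ _ _ z, where Fo = "\<lambda>D. Qo (Qo A \<otimes> Qo B) \<otimes> Qo D"
          and Fa = "\<lambda>z. Id Ho (Qo A \<otimes> Qo B) \<boxtimes> z"
          and Go = "\<lambda>D. Qo A \<otimes> Qo (Qo B \<otimes> Qo D)" and Ga = "\<lambda>z. Id Ho A \<boxtimes> (Id Ho B \<boxtimes> z)"
          and \<eta> = "\<lambda>D. dassoc A B D"])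
      (use ob dassoc_\<gamma>_natural [of "\<one> A" "\<one> B"] in \<open>simp_all add: hom_iff dtensor_\<gamma>_Id\<close>)
  have "dassoc A' B' D' \<odot> ((x \<boxtimes> y) \<boxtimes> z) =
      (dassoc A' B' D' \<odot> ((x \<boxtimes> Id Ho B') \<boxtimes> Id Ho D')) \<odot> (((Id Ho A \<boxtimes> y) \<boxtimes> Id Ho D') \<odot> (Id Ho (Qo A \<otimes> Qo B) \<boxtimes> z))"
    using s ob by simp
  also have "\<dots> = (x \<boxtimes> Id Ho (Qo B' \<otimes> Qo D')) \<odot> (dassoc A B' D' \<odot> ((Id Ho A \<boxtimes> y) \<boxtimes> Id Ho D')) \<odot> (Id Ho (Qo A \<otimes> Qo B) \<boxtimes> z)"
    unfolding 1 using s ob by simp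
  also have "\<dots> = (x \<boxtimes> Id Ho (Qo B' \<otimes> Qo D')) \<odot> (Id Ho A \<boxtimes> (y \<boxtimes> Id Ho D')) \<odot> (dassoc A B D' \<odot> (Id Ho (Qo A \<otimes> Qo B) \<boxtimes> z))"
    unfolding 2 using s ob by simp
  also have "\<dots> = (x \<boxtimes> (y \<boxtimes> z)) \<odot> dassoc A B D"
    unfolding 3 using s ob by simp
  finally show ?thesis .
qed

text \<open>The derived associator is built from \<open>\<alpha>\<close> at the replaced objects,
  yet by naturality of \<open>\<alpha>\<close> along the maps \<open>p\<close> it lies over
  \<open>\<alpha>\<close> at the original ones.\<close>

lemma dassoc_covers_Id:
  assumes "A \<in> Obj \<C>" "B \<in> Obj \<C>" "D \<in> Obj \<C>"
  shows "\<gamma> (p A \<otimes>\<^sub>a ((p B \<otimes>\<^sub>a p D) \<cdot> pp B D)) \<odot> dassoc A B D =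
    \<gamma> (\<alpha> A B D) \<odot> \<gamma> (((p A \<otimes>\<^sub>a p B) \<cdot> pp A B) \<otimes>\<^sub>a p D)"
proof -
  have "\<gamma> (p A \<otimes>\<^sub>a ((p B \<otimes>\<^sub>a p D) \<cdot> pp B D)) \<odot> dassoc A B D =
      \<gamma> (p A \<otimes>\<^sub>a (p B \<otimes>\<^sub>a p D)) \<odot> (\<gamma> (\<one> (Qo A) \<otimes>\<^sub>a pp B D) \<odot> dassoc A B D)"
    using assms by (simp del: dassoc_simps(4))
  also have "\<dots> = \<gamma> ((p A \<otimes>\<^sub>a (p B \<otimes>\<^sub>a p D)) \<cdot> \<alpha> (Dom \<C> (p A)) (Dom \<C> (p B)) (Dom \<C> (p D))) \<odot> \<gamma> (pp A B \<otimes>\<^sub>a \<one> (Qo D))"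
    using assms by simp
  also have "\<dots> = \<gamma> (\<alpha> A B D) \<odot> \<gamma> (((p A \<otimes>\<^sub>a p B) \<cdot> pp A B) \<otimes>\<^sub>a p D)"
    using assms by (subst \<alpha>_nat [symmetric]) auto
  finally show ?thesis .
qed

text \<open>By naturality of \<open>l\<close> along \<open>p A\<close>, the derived unit map is
  \<open>l A\<close> itself after the comparison from the replaced objects.\<close>

lemma dleft_eq: "A \<in> Obj \<C> \<Longrightarrow> dleft A = \<gamma> (l A) \<odot> \<gamma> (p I \<otimes>\<^sub>a p A)"
proof -
  assume A: "A \<in> Obj \<C>"
  have "dleft A = \<gamma> (p A \<cdot> l (Dom \<C> (p A))) \<odot> \<gamma> (p I \<otimes>\<^sub>a \<one> (Qo A))"
    using A by (simp add: derived_left_unit_def Let_def)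
  also have "\<dots> = \<gamma> (l A) \<odot> \<gamma> (p I \<otimes>\<^sub>a p A)"
    using A by (subst l_nat [symmetric]) auto
  finally show ?thesis .
qed

lemma dleft_simps [simp]:
  assumes "A \<in> Obj \<C>"
  shows "dleft A \<in> Arr Ho" "Dom Ho (dleft A) = Qo I \<otimes> Qo A" "Cod Ho (dleft A) = A"
  using assms by (simp_all add: dleft_eq)

lemma dleft_natural:
  assumes x: "x \<in> hom Ho A B"
  shows "dleft B \<odot> (Id Ho I \<boxtimes> x) = x \<odot> dleft A"
proof (rule Ho_natural [OF _ _ _ _ _ _ _ _ x, where Fo = "\<lambda>A. Qo I \<otimes> Qo A" and Go = "\<lambda>A. A"
      and Fa = "\<lambda>x. Id Ho I \<boxtimes> x" and Ga = "\<lambda>x. x" and \<eta> = dleft])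
  fix f assume f: "f \<in> Arr \<C>"
  have "dleft (Cod \<C> f) \<odot> (Id Ho I \<boxtimes> \<gamma> f) = \<gamma> (l (Cod \<C> f) \<cdot> (\<one> I \<otimes>\<^sub>a f)) \<odot> \<gamma> (p I \<otimes>\<^sub>a p (Dom \<C> f))"
    using f by (simp add: dleft_eq dtensor_\<gamma>_Id)
  also have "\<dots> = \<gamma> f \<odot> dleft (Dom \<C> f)" unfolding l_nat [OF f] using f by (simp add: dleft_eq)
  finally show "dleft (Cod \<C> f) \<odot> (Id Ho I \<boxtimes> \<gamma> f) = \<gamma> f \<odot> dleft (Dom \<C> f)" .
qed (auto simp: hom_iff)

lemma dright_simps [simp]:
  assumes "A \<in> Obj \<C>"
  shows "dright A \<in> Arr Ho" "Dom Ho (dright A) = A" "Cod Ho (dright A) = Qo A \<otimes> Qo I"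
    "\<gamma> (\<one> (Qo A) \<otimes>\<^sub>a p I) \<odot> dright A = \<gamma> (r (Qo A)) \<odot> inv_arr Ho (\<gamma> (p A))"
  using assms tensor_p_unit_weq [of A] by (simp_all add: derived_right_unit_def Let_def)

text \<open>Naturality of \<open>r\<close> along \<open>p A\<close> moves \<open>p A\<close> to the
  right, where it meets its own inverse.\<close>

lemma dright_covers_Id:
  assumes "A \<in> Obj \<C>"
  shows "\<gamma> (p A \<otimes>\<^sub>a p I) \<odot> dright A = \<gamma> (r A)"
proof -
  have "\<gamma> (p A \<otimes>\<^sub>a p I) \<odot> dright A = \<gamma> (p A \<otimes>\<^sub>a \<one> I) \<odot> (\<gamma> (\<one> (Qo A) \<otimes>\<^sub>a p I) \<odot> dright A)"
    using assms by (simp del: dright_simps(4))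
  also have "\<dots> = \<gamma> ((p A \<otimes>\<^sub>a \<one> I) \<cdot> r (Dom \<C> (p A))) \<odot> inv_arr Ho (\<gamma> (p A))"
    using assms by simp
  also have "\<dots> = \<gamma> (r A) \<odot> (\<gamma> (p A) \<odot> inv_arr Ho (\<gamma> (p A)))"
    using assms by (subst r_nat [symmetric]) (auto simp del: Ho.inv_arr_simps(5))
  also have "\<dots> = \<gamma> (r A)" using assms by simp
  finally show ?thesis .
qed

lemma inv_p_natural:
  assumes f: "f \<in> Arr \<C>"
  shows "inv_arr Ho (\<gamma> (p (Cod \<C> f))) \<odot> \<gamma> f = \<gamma> (Qa f) \<odot> inv_arr Ho (\<gamma> (p (Dom \<C> f)))"
proof (rule Ho.iso_cancel_left)
  show "is_iso Ho (\<gamma> (p (Cod \<C> f)))" using f by simp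
  show "\<gamma> (p (Cod \<C> f)) \<odot> (inv_arr Ho (\<gamma> (p (Cod \<C> f))) \<odot> \<gamma> f) =
      \<gamma> (p (Cod \<C> f)) \<odot> (\<gamma> (Qa f) \<odot> inv_arr Ho (\<gamma> (p (Dom \<C> f))))"
    using f by (simp flip: \<gamma>_Comp_simp)
qed (use f in auto)

lemma dright_natural:
  assumes x: "x \<in> hom Ho A B"
  shows "dright B \<odot> x = (x \<boxtimes> Id Ho I) \<odot> dright A"
proof (rule Ho_natural [OF _ _ _ _ _ _ _ _ x, where Go = "\<lambda>A. Qo A \<otimes> Qo I" and Fo = "\<lambda>A. A"
      and Ga = "\<lambda>x. x \<boxtimes> Id Ho I" and Fa = "\<lambda>x. x" and \<eta> = dright])
  fix f assume f: "f \<in> Arr \<C>"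
  let ?X = "\<gamma> (\<one> (Qo (Cod \<C> f)) \<otimes>\<^sub>a p I)"
  show "dright (Cod \<C> f) \<odot> \<gamma> f = (\<gamma> f \<boxtimes> Id Ho I) \<odot> dright (Dom \<C> f)"
  proof (rule Ho.iso_cancel_left)
    show "is_iso Ho ?X" using f tensor_p_unit_weq [of "Cod \<C> f"] by simp
    have "?X \<odot> (dright (Cod \<C> f) \<odot> \<gamma> f) = (?X \<odot> dright (Cod \<C> f)) \<odot> \<gamma> f"
      using f by (simp del: dright_simps(4))
    also have "\<dots> = \<gamma> (r (Cod \<C> (Qa f))) \<odot> (inv_arr Ho (\<gamma> (p (Cod \<C> f))) \<odot> \<gamma> f)"
      using f by simp
    also have "\<dots> = \<gamma> (r (Cod \<C> (Qa f)) \<cdot> Qa f) \<odot> inv_arr Ho (\<gamma> (p (Dom \<C> f)))"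
      unfolding inv_p_natural [OF f] using f by simp
    also have "\<dots> = \<gamma> (Qa f \<otimes>\<^sub>a \<one> I) \<odot> (\<gamma> (\<one> (Qo (Dom \<C> f)) \<otimes>\<^sub>a p I) \<odot> dright (Dom \<C> f))"
      using f by (subst r_nat) auto
    also have "\<dots> = ?X \<odot> ((\<gamma> f \<boxtimes> Id Ho I) \<odot> dright (Dom \<C> f))"
      using f by (simp add: dtensor_\<gamma>_Id del: dright_simps(4))
    finally show "?X \<odot> (dright (Cod \<C> f) \<odot> \<gamma> f) = ?X \<odot> ((\<gamma> f \<boxtimes> Id Ho I) \<odot> dright (Dom \<C> f))" .
  qed (use f in auto)
qed (auto simp: hom_iff)

text \<open>All of the derived structure covers the given structure on cofibrant objects, so that an equation
  in \<open>\<C>\<close> passes to the homotopy category.\<close>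

definition covers :: "('o, 'a) ho_arr \<Rightarrow> ('o, 'a) ho_arr \<Rightarrow> ('o, 'a) ho_arr \<Rightarrow> 'a \<Rightarrow> bool" where
  "covers c d x f \<longleftrightarrow> x \<in> Arr Ho \<and> f \<in> Arr \<C> \<and> c \<in> Arr Ho \<and> d \<in> Arr Ho \<and>
     Dom Ho c = Dom Ho x \<and> Dom Ho d = Cod Ho x \<and> Cod Ho c = Dom \<C> f \<and> Cod Ho d = Cod \<C> f \<and>
     d \<odot> x = \<gamma> f \<odot> c"

text \<open>At identities this is the canonical map from the derived tensor product to the tensor
  product in \<open>\<C>\<close>. Allowing arbitrary \<open>c\<close> and \<open>c'\<close> makes it
  iterable, so it supplies the comparison for every bracketing.\<close>

definition comparison :: "('o, 'a) ho_arr \<Rightarrow> ('o, 'a) ho_arr \<Rightarrow> ('o, 'a) ho_arr" where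
  "comparison c c' = \<gamma> (p (Cod Ho c) \<otimes>\<^sub>a p (Cod Ho c')) \<odot> (c \<boxtimes> c')"

lemma covers_Comp:
  assumes "covers c d x f" "covers d e y g"
  shows "covers c e (y \<odot> x) (g \<cdot> f)"
proof -
  have s: "x \<in> Arr Ho" "f \<in> Arr \<C>" "c \<in> Arr Ho" "d \<in> Arr Ho" "y \<in> Arr Ho" "g \<in> Arr \<C>" "e \<in> Arr Ho"
     "Dom Ho c = Dom Ho x" "Dom Ho d = Cod Ho x" "Cod Ho c = Dom \<C> f" "Cod Ho d = Cod \<C> f"
     "Dom Ho y = Cod Ho x" "Dom Ho e = Cod Ho y" "Dom \<C> g = Cod \<C> f" "Cod Ho e = Cod \<C> g"
    using assms by (auto simp: covers_def)
  have "e \<odot> (y \<odot> x) = (e \<odot> y) \<odot> x" using s by simp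
  also have "\<dots> = \<gamma> g \<odot> (d \<odot> x)" using assms(2) s by (simp add: covers_def)
  also have "\<dots> = \<gamma> (g \<cdot> f) \<odot> c" using assms(1) s by (simp add: covers_def)
  finally show ?thesis using s by (simp add: covers_def)
qed

text \<open>This is how each axiom is concluded: its two sides cover one and the same arrow of
  \<open>\<C>\<close>.\<close>

lemma covers_unique:
  assumes "covers c d x f" "covers c d y f" "is_iso Ho d"
  shows "x = y"
  by (rule Ho.iso_cancel_left [OF assms(3)]) (use assms in \<open>auto simp: covers_def\<close>)

lemma covers_Id: "c \<in> Arr Ho \<Longrightarrow> Dom Ho c = A \<Longrightarrow> Cod Ho c = B \<Longrightarrow> covers c c (Id Ho A) (\<one> B)"
  by (auto simp: covers_def)

lemma comparison_simps [simp]: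
  assumes "c \<in> Arr Ho" "c' \<in> Arr Ho"
  shows "comparison c c' \<in> Arr Ho" "Dom Ho (comparison c c') = Qo (Dom Ho c) \<otimes> Qo (Dom Ho c')"
    "Cod Ho (comparison c c') = Cod Ho c \<otimes> Cod Ho c'"
  using assms by (simp_all add: comparison_def)

lemma comparison_iso:
  assumes "is_iso Ho c" "is_iso Ho c'" "cofib (Cod Ho c)" "cofib (Cod Ho c')"
  shows "is_iso Ho (comparison c c')"
proof -
  note ob = cofibrant_Obj [OF assms(3)] cofibrant_Obj [OF assms(4)]
  note Q = Q_object [OF ob(1)] Q_object [OF ob(2)]
  have "p (Cod Ho c) \<otimes>\<^sub>a p (Cod Ho c') \<in> W"
    using tensor_weq [OF Q(1) assms(3) Q(5) assms(4) Q(2,4) Q(6,8)] .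
  then show ?thesis unfolding comparison_def
    using is_iso_dtensor [OF assms(1,2)] ob Ho.is_iso_Arr [OF assms(1)] Ho.is_iso_Arr [OF assms(2)]
    by (rule_tac Ho.is_iso_Comp) auto
qed

lemma covers_tensor:
  assumes "covers c d x f" "covers c' d' y g"
  shows "covers (comparison c c') (comparison d d') (x \<boxtimes> y) (f \<otimes>\<^sub>a g)"
proof -
  have s: "x \<in> Arr Ho" "f \<in> Arr \<C>" "c \<in> Arr Ho" "d \<in> Arr Ho" "Dom Ho c = Dom Ho x" "Dom Ho d = Cod Ho x"
     "Cod Ho c = Dom \<C> f" "Cod Ho d = Cod \<C> f"
     "y \<in> Arr Ho" "g \<in> Arr \<C>" "c' \<in> Arr Ho" "d' \<in> Arr Ho" "Dom Ho c' = Dom Ho y" "Dom Ho d' = Cod Ho y"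
     "Cod Ho c' = Dom \<C> g" "Cod Ho d' = Cod \<C> g"
    and eq: "d \<odot> x = \<gamma> f \<odot> c" "d' \<odot> y = \<gamma> g \<odot> c'"
    using assms by (auto simp: covers_def)
  have "comparison d d' \<odot> (x \<boxtimes> y) = \<gamma> (p (Cod \<C> f) \<otimes>\<^sub>a p (Cod \<C> g)) \<odot> ((\<gamma> f \<odot> c) \<boxtimes> (\<gamma> g \<odot> c'))"
    using s by (simp add: comparison_def eq)
  also have "(\<gamma> f \<odot> c) \<boxtimes> (\<gamma> g \<odot> c') = \<gamma> (Qa f \<otimes>\<^sub>a Qa g) \<odot> (c \<boxtimes> c')"
    unfolding dtensor_\<gamma> [OF s(2,10), symmetric] using s by simp
  also have "\<gamma> (p (Cod \<C> f) \<otimes>\<^sub>a p (Cod \<C> g)) \<odot> (\<gamma> (Qa f \<otimes>\<^sub>a Qa g) \<odot> (c \<boxtimes> c')) = \<gamma> (f \<otimes>\<^sub>a g) \<odot> comparison c c'"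
    using s by (simp add: comparison_def)
  finally show ?thesis using s by (simp add: covers_def)
qed

text \<open>Moving the inner \<open>p \<otimes> p\<close> out of the derived tensor applies
  \<open>Q\<close> to it; naturality of \<open>p\<close> then turns the replaced map into the map
  itself after \<open>pp\<close>. The result is one image of an arrow of \<open>\<C>\<close> after
  the iterated derived tensor of \<open>c\<close>, \<open>c'\<close> and \<open>c''\<close>.\<close>

lemma comparison_left:
  assumes "c \<in> Arr Ho" "c' \<in> Arr Ho" "c'' \<in> Arr Ho"
  shows "comparison (comparison c c') c'' =
    \<gamma> (((p (Cod Ho c) \<otimes>\<^sub>a p (Cod Ho c')) \<cdot> pp (Cod Ho c) (Cod Ho c')) \<otimes>\<^sub>a p (Cod Ho c'')) \<odot> ((c \<boxtimes> c') \<boxtimes> c'')"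
proof -
  let ?m = "p (Cod Ho c) \<otimes>\<^sub>a p (Cod Ho c')"
  have "(\<gamma> ?m \<odot> (c \<boxtimes> c')) \<boxtimes> c'' = (\<gamma> ?m \<boxtimes> Id Ho (Cod Ho c'')) \<odot> ((c \<boxtimes> c') \<boxtimes> c'')"
    using assms by simp
  then show ?thesis using assms by (simp add: comparison_def dtensor_\<gamma>_Id)
qed

lemma comparison_right:
  assumes "c \<in> Arr Ho" "c' \<in> Arr Ho" "c'' \<in> Arr Ho"
  shows "comparison c (comparison c' c'') =
    \<gamma> (p (Cod Ho c) \<otimes>\<^sub>a ((p (Cod Ho c') \<otimes>\<^sub>a p (Cod Ho c'')) \<cdot> pp (Cod Ho c') (Cod Ho c''))) \<odot> (c \<boxtimes> (c' \<boxtimes> c''))"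
proof -
  let ?m = "p (Cod Ho c') \<otimes>\<^sub>a p (Cod Ho c'')"
  have "c \<boxtimes> (\<gamma> ?m \<odot> (c' \<boxtimes> c'')) = (Id Ho (Cod Ho c) \<boxtimes> \<gamma> ?m) \<odot> (c \<boxtimes> (c' \<boxtimes> c''))"
    using assms by simp
  then show ?thesis using assms by (simp add: comparison_def dtensor_\<gamma>_Id)
qed

text \<open>Naturality of the derived associator moves \<open>c\<close>, \<open>c'\<close> and
  \<open>c''\<close> to the other side and so reduces the claim to identities, where
  \<open>dassoc_covers_Id\<close> applies.\<close>

lemma covers_assoc:
  assumes c: "c \<in> hom Ho A A'" "c' \<in> hom Ho B B'" "c'' \<in> hom Ho D D'"
  shows "covers (comparison (comparison c c') c'') (comparison c (comparison c' c'')) (dassoc A B D) (\<alpha> A' B' D')"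
proof -
  note s = homD [OF c(1)] homD [OF c(2)] homD [OF c(3)]
  have ob: "A \<in> Obj \<C>" "B \<in> Obj \<C>" "D \<in> Obj \<C>" "A' \<in> Obj \<C>" "B' \<in> Obj \<C>" "D' \<in> Obj \<C>"
    using Ho.hom_Obj [OF c(1)] Ho.hom_Obj [OF c(2)] Ho.hom_Obj [OF c(3)] by auto
  have "comparison c (comparison c' c'') \<odot> dassoc A B D =
      \<gamma> (p A' \<otimes>\<^sub>a ((p B' \<otimes>\<^sub>a p D') \<cdot> pp B' D')) \<odot> ((c \<boxtimes> (c' \<boxtimes> c'')) \<odot> dassoc A B D)"
    using s ob by (simp add: comparison_right)
  also have "\<dots> = (\<gamma> (p A' \<otimes>\<^sub>a ((p B' \<otimes>\<^sub>a p D') \<cdot> pp B' D')) \<odot> dassoc A' B' D') \<odot> ((c \<boxtimes> c') \<boxtimes> c'')"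
    unfolding dassoc_natural [OF c, symmetric] using s ob by simp
  also have "\<dots> = \<gamma> (\<alpha> A' B' D') \<odot> comparison (comparison c c') c''"
    unfolding dassoc_covers_Id [OF ob(4-6)] using s ob by (simp add: comparison_left)
  finally show ?thesis using s ob by (simp add: covers_def)
qed

lemma covers_left:
  assumes c: "c \<in> hom Ho A A'"
  shows "covers (comparison (Id Ho I) c) c (dleft A) (l A')"
proof -
  note s = homD [OF c]
  have ob: "A \<in> Obj \<C>" "A' \<in> Obj \<C>" using Ho.hom_Obj [OF c] by auto
  have "c \<odot> dleft A = \<gamma> (l A') \<odot> comparison (Id Ho I) c"
    unfolding dleft_natural [OF c, symmetric] using s ob by (simp add: comparison_def dleft_eq)
  then show ?thesis using s ob by (simp add: covers_def)
qed

lemma covers_right: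
  assumes c: "c \<in> hom Ho A A'"
  shows "covers c (comparison c (Id Ho I)) (dright A) (r A')"
proof -
  note s = homD [OF c]
  have ob: "A \<in> Obj \<C>" "A' \<in> Obj \<C>" using Ho.hom_Obj [OF c] by auto
  have "comparison c (Id Ho I) \<odot> dright A = \<gamma> (p A' \<otimes>\<^sub>a p I) \<odot> ((c \<boxtimes> Id Ho I) \<odot> dright A)"
    using s ob by (simp add: comparison_def)
  also have "\<dots> = (\<gamma> (p A' \<otimes>\<^sub>a p I) \<odot> dright A') \<odot> c"
    unfolding dright_natural [OF c, symmetric] using s ob by simp
  also have "\<dots> = \<gamma> (r A') \<odot> c" unfolding dright_covers_Id [OF ob(2)] ..
  finally show ?thesis using s ob by (simp add: covers_def)
qed

section \<open>The skew monoidal axioms in the homotopy category\<close>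

lemma to_bif_hom: "A \<in> Obj \<C> \<Longrightarrow> to_bif A \<in> hom Ho A (bif A)"
  by (simp add: hom_iff)

lemma comparison_hom:
  "c \<in> hom Ho A A' \<Longrightarrow> c' \<in> hom Ho B B' \<Longrightarrow> comparison c c' \<in> hom Ho (Qo A \<otimes> Qo B) (A' \<otimes> B')"
  by (simp add: hom_iff)

text \<open>The comparisons are built from \<open>to_bif\<close> at the variable objects and from
  the identity at \<open>I\<close>, since \<open>l\<close> and \<open>r\<close> involve
  \<open>I\<close> itself. All targets are cofibrant, \<open>I\<close> by Axiom MC, and this is what
  makes the comparisons invertible. Covering is closed under composition and tensor, so a side of an
  axiom covers the corresponding composite in \<open>\<C>\<close>.\<close>

theorem derived_skew_monoidal: "skew_monoidal Ho derived_tensor I dassoc dleft dright"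
proof (intro skew_monoidal.intro skew_monoidal_axioms.intro)
  show "category Ho" by (rule ho_category)
  show "is_functor (prod_cat Ho Ho) Ho derived_tensor" by (rule derived_tensor_functor)
  show "I \<in> Obj Ho" by simp
  have I: "Id Ho I \<in> hom Ho I I" by (simp add: hom_iff)
  fix A B D E f g h A' B' D'
  show "f \<in> hom Ho A A' \<Longrightarrow> g \<in> hom Ho B B' \<Longrightarrow> h \<in> hom Ho D D' \<Longrightarrow>
      dassoc A' B' D' \<odot> ((f \<boxtimes> g) \<boxtimes> h) = (f \<boxtimes> (g \<boxtimes> h)) \<odot> dassoc A B D"
    by (rule dassoc_natural)
  show "f \<in> hom Ho A B \<Longrightarrow> dleft B \<odot> (Id Ho I \<boxtimes> f) = f \<odot> dleft A" by (rule dleft_natural)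
  show "f \<in> hom Ho A B \<Longrightarrow> dright B \<odot> f = (f \<boxtimes> Id Ho I) \<odot> dright A" by (rule dright_natural)
  show "dleft I \<odot> dright I = Id Ho I"
  proof (rule covers_unique)
    show "covers (Id Ho I) (Id Ho I) (dleft I \<odot> dright I) (\<one> I)"
      using covers_Comp [OF covers_right [OF I] covers_left [OF I]] by (simp add: l_r)
    show "covers (Id Ho I) (Id Ho I) (Id Ho I) (\<one> I)" by (rule covers_Id) auto
  qed simp
  assume "A \<in> Obj Ho"
  then have A: "A \<in> Obj \<C>" by simp
  show "dleft A \<in> hom Ho (ob derived_tensor (I, A)) A" "dright A \<in> hom Ho A (ob derived_tensor (A, I))"
    using A by (simp_all add: hom_iff)
  note a = to_bif_hom [OF A] and a1 = covers_Id [OF bif_simps(4-6) [OF A]]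
  {
    assume "D \<in> Obj Ho"
    then have D: "D \<in> Obj \<C>" by simp
    note d = to_bif_hom [OF D] and d1 = covers_Id [OF bif_simps(4-6) [OF D]]
    show "(Id Ho A \<boxtimes> dleft D) \<odot> dassoc A I D \<odot> (dright A \<boxtimes> Id Ho D) = Id Ho (ob derived_tensor (A, D))"
    proof (rule covers_unique)
      show "covers (comparison (to_bif A) (to_bif D)) (comparison (to_bif A) (to_bif D))
          ((Id Ho A \<boxtimes> dleft D) \<odot> dassoc A I D \<odot> (dright A \<boxtimes> Id Ho D)) (\<one> (bif A \<otimes> bif D))"
        using covers_Comp [OF covers_tensor [OF covers_right [OF a] d1]
            covers_Comp [OF covers_assoc [OF a I d] covers_tensor [OF a1 covers_left [OF d]]]]
        using l_\<alpha>_r [of "bif A" "bif D"] A D by simp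
    qed (use A D in \<open>auto intro!: covers_Id comparison_iso\<close>)
  }
  assume "B \<in> Obj Ho"
  then have B: "B \<in> Obj \<C>" by simp
  note b = to_bif_hom [OF B] and b1 = covers_Id [OF bif_simps(4-6) [OF B]]
  show "dassoc A B I \<odot> dright (ob derived_tensor (A, B)) = Id Ho A \<boxtimes> dright B"
  proof (rule covers_unique)
    show "covers (comparison (to_bif A) (to_bif B)) (comparison (to_bif A) (comparison (to_bif B) (Id Ho I)))
        (dassoc A B I \<odot> dright (ob derived_tensor (A, B))) (\<one> (bif A) \<otimes>\<^sub>a r (bif B))"
      using covers_Comp [OF covers_right [OF comparison_hom [OF a b]] covers_assoc [OF a b I]]
        \<alpha>_r [of "bif A" "bif B"] A B by simp
    show "covers (comparison (to_bif A) (to_bif B)) (comparison (to_bif A) (comparison (to_bif B) (Id Ho I)))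
        (Id Ho A \<boxtimes> dright B) (\<one> (bif A) \<otimes>\<^sub>a r (bif B))"
      by (rule covers_tensor [OF a1 covers_right [OF b]])
  qed (use A B I_cofibrant in \<open>auto intro!: comparison_iso tensor_cofibrant\<close>)
  assume "D \<in> Obj Ho"
  then have D: "D \<in> Obj \<C>" by simp
  note d = to_bif_hom [OF D] and d1 = covers_Id [OF bif_simps(4-6) [OF D]]
  show "dassoc A B D \<in> hom Ho (ob derived_tensor (ob derived_tensor (A, B), D))
      (ob derived_tensor (A, ob derived_tensor (B, D)))"
    using A B D by (simp add: hom_iff)
  assume "E \<in> Obj Ho"
  then have E: "E \<in> Obj \<C>" by simp
  note e = to_bif_hom [OF E] and e1 = covers_Id [OF bif_simps(4-6) [OF E]]
  let ?c = "comparison (comparison (comparison (to_bif A) (to_bif B)) (to_bif D)) (to_bif E)"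
  let ?d = "comparison (to_bif A) (comparison (to_bif B) (comparison (to_bif D) (to_bif E)))"
  let ?f = "\<alpha> (bif A) (bif B) (bif D \<otimes> bif E) \<cdot> \<alpha> (bif A \<otimes> bif B) (bif D) (bif E)"
  show "(Id Ho A \<boxtimes> dassoc B D E) \<odot> dassoc A (ob derived_tensor (B, D)) E \<odot> (dassoc A B D \<boxtimes> Id Ho E) =
      dassoc A B (ob derived_tensor (D, E)) \<odot> dassoc (ob derived_tensor (A, B)) D E"
  proof (rule covers_unique)
    show "covers ?c ?d ((Id Ho A \<boxtimes> dassoc B D E) \<odot> dassoc A (ob derived_tensor (B, D)) E \<odot> (dassoc A B D \<boxtimes> Id Ho E)) ?f"
      using covers_Comp [OF covers_tensor [OF covers_assoc [OF a b d] e1]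
          covers_Comp [OF covers_assoc [OF a comparison_hom [OF b d] e] covers_tensor [OF a1 covers_assoc [OF b d e]]]]
      using pentagon [of "bif A" "bif B" "bif D" "bif E"] A B D E by simp
    show "covers ?c ?d (dassoc A B (ob derived_tensor (D, E)) \<odot> dassoc (ob derived_tensor (A, B)) D E) ?f"
      using covers_Comp [OF covers_assoc [OF comparison_hom [OF a b] d e] covers_assoc [OF a b comparison_hom [OF d e]]]
      by simp
  qed (use A B D E in \<open>auto intro!: comparison_iso tensor_cofibrant\<close>)
next
  fix B D assume "B \<in> Obj Ho" "D \<in> Obj Ho"
  then have B: "B \<in> Obj \<C>" and D: "D \<in> Obj \<C>" by simp_all
  have I: "Id Ho I \<in> hom Ho I I" by (simp add: hom_iff)
  note b = to_bif_hom [OF B] and d = to_bif_hom [OF D] and d1 = covers_Id [OF bif_simps(4-6) [OF D]]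
  show "dleft (ob derived_tensor (B, D)) \<odot> dassoc I B D = dleft B \<boxtimes> Id Ho D"
  proof (rule covers_unique)
    show "covers (comparison (comparison (Id Ho I) (to_bif B)) (to_bif D)) (comparison (to_bif B) (to_bif D))
        (dleft (ob derived_tensor (B, D)) \<odot> dassoc I B D) (l (bif B) \<otimes>\<^sub>a \<one> (bif D))"
      using covers_Comp [OF covers_assoc [OF I b d] covers_left [OF comparison_hom [OF b d]]]
        l_\<alpha> [of "bif B" "bif D"] B D by simp
    show "covers (comparison (comparison (Id Ho I) (to_bif B)) (to_bif D)) (comparison (to_bif B) (to_bif D))
        (dleft B \<boxtimes> Id Ho D) (l (bif B) \<otimes>\<^sub>a \<one> (bif D))"
      by (rule covers_tensor [OF covers_left [OF b] d1])
  qed (use B D in \<open>auto intro!: comparison_iso\<close>)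
qed

section \<open>The main theorem\<close>

lemma dassoc_iso_iff:
  assumes "A \<in> Obj \<C>" "B \<in> Obj \<C>" "D \<in> Obj \<C>"
  shows "is_iso Ho (dassoc A B D) \<longleftrightarrow> \<alpha> (Qo A) (Qo B) (Qo D) \<in> W"
  using assms tensor_p_weq [OF assms] unfolding dassoc_eq
  by (subst Ho.is_iso_sandwich_iff) (auto simp: saturated simp del: Ho.Comp_assoc_simp)

lemma dleft_iso_iff:
  assumes "A \<in> Obj \<C>"
  shows "is_iso Ho (dleft A) \<longleftrightarrow> l (Qo A) \<in> W"
  using assms tensor_p_unit_weq [OF assms] unfolding derived_left_unit_def Let_def
  by (subst Ho.is_iso_sandwich_iff) (auto simp: saturated simp del: Ho.Comp_assoc_simp)

lemma dright_iso_iff: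
  assumes "A \<in> Obj \<C>"
  shows "is_iso Ho (dright A) \<longleftrightarrow> r (Qo A) \<in> W"
  using assms tensor_p_unit_weq [OF assms] unfolding derived_right_unit_def Let_def
  by (subst Ho.is_iso_sandwich_iff) (auto simp: saturated simp del: Ho.Comp_assoc_simp)

text \<open>The derived structure sees \<open>\<alpha>\<close> only at replaced objects. Between
  cofibrant objects the tensors of the maps \<open>p\<close> are weak equivalences, so the
  naturality square carries the property to \<open>A\<close>, \<open>B\<close> and
  \<open>D\<close>.\<close>

lemma \<alpha>_weq_cofibrant:
  assumes "cofib A" "cofib B" "cofib D" "\<alpha> (Qo A) (Qo B) (Qo D) \<in> W"
  shows "\<alpha> A B D \<in> W"
proof (rule weq_square [OF _ _ _ _ _ _ _ assms(4)])
  note ob = cofibrant_Obj [OF assms(1)] cofibrant_Obj [OF assms(2)] cofibrant_Obj [OF assms(3)]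
  note Q = Q_object [OF ob(1)] Q_object [OF ob(2)] Q_object [OF ob(3)]
  note t = tensor_cofibrant [OF Q(1,5)] tensor_cofibrant [OF Q(5,9)] tensor_cofibrant [OF assms(1,2)] tensor_cofibrant [OF assms(2,3)]
  have W2: "p A \<otimes>\<^sub>a p B \<in> W" "p B \<otimes>\<^sub>a p D \<in> W"
    by (rule tensor_weq [OF Q(1) assms(1) Q(5) assms(2) Q(2,4) Q(6,8)],
        rule tensor_weq [OF Q(5) assms(2) Q(9) assms(3) Q(6,8) Q(10,12)])
  show "(p A \<otimes>\<^sub>a p B) \<otimes>\<^sub>a p D \<in> W"
    by (rule tensor_weq [OF t(1,3) Q(9) assms(3) tensor_hom [OF Q(2,6)] W2(1) Q(10,12)])
  show "p A \<otimes>\<^sub>a (p B \<otimes>\<^sub>a p D) \<in> W"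
    by (rule tensor_weq [OF Q(1) assms(1) t(2,4) Q(2,4) tensor_hom [OF Q(6,10)] W2(2)])
  show "\<alpha> A B D \<cdot> ((p A \<otimes>\<^sub>a p B) \<otimes>\<^sub>a p D) = (p A \<otimes>\<^sub>a (p B \<otimes>\<^sub>a p D)) \<cdot> \<alpha> (Qo A) (Qo B) (Qo D)"
    by (rule \<alpha>_natural [OF Q(2,6,10)])
  show "\<alpha> (Qo A) (Qo B) (Qo D) \<in> hom \<C> ((Qo A \<otimes> Qo B) \<otimes> Qo D) (Qo A \<otimes> (Qo B \<otimes> Qo D))"
    "\<alpha> A B D \<in> hom \<C> ((A \<otimes> B) \<otimes> D) (A \<otimes> (B \<otimes> D))"
    using ob by (auto intro!: \<alpha>_hom)
  show "(p A \<otimes>\<^sub>a p B) \<otimes>\<^sub>a p D \<in> hom \<C> ((Qo A \<otimes> Qo B) \<otimes> Qo D) ((A \<otimes> B) \<otimes> D)"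
    "p A \<otimes>\<^sub>a (p B \<otimes>\<^sub>a p D) \<in> hom \<C> (Qo A \<otimes> (Qo B \<otimes> Qo D)) (A \<otimes> (B \<otimes> D))"
    using Q by (auto intro!: tensor_hom)
qed

lemma l_weq_cofibrant:
  assumes A: "cofib A" and W: "l (Qo A) \<in> W"
  shows "l A \<in> W"
proof -
  note ob = cofibrant_Obj [OF A] and Q = Q_object [OF cofibrant_Obj [OF A]]
  show ?thesis
    by (rule weq_square [OF l_hom l_hom tensor_hom [OF Id_hom Q(2)] Q(2) tensor_right_weq [OF I_cofibrant Q(1) A Q(2,4)]
          Q(4) l_natural [OF Q(2)] W])
      (use ob in auto)
qed

lemma r_weq_cofibrant:
  assumes A: "cofib A" and W: "r (Qo A) \<in> W"
  shows "r A \<in> W"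
proof -
  note ob = cofibrant_Obj [OF A] and Q = Q_object [OF cofibrant_Obj [OF A]]
  show ?thesis
    by (rule weq_square [OF r_hom r_hom Q(2) tensor_hom [OF Q(2) Id_hom] Q(4)
          tensor_left_weq [OF Q(1) A I_cofibrant Q(2,4)] r_natural [OF Q(2)] W])
      (use ob in auto)
qed

text \<open>The derived structure maps are given by formulas that do not mention the functor
  \<open>T\<^sub>l\<close>, so every witness yields the same three invertibility statements.
  Conversely \<open>derived_tensor\<close> is the witness.\<close>

theorem homotopy_monoidal_iff:
  "homotopy_monoidal \<C> W \<Phi> T I \<alpha> l r \<longleftrightarrow>
     (\<forall>A. cofib A \<longrightarrow> l A \<in> W) \<and> (\<forall>A. cofib A \<longrightarrow> r A \<in> W) \<and>
     (\<forall>A B D. cofib A \<and> cofib B \<and> cofib D \<longrightarrow> \<alpha> A B D \<in> W)"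
proof
  assume "homotopy_monoidal \<C> W \<Phi> T I \<alpha> l r"
  then obtain T\<^sub>l where "genuinely_monoidal Ho T\<^sub>l I dassoc dleft dright"
    unfolding homotopy_monoidal_def by blast
  then interpret gm: genuinely_monoidal Ho T\<^sub>l I dassoc dleft dright .
  show "(\<forall>A. cofib A \<longrightarrow> l A \<in> W) \<and> (\<forall>A. cofib A \<longrightarrow> r A \<in> W) \<and>
     (\<forall>A B D. cofib A \<and> cofib B \<and> cofib D \<longrightarrow> \<alpha> A B D \<in> W)"
    using gm.\<alpha>_iso gm.l_iso gm.r_iso dassoc_iso_iff dleft_iso_iff dright_iso_iff cofibrant_Obj
      \<alpha>_weq_cofibrant l_weq_cofibrant r_weq_cofibrant by simp
next
  assume W: "(\<forall>A. cofib A \<longrightarrow> l A \<in> W) \<and> (\<forall>A. cofib A \<longrightarrow> r A \<in> W) \<and>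
     (\<forall>A B D. cofib A \<and> cofib B \<and> cofib D \<longrightarrow> \<alpha> A B D \<in> W)"
  have "genuinely_monoidal Ho derived_tensor I dassoc dleft dright"
    using derived_skew_monoidal
    by (rule genuinely_monoidal.intro, intro genuinely_monoidal_axioms.intro)
      (use W Q_object(1) in \<open>simp_all add: dassoc_iso_iff dleft_iso_iff dright_iso_iff\<close>)
  then show "homotopy_monoidal \<C> W \<Phi> T I \<alpha> l r"
    unfolding homotopy_monoidal_def using is_derived_tensor_derived_tensor by blast
qed

end

theorem theorem5p12:
  fixes \<C> :: "('o, 'a) cat"
    and W Cof Fib :: "'a set"
    and \<Phi> \<Psi> :: "('o, 'a) ffact"
    and T H :: "('o \<times> 'o, 'a \<times> 'a, 'o, 'a) func"
    and I :: "'o"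
    and \<alpha> L :: "'o \<Rightarrow> 'o \<Rightarrow> 'o \<Rightarrow> 'a"
    and l r i j :: "'o \<Rightarrow> 'a"
    and \<phi> :: "'o \<Rightarrow> 'o \<Rightarrow> 'o \<Rightarrow> 'a \<Rightarrow> 'a"
  assumes "model_category \<C> W Cof Fib \<Phi> \<Psi>"
    and "monoidal_skew_closed \<C> T H I \<alpha> l r L i j \<phi>"
    and "axiom_MC \<C> W Cof T I"
  shows "homotopy_monoidal \<C> W \<Phi> T I \<alpha> l r \<longleftrightarrow>
    (\<forall>A B. cofibrant \<C> Cof A \<and> fibrant \<C> Fib B \<longrightarrow>
       bij_on_homotopy_classes \<C> W Cof Fib A B I (ob H (A, B)) (v_map \<C> H j A)) \<and>
    (\<forall>A. fibrant \<C> Fib A \<longrightarrow> i A \<in> W) \<and>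
    (\<forall>A B D. cofibrant \<C> Cof A \<and> cofibrant \<C> Cof B \<and> fibrant \<C> Fib D \<longrightarrow>
       t_map \<C> T H L \<phi> A B D \<in> W)"
proof -
  interpret monoidal_skew_closed_model \<C> W Cof Fib \<Phi> \<Psi> T H I \<alpha> l r L i j \<phi>
    by (rule monoidal_skew_closed_model.intro [OF assms(1,2) monoidal_skew_closed_model_axioms.intro [OF assms(3)]])
  have "(\<forall>A B. cofibrant \<C> Cof A \<and> fibrant \<C> Fib B \<longrightarrow>
       bij_on_homotopy_classes \<C> W Cof Fib A B I (ob H (A, B)) (v_map \<C> H j A)) \<longleftrightarrow>
     (\<forall>A. cofibrant \<C> Cof A \<longrightarrow> l A \<in> W)"
    using v_bij_iff by blast
  moreover have "(\<forall>A B D. cofibrant \<C> Cof A \<and> cofibrant \<C> Cof B \<and> fibrant \<C> Fib D \<longrightarrow>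
       t_map \<C> T H L \<phi> A B D \<in> W) \<longleftrightarrow>
     (\<forall>A B D. cofibrant \<C> Cof A \<and> cofibrant \<C> Cof B \<and> cofibrant \<C> Cof D \<longrightarrow> \<alpha> A B D \<in> W)"
    using t_weq_iff by blast
  ultimately show ?thesis unfolding homotopy_monoidal_iff using i_weq_iff by simp
qed

end
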